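(* Let $\mathcal C$ be a weak model category and let $I$ be a pseudo-generating set of cofibrations of $\mathcal C$ (each with cofibrant domain). Then a map $f\colon X\to Y$ between fibrant objects is an equivalence if and only if, for all $i\colon A\hookrightarrow B$ in $I$ and all $x\colon A\to X$, the induced morphism of setoids $\pi_i(X,x)\to\pi_i(Y,f\circ x)$ (post-composition with $f$) is a surjection of setoids.
   Context: Weak model category: a category with a class of cofibrations (containing isomorphisms with cofibrant domain, closed under composition, cofibrant initial object $0$, closed under pushout along maps between cofibrant objects) and a class of fibrations (dual); acyclic fibration: fibration with the right lifting property against all cofibrations between cofibrant objects; acyclic cofibration: cofibration with the left lifting property against all fibrations between fibrant objects; every map from a cofibrant to a fibrant object factors as cofibration then acyclic fibration and as acyclic cofibration then fibration; every cofibration $A\to B$ from a cofibrant to a fibrant object has a relative strong cylinder object $B\sqcup_AB\hookrightarrow I_AB\to B$ (first map a cofibration, restriction to the first $B$ an acyclic cofibration), and dually for fibrations and relative strong path objects. Equivalence: a map between objects that are fibrant or cofibrant which becomes invertible after localizing the full subcategory of such objects at acyclic cofibrations with cofibrant domain and acyclic fibrations with fibrant target. A set $I$ of cofibrations is pseudo-generating if every fibration between fibrant objects having the right lifting property against all maps of $I$ is an acyclic fibration. For a cofibration $i\colon A\hookrightarrow B$ with $A$ cofibrant, a fibrant $X$ and a map $x\colon A\to X$, the setoid $\pi_i(X,x)$ has as elements the maps $u\colon B\to X$ with $u\circ i=x$, and as relations from $u$ to $v$ the homotopies relative to $A$, i.e. maps $I_AB\to X$ restricting to $(u,v)$ on $B\sqcup_AB$,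 for a fixed relative weak cylinder object of $i$ (a cofibration $B\sqcup_AB\hookrightarrow I_AB$ with a map $I_AB\to D_AB$ and an acyclic cofibration $B\to D_AB$ forming a commutative square with the codiagonal, such that the first map $B\to I_AB$ is an acyclic cofibration); this is the hom-setoid $\mathrm{Hom}_{\mathrm{Ho}(A/\mathcal C)}(B,X)$, independent of choices up to isomorphism. A setoid is a set with a set of relations $a\colon x\Rightarrow y$ equipped with chosen reflexivity, symmetry and transitivity operations. A setoid morphism $g\colon S\to T$ is a surjection if for each $t\in T$ there are a chosen $s\in S$ and a chosen relation $t\Rightarrow g(s)$. *)

theory Defs
  imports Main
begin

record ('o, 'm) cat =
  Ob  :: "'o set"
  Ar  :: "'m set"
  src :: "'m \<Rightarrow> 'o"
  tgt :: "'m \<Rightarrow> 'o"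
  idm :: "'o \<Rightarrow> 'm"
  cmp :: "'m \<Rightarrow> 'm \<Rightarrow> 'm"   (* cmp C g f = g \<circ> f *)

definition hom :: "('o, 'm, 'x) cat_scheme \<Rightarrow> 'o \<Rightarrow> 'o \<Rightarrow> 'm \<Rightarrow> bool" where
  "hom C x y f \<longleftrightarrow> f \<in> Ar C \<and> src C f = x \<and> tgt C f = y"

definition category :: "('o, 'm, 'x) cat_scheme \<Rightarrow> bool" where
  "category C \<longleftrightarrow>
     (\<forall>f\<in>Ar C. src C f \<in> Ob C \<and> tgt C f \<in> Ob C) \<and>
     (\<forall>x\<in>Ob C. hom C x x (idm C x)) \<and>
     (\<forall>f g. f \<in> Ar C \<and> g \<in> Ar C \<and> tgt C f = src C g \<longrightarrow>
        hom C (src C f) (tgt C g) (cmp C g f)) \<and>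
     (\<forall>f\<in>Ar C. cmp C f (idm C (src C f)) = f \<and> cmp C (idm C (tgt C f)) f = f) \<and>
     (\<forall>f g h. f \<in> Ar C \<and> g \<in> Ar C \<and> h \<in> Ar C \<and> tgt C f = src C g \<and> tgt C g = src C h \<longrightarrow>
        cmp C h (cmp C g f) = cmp C (cmp C h g) f)"

definition iso :: "('o, 'm, 'x) cat_scheme \<Rightarrow> 'm \<Rightarrow> bool" where
  "iso C f \<longleftrightarrow> f \<in> Ar C \<and> (\<exists>g. hom C (tgt C f) (src C f) g \<and>
      cmp C g f = idm C (src C f) \<and> cmp C f g = idm C (tgt C f))"

definition initial :: "('o, 'm, 'x) cat_scheme \<Rightarrow> 'o \<Rightarrow> bool" where
  "initial C z \<longleftrightarrow> z \<in> Ob C \<and> (\<forall>x\<in>Ob C. \<exists>!m. hom C z x m)"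

definition terminal :: "('o, 'm, 'x) cat_scheme \<Rightarrow> 'o \<Rightarrow> bool" where
  "terminal C t \<longleftrightarrow> t \<in> Ob C \<and> (\<forall>x\<in>Ob C. \<exists>!m. hom C x t m)"

definition is_pushout :: "('o, 'm, 'x) cat_scheme \<Rightarrow> 'm \<Rightarrow> 'm \<Rightarrow> 'm \<Rightarrow> 'm \<Rightarrow> bool" where
  "is_pushout C f g f' g' \<longleftrightarrow>
     f \<in> Ar C \<and> g \<in> Ar C \<and> src C g = src C f \<and>
     hom C (tgt C g) (tgt C f') f' \<and> hom C (tgt C f) (tgt C f') g' \<and>
     cmp C g' f = cmp C f' g \<and>
     (\<forall>u v. hom C (tgt C f) (tgt C u) u \<and> hom C (tgt C g) (tgt C u) v \<and> cmp C u f = cmp C v g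
        \<longrightarrow> (\<exists>!h. hom C (tgt C f') (tgt C u) h \<and> cmp C h g' = u \<and> cmp C h f' = v))"

definition is_pullback :: "('o, 'm, 'x) cat_scheme \<Rightarrow> 'm \<Rightarrow> 'm \<Rightarrow> 'm \<Rightarrow> 'm \<Rightarrow> bool" where
  "is_pullback C p g p' g' \<longleftrightarrow>
     p \<in> Ar C \<and> g \<in> Ar C \<and> tgt C g = tgt C p \<and>
     hom C (src C p') (src C g) p' \<and> hom C (src C p') (src C p) g' \<and>
     cmp C p g' = cmp C g p' \<and>
     (\<forall>u v. hom C (src C u) (src C p) u \<and> hom C (src C u) (src C g) v \<and> cmp C p u = cmp C g v
        \<longrightarrow> (\<exists>!h. hom C (src C u) (src C p') h \<and> cmp C g' h = u \<and> cmp C p' h = v))"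

definition lifts :: "('o, 'm, 'x) cat_scheme \<Rightarrow> 'm \<Rightarrow> 'm \<Rightarrow> bool" where
  "lifts C i p \<longleftrightarrow>
     (\<forall>a b. hom C (src C i) (src C p) a \<and> hom C (tgt C i) (tgt C p) b \<and> cmp C p a = cmp C b i
        \<longrightarrow> (\<exists>h. hom C (tgt C i) (src C p) h \<and> cmp C h i = a \<and> cmp C p h = b))"

record ('o, 'm) wcat = "('o, 'm) cat" +
  cof  :: "'m set"
  fib  :: "'m set"
  zero :: 'o
  one  :: 'o

definition cofibrant :: "('o, 'm) wcat \<Rightarrow> 'o \<Rightarrow> bool" where
  "cofibrant M X \<longleftrightarrow> X \<in> Ob M \<and> (\<exists>m. hom M (zero M) X m \<and> m \<in> cof M)"

definition fibrant :: "('o, 'm) wcat \<Rightarrow> 'o \<Rightarrow> bool" where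
  "fibrant M X \<longleftrightarrow> X \<in> Ob M \<and> (\<exists>m. hom M X (one M) m \<and> m \<in> fib M)"

definition acyc_fib :: "('o, 'm) wcat \<Rightarrow> 'm \<Rightarrow> bool" where
  "acyc_fib M p \<longleftrightarrow> p \<in> fib M \<and>
     (\<forall>i\<in>cof M. cofibrant M (src M i) \<and> cofibrant M (tgt M i) \<longrightarrow> lifts M i p)"

definition acyc_cof :: "('o, 'm) wcat \<Rightarrow> 'm \<Rightarrow> bool" where
  "acyc_cof M i \<longleftrightarrow> i \<in> cof M \<and>
     (\<forall>p\<in>fib M. fibrant M (src M p) \<and> fibrant M (tgt M p) \<longrightarrow> lifts M i p)"

definition weak_model_category :: "('o, 'm) wcat \<Rightarrow> bool" where
  "weak_model_category M \<longleftrightarrow>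
     category M \<and> initial M (zero M) \<and> terminal M (one M) \<and>
     cof M \<subseteq> Ar M \<and> fib M \<subseteq> Ar M \<and>
     \<comment> \<open>cofibrations\<close>
     (\<forall>f. iso M f \<and> cofibrant M (src M f) \<longrightarrow> f \<in> cof M) \<and>
     (\<forall>f g. f \<in> cof M \<and> g \<in> cof M \<and> tgt M f = src M g \<longrightarrow> cmp M g f \<in> cof M) \<and>
     idm M (zero M) \<in> cof M \<and>
     (\<forall>i g. i \<in> cof M \<and> g \<in> Ar M \<and> src M g = src M i \<and>
          cofibrant M (src M g) \<and> cofibrant M (tgt M g) \<longrightarrow>
        (\<exists>i' g'. is_pushout M i g i' g') \<and> (\<forall>i' g'. is_pushout M i g i' g' \<longrightarrow> i' \<in> cof M)) \<and>
     \<comment> \<open>fibrations (dual)\<close>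
     (\<forall>f. iso M f \<and> fibrant M (tgt M f) \<longrightarrow> f \<in> fib M) \<and>
     (\<forall>f g. f \<in> fib M \<and> g \<in> fib M \<and> tgt M f = src M g \<longrightarrow> cmp M g f \<in> fib M) \<and>
     idm M (one M) \<in> fib M \<and>
     (\<forall>p g. p \<in> fib M \<and> g \<in> Ar M \<and> tgt M g = tgt M p \<and>
          fibrant M (src M g) \<and> fibrant M (tgt M g) \<longrightarrow>
        (\<exists>p' g'. is_pullback M p g p' g') \<and> (\<forall>p' g'. is_pullback M p g p' g' \<longrightarrow> p' \<in> fib M)) \<and>
     \<comment> \<open>factorizations\<close>
     (\<forall>f\<in>Ar M. cofibrant M (src M f) \<and> fibrant M (tgt M f) \<longrightarrow>
        (\<exists>i p. i \<in> cof M \<and> acyc_fib M p \<and> tgt M i = src M p \<and> cmp M p i = f) \<and>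
        (\<exists>j q. acyc_cof M j \<and> q \<in> fib M \<and> tgt M j = src M q \<and> cmp M q j = f)) \<and>
     \<comment> \<open>relative strong cylinder objects\<close>
     (\<forall>i\<in>cof M. cofibrant M (src M i) \<and> fibrant M (tgt M i) \<longrightarrow>
        (\<exists>i1 i2 c q. is_pushout M i i i2 i1 \<and> c \<in> cof M \<and> src M c = tgt M i1 \<and>
           hom M (tgt M c) (tgt M i) q \<and>
           cmp M q (cmp M c i1) = idm M (tgt M i) \<and> cmp M q (cmp M c i2) = idm M (tgt M i) \<and>
           acyc_cof M (cmp M c i1))) \<and>
     \<comment> \<open>relative strong path objects (dual)\<close>
     (\<forall>p\<in>fib M. cofibrant M (src M p) \<and> fibrant M (tgt M p) \<longrightarrow>
        (\<exists>p1 p2 q j. is_pullback M p p p2 p1 \<and> q \<in> fib M \<and> tgt M q = src M p1 \<and>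
           hom M (src M p) (src M q) j \<and>
           cmp M p1 (cmp M q j) = idm M (src M p) \<and> cmp M p2 (cmp M q j) = idm M (src M p) \<and>
           acyc_fib M (cmp M p1 q)))"

definition fc_obj :: "('o, 'm) wcat \<Rightarrow> 'o set" where
  "fc_obj M = {X \<in> Ob M. fibrant M X \<or> cofibrant M X}"

definition weq_gen :: "('o, 'm) wcat \<Rightarrow> 'm set" where
  "weq_gen M = {w. acyc_cof M w \<and> cofibrant M (src M w)} \<union> {w. acyc_fib M w \<and> fibrant M (tgt M w)}"

definition sub_hom :: "('o, 'm) wcat \<Rightarrow> 'm \<Rightarrow> bool" where
  "sub_hom M f \<longleftrightarrow> f \<in> Ar M \<and> src M f \<in> fc_obj M \<and> tgt M f \<in> fc_obj M"

text \<open>Zigzags (Gabriel--Zisman): a list of steps read left to right; (True, f) is a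
  forward arrow f of the full subcategory, (False, w) a formal inverse of w in W.\<close>
inductive zz_path :: "('o, 'm) wcat \<Rightarrow> 'o \<Rightarrow> (bool \<times> 'm) list \<Rightarrow> 'o \<Rightarrow> bool" for M where
  zz_nil: "x \<in> fc_obj M \<Longrightarrow> zz_path M x [] x"
| zz_fwd: "sub_hom M f \<Longrightarrow> zz_path M (tgt M f) ss y \<Longrightarrow> zz_path M (src M f) ((True, f) # ss) y"
| zz_bwd: "w \<in> weq_gen M \<Longrightarrow> sub_hom M w \<Longrightarrow> zz_path M (src M w) ss y \<Longrightarrow>
             zz_path M (tgt M w) ((False, w) # ss) y"

text \<open>The congruence on zigzags whose quotient is the localization.\<close>
inductive zz_eq :: "('o, 'm) wcat \<Rightarrow> 'o \<Rightarrow> 'o \<Rightarrow> (bool \<times> 'm) list \<Rightarrow> (bool \<times> 'm) list \<Rightarrow> bool"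
  for M where
  zz_id: "x \<in> fc_obj M \<Longrightarrow> zz_eq M x x [(True, idm M x)] []"
| zz_comp: "sub_hom M f \<Longrightarrow> sub_hom M g \<Longrightarrow> tgt M f = src M g \<Longrightarrow>
              zz_eq M (src M f) (tgt M g) [(True, f), (True, g)] [(True, cmp M g f)]"
| zz_inv1: "w \<in> weq_gen M \<Longrightarrow> sub_hom M w \<Longrightarrow> zz_eq M (src M w) (src M w) [(True, w), (False, w)] []"
| zz_inv2: "w \<in> weq_gen M \<Longrightarrow> sub_hom M w \<Longrightarrow> zz_eq M (tgt M w) (tgt M w) [(False, w), (True, w)] []"
| zz_refl: "zz_path M x ss y \<Longrightarrow> zz_eq M x y ss ss"
| zz_sym: "zz_eq M x y ss ts \<Longrightarrow> zz_eq M x y ts ss"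
| zz_trans: "zz_eq M x y ss ts \<Longrightarrow> zz_eq M x y ts us \<Longrightarrow> zz_eq M x y ss us"
| zz_ctx: "zz_path M a as x \<Longrightarrow> zz_eq M x y ss ts \<Longrightarrow> zz_path M y bs b \<Longrightarrow>
             zz_eq M a b (as @ ss @ bs) (as @ ts @ bs)"

definition equivalence :: "('o, 'm) wcat \<Rightarrow> 'm \<Rightarrow> bool" where
  "equivalence M f \<longleftrightarrow> sub_hom M f \<and>
     (\<exists>g. zz_path M (tgt M f) g (src M f) \<and>
          zz_eq M (src M f) (src M f) ((True, f) # g) [] \<and>
          zz_eq M (tgt M f) (tgt M f) (g @ [(True, f)]) [])"

definition pseudo_generating :: "('o, 'm) wcat \<Rightarrow> 'm set \<Rightarrow> bool" where
  "pseudo_generating M I \<longleftrightarrow> I \<subseteq> cof M \<and>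
     (\<forall>p\<in>fib M. fibrant M (src M p) \<and> fibrant M (tgt M p) \<and> (\<forall>i\<in>I. lifts M i p) \<longrightarrow> acyc_fib M p)"

definition rel_weak_cyl :: "('o, 'm) wcat \<Rightarrow> 'm \<Rightarrow> 'm \<Rightarrow> 'm \<Rightarrow> 'm \<Rightarrow> 'm \<Rightarrow> 'm \<Rightarrow> bool" where
  "rel_weak_cyl M i i1 i2 c d e \<longleftrightarrow>
     is_pushout M i i i2 i1 \<and> c \<in> cof M \<and> src M c = tgt M i1 \<and>
     d \<in> Ar M \<and> src M d = tgt M c \<and> acyc_cof M e \<and> src M e = tgt M i \<and> tgt M d = tgt M e \<and>
     cmp M d (cmp M c i1) = e \<and> cmp M d (cmp M c i2) = e \<and> acyc_cof M (cmp M c i1)"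

definition pi_el :: "('o, 'm) wcat \<Rightarrow> 'm \<Rightarrow> 'o \<Rightarrow> 'm \<Rightarrow> 'm \<Rightarrow> bool" where
  "pi_el M i X x u \<longleftrightarrow> hom M (tgt M i) X u \<and> cmp M u i = x"

text \<open>Relations u \<Rightarrow> v in \<pi>_i(X, x): homotopies h : I_A B \<rightarrow> X relative to A.\<close>
definition rel_htpy :: "('o, 'm) wcat \<Rightarrow> 'm \<Rightarrow> 'm \<Rightarrow> 'm \<Rightarrow> 'o \<Rightarrow> 'm \<Rightarrow> 'm \<Rightarrow> 'm \<Rightarrow> bool" where
  "rel_htpy M i1 i2 c X u v h \<longleftrightarrow>
     hom M (tgt M c) X h \<and> cmp M h (cmp M c i1) = u \<and> cmp M h (cmp M c i2) = v"

definition pi_surj :: "('o, 'm) wcat \<Rightarrow> 'm \<Rightarrow> 'm \<Rightarrow> 'm \<Rightarrow> 'm \<Rightarrow> 'm \<Rightarrow> 'm \<Rightarrow> bool" where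
  "pi_surj M i i1 i2 c f x \<longleftrightarrow>
     (\<forall>v. pi_el M i (tgt M f) (cmp M f x) v \<longrightarrow>
        (\<exists>u. pi_el M i (src M f) x u \<and> (\<exists>h. rel_htpy M i1 i2 c (tgt M f) v (cmp M f u) h)))"

end

theory Submission
  imports Defs
begin

text \<open>Take cofibrant replacements $X' \to X$ and $Y' \to Y$, lift f to $X' \to Y'$ and factor its graph
  $X' \to X' \times Y'$ as an acyclic cofibration s followed by a fibration $(r, q)$. Then r is an
  acyclic fibration, and by two out of three f is an equivalence iff the fibration q is one.

  A fibration q of bifibrant objects is an equivalence iff it is acyclic. An equivalence induces
  bijections on homotopy classes of maps out of bifibrant objects, hence q has a homotopy inverse g,
  which may be taken to be a section. Given a lifting problem $(a, b)$, transport it along the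
  homotopy $g q a \sim a$ to a problem $(g q a, b')$, which is solved by $g b'$.

  Finally q has the lifting property against i iff f is surjective on the setoids of i: since r is
  an acyclic fibration with section s, every lifting problem against q is homotopic to one of the
  form $(s x, b)$, and solving that one up to homotopy relative to A is surjectivity at x.\<close>

text \<open>Why the graph: factoring X' -> Y' itself would also give an acyclic cofibration s with a
  retraction, but that retraction need not be a fibration. The setoid argument needs the homotopy
  from w to s r w relative to A, and it is found by lifting the constant homotopy at r w along r. So
  r has to be an acyclic fibration, and the projection to X' makes it one.

  The obstacle is that acyclicity is a lifting property with no two out of three built in. Two out
  of three for \<open>equivalence\<close> is formal, but it never returns an acyclic map. Acyclicity
  is therefore derived from sections and retractions by explicit homotopies, in
  \<open>fib_section_acyc_fib\<close>, \<open>cof_retraction_acyc_cof\<close> and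
  \<open>acyc_fib_cancel\<close>. In addition, factorizations go from cofibrant to fibrant objects
  only, and zigzags may pass through cofibrant objects that are not fibrant, so what detects
  equivalences must be defined there as well.\<close>

locale weak_model =
  fixes M :: "('o, 'm) wcat"
  assumes wmc: "weak_model_category M"
begin

abbreviation comp (infixr "\<cdot>" 70)
  where "g \<cdot> f \<equiv> cmp M g f"

abbreviation arr ("\<guillemotleft>_ : _ \<rightarrow> _\<guillemotright>")
  where "\<guillemotleft>f : x \<rightarrow> y\<guillemotright> \<equiv> hom M x y f"

abbreviation bifibrant
  where "bifibrant X \<equiv> cofibrant M X \<and> fibrant M X"

section \<open>Axioms, composition, and closure properties of cofibrations and fibrations\<close>

lemma pushout_axiom:
  "\<forall>i g. i \<in> cof M \<and> g \<in> Ar M \<and> src M g = src M i \<and>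
      cofibrant M (src M g) \<and> cofibrant M (tgt M g) \<longrightarrow>
    (\<exists>i' g'. is_pushout M i g i' g') \<and> (\<forall>i' g'. is_pushout M i g i' g' \<longrightarrow> i' \<in> cof M)"
  using wmc unfolding weak_model_category_def by (elim conjE)

lemma pullback_axiom:
  "\<forall>p g. p \<in> fib M \<and> g \<in> Ar M \<and> tgt M g = tgt M p \<and>
      fibrant M (src M g) \<and> fibrant M (tgt M g) \<longrightarrow>
    (\<exists>p' g'. is_pullback M p g p' g') \<and> (\<forall>p' g'. is_pullback M p g p' g' \<longrightarrow> p' \<in> fib M)"
  using wmc unfolding weak_model_category_def by (elim conjE)

lemma factor_axiom:
  "\<forall>f\<in>Ar M. cofibrant M (src M f) \<and> fibrant M (tgt M f) \<longrightarrow>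
    (\<exists>i p. i \<in> cof M \<and> acyc_fib M p \<and> tgt M i = src M p \<and> p \<cdot> i = f) \<and>
    (\<exists>j q. acyc_cof M j \<and> q \<in> fib M \<and> tgt M j = src M q \<and> q \<cdot> j = f)"
  using wmc unfolding weak_model_category_def by (elim conjE)

lemma category: "category M"
  using wmc by (simp add: weak_model_category_def)

lemma arr_Ob:
  assumes "\<guillemotleft>f : x \<rightarrow> y\<guillemotright>"
  shows "x \<in> Ob M" "y \<in> Ob M"
  using assms category by (auto simp: category_def hom_def)

lemma id_arr: "x \<in> Ob M \<Longrightarrow> \<guillemotleft>idm M x : x \<rightarrow> x\<guillemotright>"
  using category by (simp add: category_def)

lemma comp_arr [intro]: "\<lbrakk>\<guillemotleft>f : x \<rightarrow> y\<guillemotright>; \<guillemotleft>g : y \<rightarrow> z\<guillemotright>\<rbrakk> \<Longrightarrow> \<guillemotleft>g \<cdot> f : x \<rightarrow> z\<guillemotright>"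
  using category by (auto simp: category_def hom_def)

lemma comp_Ar [simp]:
  assumes "f \<in> Ar M" "g \<in> Ar M" "tgt M f = src M g"
  shows "g \<cdot> f \<in> Ar M" "src M (g \<cdot> f) = src M f" "tgt M (g \<cdot> f) = tgt M g"
  using category assms unfolding category_def hom_def by blast+

lemma comp_assoc [simp]:
  assumes "f \<in> Ar M" "g \<in> Ar M" "h \<in> Ar M" "tgt M f = src M g" "tgt M g = src M h"
  shows "(h \<cdot> g) \<cdot> f = h \<cdot> g \<cdot> f"
  using category assms unfolding category_def by metis

lemma comp_id_right [simp]: "f \<in> Ar M \<Longrightarrow> src M f = x \<Longrightarrow> f \<cdot> idm M x = f"
  using category unfolding category_def by auto

lemma comp_id_left [simp]: "f \<in> Ar M \<Longrightarrow> tgt M f = x \<Longrightarrow> idm M x \<cdot> f = f"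
  using category unfolding category_def by auto

text \<open>With composites normalised to the right, an equation between binary composites only
  rewrites inside longer ones in this form.\<close>

lemma comp_eq_extend:
  assumes "g \<cdot> f = k" "f \<in> Ar M" "g \<in> Ar M" "tgt M f = src M g" "x \<in> Ar M" "tgt M x = src M f"
  shows "g \<cdot> f \<cdot> x = k \<cdot> x"
  using assms comp_assoc[of x f g] by simp

lemma comp_square_extend:
  assumes "g \<cdot> f = g' \<cdot> f'" "f \<in> Ar M" "g \<in> Ar M" "tgt M f = src M g"
    "f' \<in> Ar M" "g' \<in> Ar M" "tgt M f' = src M g'" "src M f' = src M f"
    "x \<in> Ar M" "tgt M x = src M f"
  shows "g \<cdot> f \<cdot> x = g' \<cdot> f' \<cdot> x"
  using assms comp_assoc[of x f g] comp_assoc[of x f' g'] by simp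

lemma cof_Ar: "i \<in> cof M \<Longrightarrow> i \<in> Ar M"
  using wmc by (auto simp: weak_model_category_def)

lemma fib_Ar: "p \<in> fib M \<Longrightarrow> p \<in> Ar M"
  using wmc by (auto simp: weak_model_category_def)

lemma cof_comp: "\<lbrakk>f \<in> cof M; g \<in> cof M; tgt M f = src M g\<rbrakk> \<Longrightarrow> g \<cdot> f \<in> cof M"
  using wmc by (auto simp: weak_model_category_def)

lemma fib_comp: "\<lbrakk>f \<in> fib M; g \<in> fib M; tgt M f = src M g\<rbrakk> \<Longrightarrow> g \<cdot> f \<in> fib M"
  using wmc by (auto simp: weak_model_category_def)

lemma fibrant_Ob: "fibrant M X \<Longrightarrow> X \<in> Ob M"
  by (simp add: fibrant_def)

lemma initial_zero: "initial M (zero M)" and terminal_one: "terminal M (one M)"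
  using wmc by (auto simp: weak_model_category_def)

lemma id_zero_cof: "idm M (zero M) \<in> cof M" and id_one_fib: "idm M (one M) \<in> fib M"
  using wmc by (auto simp: weak_model_category_def)

lemma from_zero_unique: "\<lbrakk>\<guillemotleft>f : zero M \<rightarrow> x\<guillemotright>; \<guillemotleft>g : zero M \<rightarrow> x\<guillemotright>\<rbrakk> \<Longrightarrow> f = g"
  using initial_zero arr_Ob unfolding initial_def by blast

lemma to_one_unique: "\<lbrakk>\<guillemotleft>f : x \<rightarrow> one M\<guillemotright>; \<guillemotleft>g : x \<rightarrow> one M\<guillemotright>\<rbrakk> \<Longrightarrow> f = g"
  using terminal_one arr_Ob unfolding terminal_def by blast

lemma to_one_ex: "x \<in> Ob M \<Longrightarrow> \<exists>f. \<guillemotleft>f : x \<rightarrow> one M\<guillemotright>"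
  using terminal_one unfolding terminal_def by blast

lemma cofibrant_zero: "cofibrant M (zero M)"
  using id_zero_cof initial_zero id_arr unfolding cofibrant_def initial_def by blast

lemma fibrant_one: "fibrant M (one M)"
  using id_one_fib terminal_one id_arr unfolding fibrant_def terminal_def by blast

lemma cofibrant_tgt:
  assumes "i \<in> cof M" "\<guillemotleft>i : A \<rightarrow> B\<guillemotright>" "cofibrant M A"
  shows "cofibrant M B"
proof -
  obtain m where "\<guillemotleft>m : zero M \<rightarrow> A\<guillemotright>" "m \<in> cof M"
    using assms(3) by (auto simp: cofibrant_def)
  then have "i \<cdot> m \<in> cof M" "\<guillemotleft>i \<cdot> m : zero M \<rightarrow> B\<guillemotright>"
    using assms cof_comp by (auto simp: hom_def)
  then show ?thesis using arr_Ob by (auto simp: cofibrant_def)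
qed

lemma fibrant_src:
  assumes "p \<in> fib M" "\<guillemotleft>p : E \<rightarrow> Y\<guillemotright>" "fibrant M Y"
  shows "fibrant M E"
proof -
  obtain m where "\<guillemotleft>m : Y \<rightarrow> one M\<guillemotright>" "m \<in> fib M"
    using assms(3) by (auto simp: fibrant_def)
  then have "m \<cdot> p \<in> fib M" "\<guillemotleft>m \<cdot> p : E \<rightarrow> one M\<guillemotright>"
    using assms fib_comp by (auto simp: hom_def)
  then show ?thesis using arr_Ob by (auto simp: fibrant_def)
qed

section \<open>Lifting properties and factorizations\<close>

lemma acyc_fib_fib: "acyc_fib M p \<Longrightarrow> p \<in> fib M"
  by (simp add: acyc_fib_def)

lemma acyc_cof_cof: "acyc_cof M i \<Longrightarrow> i \<in> cof M"
  by (simp add: acyc_cof_def)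

text \<open>\<open>acyc_fib\<close> asks for both ends of i to be cofibrant; composing 0 -> A with i
  takes care of B.\<close>

lemma acyc_fib_lift:
  assumes "acyc_fib M p" "\<guillemotleft>p : E \<rightarrow> Y\<guillemotright>" "i \<in> cof M" "\<guillemotleft>i : A \<rightarrow> B\<guillemotright>" "cofibrant M A"
    "\<guillemotleft>a : A \<rightarrow> E\<guillemotright>" "\<guillemotleft>b : B \<rightarrow> Y\<guillemotright>" "p \<cdot> a = b \<cdot> i"
  obtains h where "\<guillemotleft>h : B \<rightarrow> E\<guillemotright>" "h \<cdot> i = a" "p \<cdot> h = b"
proof -
  have "lifts M i p"
    using assms cofibrant_tgt[of i A B] by (auto simp: acyc_fib_def hom_def)
  then have "\<exists>h. \<guillemotleft>h : B \<rightarrow> E\<guillemotright> \<and> h \<cdot> i = a \<and> p \<cdot> h = b"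
    using assms by (auto simp: lifts_def hom_def)
  then show thesis using that by blast
qed

text \<open>Dually, fibrancy of the base suffices, since E -> Y -> 1 is then a fibration.\<close>

lemma acyc_cof_lift:
  assumes "acyc_cof M i" "\<guillemotleft>i : A \<rightarrow> B\<guillemotright>" "p \<in> fib M" "\<guillemotleft>p : E \<rightarrow> Y\<guillemotright>" "fibrant M Y"
    "\<guillemotleft>a : A \<rightarrow> E\<guillemotright>" "\<guillemotleft>b : B \<rightarrow> Y\<guillemotright>" "p \<cdot> a = b \<cdot> i"
  obtains h where "\<guillemotleft>h : B \<rightarrow> E\<guillemotright>" "h \<cdot> i = a" "p \<cdot> h = b"
proof -
  have "lifts M i p"
    using assms fibrant_src[of p E Y] by (auto simp: acyc_cof_def hom_def)
  then have "\<exists>h. \<guillemotleft>h : B \<rightarrow> E\<guillemotright> \<and> h \<cdot> i = a \<and> p \<cdot> h = b"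
    using assms by (auto simp: lifts_def hom_def)
  then show thesis using that by blast
qed

lemma acyc_fibI:
  assumes "p \<in> fib M" "\<guillemotleft>p : E \<rightarrow> Y\<guillemotright>"
    and "\<And>i A B a b. \<lbrakk>i \<in> cof M; \<guillemotleft>i : A \<rightarrow> B\<guillemotright>; cofibrant M A; cofibrant M B;
      \<guillemotleft>a : A \<rightarrow> E\<guillemotright>; \<guillemotleft>b : B \<rightarrow> Y\<guillemotright>; p \<cdot> a = b \<cdot> i\<rbrakk>
      \<Longrightarrow> \<exists>h. \<guillemotleft>h : B \<rightarrow> E\<guillemotright> \<and> h \<cdot> i = a \<and> p \<cdot> h = b"
  shows "acyc_fib M p"
proof -
  have "lifts M i p" if "i \<in> cof M" "cofibrant M (src M i)" "cofibrant M (tgt M i)" for i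
    unfolding lifts_def
    using assms(3)[OF that(1) _ that(2,3)] assms(2) cof_Ar[OF that(1)] by (simp add: hom_def)
  then show ?thesis using assms(1) by (simp add: acyc_fib_def)
qed

lemma acyc_cofI:
  assumes "i \<in> cof M" "\<guillemotleft>i : A \<rightarrow> B\<guillemotright>"
    and "\<And>p E Y a b. \<lbrakk>p \<in> fib M; \<guillemotleft>p : E \<rightarrow> Y\<guillemotright>; fibrant M E; fibrant M Y;
      \<guillemotleft>a : A \<rightarrow> E\<guillemotright>; \<guillemotleft>b : B \<rightarrow> Y\<guillemotright>; p \<cdot> a = b \<cdot> i\<rbrakk>
      \<Longrightarrow> \<exists>h. \<guillemotleft>h : B \<rightarrow> E\<guillemotright> \<and> h \<cdot> i = a \<and> p \<cdot> h = b"
  shows "acyc_cof M i"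
proof -
  have "lifts M i p" if "p \<in> fib M" "fibrant M (src M p)" "fibrant M (tgt M p)" for p
    unfolding lifts_def
    using assms(3)[OF that(1) _ that(2,3)] assms(2) fib_Ar[OF that(1)] by (simp add: hom_def)
  then show ?thesis using assms(1) by (simp add: acyc_cof_def)
qed

text \<open>Lifting against 0 -> B; initiality supplies the upper map and the commuting
  square.\<close>

lemma acyc_fib_lift_point:
  assumes "acyc_fib M p" "\<guillemotleft>p : E \<rightarrow> Y\<guillemotright>" "cofibrant M B" "\<guillemotleft>b : B \<rightarrow> Y\<guillemotright>"
  obtains h where "\<guillemotleft>h : B \<rightarrow> E\<guillemotright>" "p \<cdot> h = b"
proof -
  obtain i where i: "\<guillemotleft>i : zero M \<rightarrow> B\<guillemotright>" "i \<in> cof M"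
    using assms(3) by (auto simp: cofibrant_def)
  obtain a where a: "\<guillemotleft>a : zero M \<rightarrow> E\<guillemotright>"
    using initial_zero arr_Ob(1)[OF assms(2)] unfolding initial_def by blast
  have "p \<cdot> a = b \<cdot> i"
    by (rule from_zero_unique) (use a i assms in auto)
  then show thesis
    using acyc_fib_lift[OF assms(1,2) i(2,1) cofibrant_zero a assms(4)] that by blast
qed

text \<open>Lifting against Z -> 1; terminality supplies the lower map and the commuting
  square.\<close>

lemma acyc_cof_extend:
  assumes "acyc_cof M i" "\<guillemotleft>i : A \<rightarrow> B\<guillemotright>" "fibrant M Z" "\<guillemotleft>a : A \<rightarrow> Z\<guillemotright>"
  obtains h where "\<guillemotleft>h : B \<rightarrow> Z\<guillemotright>" "h \<cdot> i = a"
proof -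
  obtain p where p: "\<guillemotleft>p : Z \<rightarrow> one M\<guillemotright>" "p \<in> fib M"
    using assms(3) by (auto simp: fibrant_def)
  obtain b where b: "\<guillemotleft>b : B \<rightarrow> one M\<guillemotright>"
    using to_one_ex arr_Ob(2)[OF assms(2)] by blast
  have "p \<cdot> a = b \<cdot> i"
    by (rule to_one_unique) (use b p assms in auto)
  then show thesis
    using acyc_cof_lift[OF assms(1,2) p(2,1) fibrant_one assms(4) b] that by blast
qed

lemma acyc_fib_comp:
  assumes "acyc_fib M p" "acyc_fib M q" "\<guillemotleft>p : E \<rightarrow> Y\<guillemotright>" "\<guillemotleft>q : Y \<rightarrow> Z\<guillemotright>"
  shows "acyc_fib M (q \<cdot> p)"
proof (rule acyc_fibI)
  show "q \<cdot> p \<in> fib M" "\<guillemotleft>q \<cdot> p : E \<rightarrow> Z\<guillemotright>"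
    using assms fib_comp[of p q] acyc_fib_fib by (auto simp: hom_def)
  fix i A B a b
  assume *: "i \<in> cof M" "\<guillemotleft>i : A \<rightarrow> B\<guillemotright>" "cofibrant M A" "\<guillemotleft>a : A \<rightarrow> E\<guillemotright>" "\<guillemotleft>b : B \<rightarrow> Z\<guillemotright>"
    "(q \<cdot> p) \<cdot> a = b \<cdot> i"
  have "q \<cdot> p \<cdot> a = b \<cdot> i" using assms * by (simp add: hom_def)
  then obtain h where h: "\<guillemotleft>h : B \<rightarrow> Y\<guillemotright>" "h \<cdot> i = p \<cdot> a" "q \<cdot> h = b"
    using acyc_fib_lift[OF assms(2,4) *(1-3) comp_arr[OF *(4) assms(3)] *(5)] by blast
  obtain h' where "\<guillemotleft>h' : B \<rightarrow> E\<guillemotright>" "h' \<cdot> i = a" "p \<cdot> h' = h"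
    using acyc_fib_lift[OF assms(1,3) *(1-4) h(1)] h by metis
  then show "\<exists>h. \<guillemotleft>h : B \<rightarrow> E\<guillemotright> \<and> h \<cdot> i = a \<and> (q \<cdot> p) \<cdot> h = b"
    using h assms(3,4) by (intro exI[of _ h']) (simp add: hom_def)
qed

text \<open>Beyond the axiom, the middle object is bifibrant: it receives a cofibration from a
  cofibrant object and has a fibration to a fibrant one.\<close>

lemma factor_cof_acyc_fib:
  assumes "\<guillemotleft>f : A \<rightarrow> B\<guillemotright>" "cofibrant M A" "fibrant M B"
  obtains Z i p where "\<guillemotleft>i : A \<rightarrow> Z\<guillemotright>" "i \<in> cof M" "\<guillemotleft>p : Z \<rightarrow> B\<guillemotright>" "acyc_fib M p" "p \<cdot> i = f"
    "bifibrant Z"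
proof -
  have "\<exists>i p. i \<in> cof M \<and> acyc_fib M p \<and> tgt M i = src M p \<and> p \<cdot> i = f"
    using factor_axiom[rule_format, of f] assms by (simp add: hom_def)
  then obtain i p where ip: "i \<in> cof M" "acyc_fib M p" "tgt M i = src M p" "p \<cdot> i = f"
    by blast
  then have "i \<in> Ar M" "p \<in> Ar M" "p \<in> fib M" using cof_Ar fib_Ar acyc_fib_fib by auto
  with ip assms have "\<guillemotleft>i : A \<rightarrow> src M p\<guillemotright>" "\<guillemotleft>p : src M p \<rightarrow> B\<guillemotright>" by (auto simp: hom_def)
  with ip \<open>p \<in> fib M\<close> show thesis using that assms cofibrant_tgt fibrant_src by blast
qed

lemma factor_acyc_cof_fib:
  assumes "\<guillemotleft>f : A \<rightarrow> B\<guillemotright>" "cofibrant M A" "fibrant M B"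
  obtains Z j q where "\<guillemotleft>j : A \<rightarrow> Z\<guillemotright>" "acyc_cof M j" "\<guillemotleft>q : Z \<rightarrow> B\<guillemotright>" "q \<in> fib M" "q \<cdot> j = f"
    "bifibrant Z"
proof -
  have "\<exists>j q. acyc_cof M j \<and> q \<in> fib M \<and> tgt M j = src M q \<and> q \<cdot> j = f"
    using factor_axiom[rule_format, of f] assms by (simp add: hom_def)
  then obtain j q where ip: "acyc_cof M j" "q \<in> fib M" "tgt M j = src M q" "q \<cdot> j = f"
    by blast
  then have "j \<in> Ar M" "q \<in> Ar M" "j \<in> cof M" using cof_Ar fib_Ar acyc_cof_cof by auto
  with ip assms have "\<guillemotleft>j : A \<rightarrow> src M q\<guillemotright>" "\<guillemotleft>q : src M q \<rightarrow> B\<guillemotright>" by (auto simp: hom_def)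
  with ip \<open>j \<in> cof M\<close> show thesis using that assms cofibrant_tgt fibrant_src by blast
qed

lemma cofibrant_replacement:
  assumes "fibrant M X"
  obtains X' p where "\<guillemotleft>p : X' \<rightarrow> X\<guillemotright>" "acyc_fib M p" "bifibrant X'"
proof -
  obtain m where "\<guillemotleft>m : zero M \<rightarrow> X\<guillemotright>"
    using initial_zero fibrant_Ob[OF assms] unfolding initial_def by blast
  then show thesis
    using factor_cof_acyc_fib[OF _ cofibrant_zero assms] that by blast
qed

section \<open>Pullbacks, pushouts and products\<close>

lemma pullback_univ:
  assumes "is_pullback M p g p' g'" "\<guillemotleft>u : T \<rightarrow> src M p\<guillemotright>" "\<guillemotleft>v : T \<rightarrow> src M g\<guillemotright>" "p \<cdot> u = g \<cdot> v"
  shows "\<exists>!h. \<guillemotleft>h : T \<rightarrow> src M p'\<guillemotright> \<and> g' \<cdot> h = u \<and> p' \<cdot> h = v"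
proof -
  have "src M u = T" using assms(2) by (simp add: hom_def)
  then show ?thesis using assms unfolding is_pullback_def by blast
qed

text \<open>The axiom speaks of the base change of p only. Exchanging the roles of p and g gives the
  same conclusion for the other projection when g is a fibration.\<close>

lemma pullback_sym:
  assumes "is_pullback M p g p' g'"
  shows "is_pullback M g p g' p'"
proof -
  have "src M g' = src M p'" using assms by (simp add: is_pullback_def hom_def)
  moreover have "\<exists>!h. \<guillemotleft>h : src M u \<rightarrow> src M p'\<guillemotright> \<and> p' \<cdot> h = u \<and> g' \<cdot> h = v"
    if "\<guillemotleft>u : src M u \<rightarrow> src M g\<guillemotright>" "\<guillemotleft>v : src M u \<rightarrow> src M p\<guillemotright>" "g \<cdot> u = p \<cdot> v" for u v
    using pullback_univ[OF assms that(2,1)] that(3) by metis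
  ultimately show ?thesis
    using assms unfolding is_pullback_def by simp
qed

lemma pullback_arrs:
  assumes "is_pullback M p g p' g'" "\<guillemotleft>p : E \<rightarrow> Y\<guillemotright>" "\<guillemotleft>g : X \<rightarrow> Y\<guillemotright>"
  shows "\<guillemotleft>p' : src M p' \<rightarrow> X\<guillemotright>" "\<guillemotleft>g' : src M p' \<rightarrow> E\<guillemotright>" "p \<cdot> g' = g \<cdot> p'"
  using assms unfolding is_pullback_def hom_def by auto

lemma pullback_pair:
  assumes "is_pullback M p g p' g'" "\<guillemotleft>p : E \<rightarrow> Y\<guillemotright>" "\<guillemotleft>g : X \<rightarrow> Y\<guillemotright>"
    "\<guillemotleft>u : T \<rightarrow> E\<guillemotright>" "\<guillemotleft>v : T \<rightarrow> X\<guillemotright>" "p \<cdot> u = g \<cdot> v"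
  obtains h where "\<guillemotleft>h : T \<rightarrow> src M p'\<guillemotright>" "g' \<cdot> h = u" "p' \<cdot> h = v"
proof -
  have "\<guillemotleft>u : T \<rightarrow> src M p\<guillemotright>" "\<guillemotleft>v : T \<rightarrow> src M g\<guillemotright>" using assms(2-5) by (simp_all add: hom_def)
  from pullback_univ[OF assms(1) this assms(6)] show thesis using that by blast
qed

lemma pullback_cancel:
  assumes "is_pullback M p g p' g'" "\<guillemotleft>h : T \<rightarrow> src M p'\<guillemotright>" "\<guillemotleft>h' : T \<rightarrow> src M p'\<guillemotright>"
    "g' \<cdot> h = g' \<cdot> h'" "p' \<cdot> h = p' \<cdot> h'"
  shows "h = h'"
proof -
  have "p \<cdot> g' \<cdot> h = g \<cdot> p' \<cdot> h"
    using assms comp_square_extend[of p g' g p' h] by (auto simp: is_pullback_def hom_def)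
  moreover have "\<guillemotleft>g' \<cdot> h : T \<rightarrow> src M p\<guillemotright>" "\<guillemotleft>p' \<cdot> h : T \<rightarrow> src M g\<guillemotright>"
    using assms(1,2) by (auto simp: is_pullback_def)
  ultimately have "\<exists>!k. \<guillemotleft>k : T \<rightarrow> src M p'\<guillemotright> \<and> g' \<cdot> k = g' \<cdot> h \<and> p' \<cdot> k = p' \<cdot> h"
    using pullback_univ[OF assms(1)] by blast
  then show ?thesis using assms by metis
qed

lemma pullback_ex:
  assumes "p \<in> fib M" "\<guillemotleft>p : E \<rightarrow> Y\<guillemotright>" "\<guillemotleft>g : X \<rightarrow> Y\<guillemotright>" "fibrant M X" "fibrant M Y"
  obtains p' g' where "is_pullback M p g p' g'"
proof -
  have "\<exists>p' g'. is_pullback M p g p' g'"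
    using pullback_axiom assms by (simp add: hom_def)
  then show thesis using that by blast
qed

lemma pullback_fib:
  assumes "is_pullback M p g p' g'" "p \<in> fib M" "\<guillemotleft>p : E \<rightarrow> Y\<guillemotright>" "\<guillemotleft>g : X \<rightarrow> Y\<guillemotright>"
    "fibrant M X" "fibrant M Y"
  shows "p' \<in> fib M"
  using pullback_axiom[rule_format, of p g] assms by (auto simp: hom_def)

text \<open>A problem against p' is composed with g' and solved against p. The solution and b agree
  over Y, hence define a map to the pullback, and uniqueness there gives agreement with a.\<close>

lemma pullback_acyc_fib:
  assumes pb: "is_pullback M p g p' g'" and ac: "acyc_fib M p"
    and p: "\<guillemotleft>p : E \<rightarrow> Y\<guillemotright>" and g: "\<guillemotleft>g : X \<rightarrow> Y\<guillemotright>" and "fibrant M X" "fibrant M Y"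
  shows "acyc_fib M p'"
proof (rule acyc_fibI)
  note pb' = pullback_arrs[OF pb p g]
  show "p' \<in> fib M" using pullback_fib assms acyc_fib_fib by metis
  show "\<guillemotleft>p' : src M p' \<rightarrow> X\<guillemotright>" by fact
  fix i A B a b
  assume *: "i \<in> cof M" "\<guillemotleft>i : A \<rightarrow> B\<guillemotright>" "cofibrant M A" "\<guillemotleft>a : A \<rightarrow> src M p'\<guillemotright>" "\<guillemotleft>b : B \<rightarrow> X\<guillemotright>"
    "p' \<cdot> a = b \<cdot> i"
  have "p \<cdot> g' \<cdot> a = (g \<cdot> b) \<cdot> i"
    using comp_square_extend[of p g' g p' a] pb' p g * by (simp add: hom_def)
  then obtain h where h: "\<guillemotleft>h : B \<rightarrow> E\<guillemotright>" "h \<cdot> i = g' \<cdot> a" "p \<cdot> h = g \<cdot> b"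
    using acyc_fib_lift[OF ac p *(1-3), of "g' \<cdot> a" "g \<cdot> b"] pb' * g by blast
  obtain k where k: "\<guillemotleft>k : B \<rightarrow> src M p'\<guillemotright>" "g' \<cdot> k = h" "p' \<cdot> k = b"
    using pullback_pair[OF pb p g h(1) *(5) h(3)] by blast
  have "k \<cdot> i = a"
    by (rule pullback_cancel[OF pb, where T = A])
      (use k pb' * h comp_eq_extend[of g' k h i] comp_eq_extend[of p' k b i] in
        \<open>auto simp: hom_def\<close>)
  then show "\<exists>h. \<guillemotleft>h : B \<rightarrow> src M p'\<guillemotright> \<and> h \<cdot> i = a \<and> p' \<cdot> h = b"
    using k by blast
qed

lemma pushout_univ:
  assumes "is_pushout M f g f' g'" "\<guillemotleft>u : tgt M f \<rightarrow> T\<guillemotright>" "\<guillemotleft>v : tgt M g \<rightarrow> T\<guillemotright>" "u \<cdot> f = v \<cdot> g"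
  shows "\<exists>!h. \<guillemotleft>h : tgt M f' \<rightarrow> T\<guillemotright> \<and> h \<cdot> g' = u \<and> h \<cdot> f' = v"
proof -
  have "tgt M u = T" using assms(2) by (simp add: hom_def)
  then show ?thesis using assms unfolding is_pushout_def by blast
qed

lemma pushout_pair:
  assumes "is_pushout M f g f' g'" "\<guillemotleft>f : A \<rightarrow> B\<guillemotright>" "\<guillemotleft>g : A \<rightarrow> C\<guillemotright>"
    "\<guillemotleft>u : B \<rightarrow> T\<guillemotright>" "\<guillemotleft>v : C \<rightarrow> T\<guillemotright>" "u \<cdot> f = v \<cdot> g"
  obtains h where "\<guillemotleft>h : tgt M f' \<rightarrow> T\<guillemotright>" "h \<cdot> g' = u" "h \<cdot> f' = v"
proof -
  have "\<guillemotleft>u : tgt M f \<rightarrow> T\<guillemotright>" "\<guillemotleft>v : tgt M g \<rightarrow> T\<guillemotright>" using assms(2-5) by (simp_all add: hom_def)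
  from pushout_univ[OF assms(1) this assms(6)] show thesis using that by blast
qed

lemma pushout_arrs:
  assumes "is_pushout M f g f' g'" "\<guillemotleft>f : A \<rightarrow> B\<guillemotright>" "\<guillemotleft>g : A \<rightarrow> C\<guillemotright>"
  shows "\<guillemotleft>f' : C \<rightarrow> tgt M f'\<guillemotright>" "\<guillemotleft>g' : B \<rightarrow> tgt M f'\<guillemotright>" "g' \<cdot> f = f' \<cdot> g"
  using assms unfolding is_pushout_def hom_def by auto

lemma pushout_cancel:
  assumes "is_pushout M f g f' g'" "\<guillemotleft>h : tgt M f' \<rightarrow> T\<guillemotright>" "\<guillemotleft>h' : tgt M f' \<rightarrow> T\<guillemotright>"
    "h \<cdot> g' = h' \<cdot> g'" "h \<cdot> f' = h' \<cdot> f'"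
  shows "h = h'"
proof -
  have "(h \<cdot> g') \<cdot> f = (h \<cdot> f') \<cdot> g"
    using assms(1,2) by (auto simp: is_pushout_def hom_def)
  moreover have "\<guillemotleft>h \<cdot> g' : tgt M f \<rightarrow> T\<guillemotright>" "\<guillemotleft>h \<cdot> f' : tgt M g \<rightarrow> T\<guillemotright>"
    using assms(1,2) by (auto simp: is_pushout_def)
  ultimately have "\<exists>!k. \<guillemotleft>k : tgt M f' \<rightarrow> T\<guillemotright> \<and> k \<cdot> g' = h \<cdot> g' \<and> k \<cdot> f' = h \<cdot> f'"
    using pushout_univ[OF assms(1)] by blast
  then show ?thesis using assms by metis
qed

lemma pushout_cof:
  assumes "is_pushout M i g i' g'" "i \<in> cof M" "\<guillemotleft>i : A \<rightarrow> B\<guillemotright>" "\<guillemotleft>g : A \<rightarrow> C\<guillemotright>"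
    "cofibrant M A" "cofibrant M C"
  shows "i' \<in> cof M"
  using pushout_axiom[rule_format, of i g] assms by (auto simp: hom_def)

text \<open>The pullback over the terminal object; each projection is the base change of a fibration
  to it.\<close>

lemma product_ex:
  assumes "fibrant M X" "fibrant M Y"
  obtains Q p1 p2 where "\<guillemotleft>p1 : Q \<rightarrow> X\<guillemotright>" "\<guillemotleft>p2 : Q \<rightarrow> Y\<guillemotright>" "p1 \<in> fib M" "p2 \<in> fib M" "fibrant M Q"
    "\<And>T u v. \<lbrakk>\<guillemotleft>u : T \<rightarrow> X\<guillemotright>; \<guillemotleft>v : T \<rightarrow> Y\<guillemotright>\<rbrakk> \<Longrightarrow> \<exists>h. \<guillemotleft>h : T \<rightarrow> Q\<guillemotright> \<and> p1 \<cdot> h = u \<and> p2 \<cdot> h = v"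
    "\<And>T h h'. \<lbrakk>\<guillemotleft>h : T \<rightarrow> Q\<guillemotright>; \<guillemotleft>h' : T \<rightarrow> Q\<guillemotright>; p1 \<cdot> h = p1 \<cdot> h'; p2 \<cdot> h = p2 \<cdot> h'\<rbrakk> \<Longrightarrow> h = h'"
proof -
  obtain x y where x: "\<guillemotleft>x : X \<rightarrow> one M\<guillemotright>" "x \<in> fib M" and y: "\<guillemotleft>y : Y \<rightarrow> one M\<guillemotright>" "y \<in> fib M"
    using assms by (auto simp: fibrant_def)
  obtain p2 p1 where pb: "is_pullback M x y p2 p1"
    using pullback_ex[OF x(2,1) y(1) assms(2) fibrant_one] by blast
  note pb' = pullback_arrs[OF pb x(1) y(1)]
  have f2: "p2 \<in> fib M"
    using pullback_fib[OF pb x(2,1) y(1) assms(2) fibrant_one] .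
  have f1: "p1 \<in> fib M"
    using pullback_fib[OF pullback_sym[OF pb] y(2,1) x(1) assms(1) fibrant_one] .
  show thesis
  proof (rule that[OF pb'(2,1) f1 f2])
    show "fibrant M (src M p2)" using fibrant_src[OF f2 pb'(1) assms(2)] .
    show "\<exists>h. \<guillemotleft>h : T \<rightarrow> src M p2\<guillemotright> \<and> p1 \<cdot> h = u \<and> p2 \<cdot> h = v"
      if "\<guillemotleft>u : T \<rightarrow> X\<guillemotright>" "\<guillemotleft>v : T \<rightarrow> Y\<guillemotright>" for T u v
    proof -
      have "x \<cdot> u = y \<cdot> v"
        by (rule to_one_unique) (use that x y in auto)
      then show ?thesis using pullback_pair[OF pb x(1) y(1) that] by metis
    qed
    show "h = h'" if "\<guillemotleft>h : T \<rightarrow> src M p2\<guillemotright>" "\<guillemotleft>h' : T \<rightarrow> src M p2\<guillemotright>" "p1 \<cdot> h = p1 \<cdot> h'" "p2 \<cdot> h = p2 \<cdot> h'"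
      for T h h'
      using pullback_cancel[OF pb that] .
  qed
qed


section \<open>Relative cylinders, relative path objects and criteria for acyclicity\<close>

lemma cylinder_axiom:
  "\<forall>i\<in>cof M. cofibrant M (src M i) \<and> fibrant M (tgt M i) \<longrightarrow>
    (\<exists>i1 i2 c q. is_pushout M i i i2 i1 \<and> c \<in> cof M \<and> src M c = tgt M i1 \<and>
      \<guillemotleft>q : tgt M c \<rightarrow> tgt M i\<guillemotright> \<and>
      q \<cdot> c \<cdot> i1 = idm M (tgt M i) \<and> q \<cdot> c \<cdot> i2 = idm M (tgt M i) \<and> acyc_cof M (c \<cdot> i1))"
  using wmc unfolding weak_model_category_def by (elim conjE)

lemma path_axiom:
  "\<forall>p\<in>fib M. cofibrant M (src M p) \<and> fibrant M (tgt M p) \<longrightarrow>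
    (\<exists>p1 p2 q j. is_pullback M p p p2 p1 \<and> q \<in> fib M \<and> tgt M q = src M p1 \<and>
      \<guillemotleft>j : src M p \<rightarrow> src M q\<guillemotright> \<and>
      p1 \<cdot> q \<cdot> j = idm M (src M p) \<and> p2 \<cdot> q \<cdot> j = idm M (src M p) \<and> acyc_fib M (p1 \<cdot> q))"
  using wmc unfolding weak_model_category_def by (elim conjE)

text \<open>The ends u and v glue to a map on the pushout, which is cofibrant, and c is lifted
  against p. Nothing is assumed of c beyond being a cofibration, so the lemma serves strong and weak
  relative cylinders alike.\<close>

lemma rel_cylinder_lift:
  assumes po: "is_pushout M i i i2 i1" and i: "i \<in> cof M" "\<guillemotleft>i : A \<rightarrow> B\<guillemotright>" "cofibrant M A"
    and c: "c \<in> cof M" "\<guillemotleft>c : tgt M i2 \<rightarrow> C\<guillemotright>"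
    and p: "acyc_fib M p" "\<guillemotleft>p : E \<rightarrow> Y\<guillemotright>"
    and uv: "\<guillemotleft>u : B \<rightarrow> E\<guillemotright>" "\<guillemotleft>v : B \<rightarrow> E\<guillemotright>" "u \<cdot> i = v \<cdot> i"
    and b: "\<guillemotleft>b : C \<rightarrow> Y\<guillemotright>" "p \<cdot> u = b \<cdot> c \<cdot> i1" "p \<cdot> v = b \<cdot> c \<cdot> i2"
  shows "\<exists>h. \<guillemotleft>h : C \<rightarrow> E\<guillemotright> \<and> h \<cdot> c \<cdot> i1 = u \<and> h \<cdot> c \<cdot> i2 = v \<and> p \<cdot> h = b"
proof -
  note po' = pushout_arrs[OF po i(2) i(2)]
  have B: "cofibrant M B" using cofibrant_tgt i by blast
  have "i2 \<in> cof M" using pushout_cof[OF po i(1,2,2,3) B] .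
  then have P: "cofibrant M (tgt M i2)" using cofibrant_tgt po'(1) B by blast
  obtain w where w: "\<guillemotleft>w : tgt M i2 \<rightarrow> E\<guillemotright>" "w \<cdot> i1 = u" "w \<cdot> i2 = v"
    using pushout_pair[OF po i(2) i(2) uv] by blast
  have "p \<cdot> w = b \<cdot> c"
    by (rule pushout_cancel[OF po, where T = Y]) (use w po' p c b in \<open>auto simp: hom_def\<close>)
  then obtain h where h: "\<guillemotleft>h : C \<rightarrow> E\<guillemotright>" "h \<cdot> c = w" "p \<cdot> h = b"
    using acyc_fib_lift[OF p c P w(1) b(1)] by blast
  then have "h \<cdot> c \<cdot> i1 = u" "h \<cdot> c \<cdot> i2 = v"
    using comp_eq_extend[of h c w] po' c w by (auto simp: hom_def)
  then show ?thesis using h by blast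
qed

text \<open>Hides the pushout: what remains of c being a cofibration is that homotopies relative to
  A lift along acyclic fibrations with prescribed ends.\<close>

lemma rel_cylinder_ex:
  assumes i: "i \<in> cof M" "\<guillemotleft>i : A \<rightarrow> B\<guillemotright>" "cofibrant M A" "fibrant M B"
  obtains C c1 c2 s where "\<guillemotleft>c1 : B \<rightarrow> C\<guillemotright>" "\<guillemotleft>c2 : B \<rightarrow> C\<guillemotright>" "\<guillemotleft>s : C \<rightarrow> B\<guillemotright>"
    "s \<cdot> c1 = idm M B" "s \<cdot> c2 = idm M B" "c1 \<cdot> i = c2 \<cdot> i" "acyc_cof M c1"
    "\<And>p E Y u v b. \<lbrakk>acyc_fib M p; \<guillemotleft>p : E \<rightarrow> Y\<guillemotright>; \<guillemotleft>u : B \<rightarrow> E\<guillemotright>; \<guillemotleft>v : B \<rightarrow> E\<guillemotright>; u \<cdot> i = v \<cdot> i;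
      \<guillemotleft>b : C \<rightarrow> Y\<guillemotright>; p \<cdot> u = b \<cdot> c1; p \<cdot> v = b \<cdot> c2\<rbrakk>
      \<Longrightarrow> \<exists>h. \<guillemotleft>h : C \<rightarrow> E\<guillemotright> \<and> h \<cdot> c1 = u \<and> h \<cdot> c2 = v \<and> p \<cdot> h = b"
proof -
  have "\<exists>i1 i2 c q. is_pushout M i i i2 i1 \<and> c \<in> cof M \<and> src M c = tgt M i1 \<and>
      \<guillemotleft>q : tgt M c \<rightarrow> tgt M i\<guillemotright> \<and>
      q \<cdot> c \<cdot> i1 = idm M (tgt M i) \<and> q \<cdot> c \<cdot> i2 = idm M (tgt M i) \<and> acyc_cof M (c \<cdot> i1)"
    by (rule cylinder_axiom[rule_format]) (use i in \<open>auto simp: hom_def\<close>)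
  then obtain i1 i2 c q where po: "is_pushout M i i i2 i1" and c: "c \<in> cof M" "src M c = tgt M i1"
    and q: "\<guillemotleft>q : tgt M c \<rightarrow> tgt M i\<guillemotright>" "q \<cdot> c \<cdot> i1 = idm M (tgt M i)" "q \<cdot> c \<cdot> i2 = idm M (tgt M i)"
      "acyc_cof M (c \<cdot> i1)"
    by blast
  note po' = pushout_arrs[OF po i(2) i(2)]
  have c': "\<guillemotleft>c : tgt M i2 \<rightarrow> tgt M c\<guillemotright>" using c po' cof_Ar by (auto simp: hom_def)
  show thesis
  proof (rule that[of "tgt M c" "c \<cdot> i1" "c \<cdot> i2" q])
    show "\<exists>h. \<guillemotleft>h : tgt M c \<rightarrow> E\<guillemotright> \<and> h \<cdot> c \<cdot> i1 = u \<and> h \<cdot> c \<cdot> i2 = v \<and> p \<cdot> h = b"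
      if "acyc_fib M p" "\<guillemotleft>p : E \<rightarrow> Y\<guillemotright>" "\<guillemotleft>u : B \<rightarrow> E\<guillemotright>" "\<guillemotleft>v : B \<rightarrow> E\<guillemotright>" "u \<cdot> i = v \<cdot> i"
        "\<guillemotleft>b : tgt M c \<rightarrow> Y\<guillemotright>" "p \<cdot> u = b \<cdot> c \<cdot> i1" "p \<cdot> v = b \<cdot> c \<cdot> i2" for p E Y u v b
      using rel_cylinder_lift[OF po i(1-3) c(1) c' that] .
  qed (use po' c' q i in \<open>auto simp: hom_def\<close>)
qed

text \<open>The dual packaging: what remains of q being a fibration is that fibrewise paths with
  prescribed ends extend along acyclic cofibrations.\<close>

lemma rel_path_ex:
  assumes p: "p \<in> fib M" "\<guillemotleft>p : E \<rightarrow> Y\<guillemotright>" "cofibrant M E" "fibrant M Y"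
  obtains Q d1 d2 j where "\<guillemotleft>d1 : Q \<rightarrow> E\<guillemotright>" "\<guillemotleft>d2 : Q \<rightarrow> E\<guillemotright>" "\<guillemotleft>j : E \<rightarrow> Q\<guillemotright>"
    "d1 \<cdot> j = idm M E" "d2 \<cdot> j = idm M E" "p \<cdot> d1 = p \<cdot> d2" "acyc_fib M d1"
    "\<And>l K L a u v. \<lbrakk>acyc_cof M l; \<guillemotleft>l : K \<rightarrow> L\<guillemotright>; \<guillemotleft>u : L \<rightarrow> E\<guillemotright>; \<guillemotleft>v : L \<rightarrow> E\<guillemotright>; p \<cdot> u = p \<cdot> v;
      \<guillemotleft>a : K \<rightarrow> Q\<guillemotright>; d1 \<cdot> a = u \<cdot> l; d2 \<cdot> a = v \<cdot> l\<rbrakk>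
      \<Longrightarrow> \<exists>h. \<guillemotleft>h : L \<rightarrow> Q\<guillemotright> \<and> h \<cdot> l = a \<and> d1 \<cdot> h = u \<and> d2 \<cdot> h = v"
proof -
  have "\<exists>p1 p2 q j. is_pullback M p p p2 p1 \<and> q \<in> fib M \<and> tgt M q = src M p1 \<and>
      \<guillemotleft>j : src M p \<rightarrow> src M q\<guillemotright> \<and>
      p1 \<cdot> q \<cdot> j = idm M (src M p) \<and> p2 \<cdot> q \<cdot> j = idm M (src M p) \<and> acyc_fib M (p1 \<cdot> q)"
    by (rule path_axiom[rule_format]) (use p in \<open>auto simp: hom_def\<close>)
  then obtain p1 p2 q j where pb: "is_pullback M p p p2 p1" and q: "q \<in> fib M" "tgt M q = src M p1"
    and j: "\<guillemotleft>j : src M p \<rightarrow> src M q\<guillemotright>" "p1 \<cdot> q \<cdot> j = idm M (src M p)" "p2 \<cdot> q \<cdot> j = idm M (src M p)"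
      "acyc_fib M (p1 \<cdot> q)"
    by blast
  note pb' = pullback_arrs[OF pb p(2) p(2)]
  have E: "fibrant M E" using fibrant_src p by blast
  have "p2 \<in> fib M" using pullback_fib[OF pb p(1,2,2) E p(4)] .
  then have S: "fibrant M (src M p2)" using fibrant_src pb'(1) E by blast
  have q': "\<guillemotleft>q : src M q \<rightarrow> src M p2\<guillemotright>" using q pb' fib_Ar by (auto simp: hom_def)
  show thesis
  proof (rule that[of "src M q" "p1 \<cdot> q" "p2 \<cdot> q" j])
    show "\<exists>h. \<guillemotleft>h : L \<rightarrow> src M q\<guillemotright> \<and> h \<cdot> l = a \<and> (p1 \<cdot> q) \<cdot> h = u \<and> (p2 \<cdot> q) \<cdot> h = v"
      if *: "acyc_cof M l" "\<guillemotleft>l : K \<rightarrow> L\<guillemotright>" "\<guillemotleft>u : L \<rightarrow> E\<guillemotright>" "\<guillemotleft>v : L \<rightarrow> E\<guillemotright>" "p \<cdot> u = p \<cdot> v"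
        "\<guillemotleft>a : K \<rightarrow> src M q\<guillemotright>" "(p1 \<cdot> q) \<cdot> a = u \<cdot> l" "(p2 \<cdot> q) \<cdot> a = v \<cdot> l" for l K L a u v
    proof -
      obtain w where w: "\<guillemotleft>w : L \<rightarrow> src M p2\<guillemotright>" "p1 \<cdot> w = u" "p2 \<cdot> w = v"
        using pullback_pair[OF pb p(2) p(2) *(3-5)] by blast
      have "q \<cdot> a = w \<cdot> l"
        by (rule pullback_cancel[OF pb, where T = K])
          (use * w pb' q' comp_eq_extend[of p1 w u l] comp_eq_extend[of p2 w v l] in
            \<open>auto simp: hom_def\<close>)
      then obtain h where "\<guillemotleft>h : L \<rightarrow> src M q\<guillemotright>" "h \<cdot> l = a" "q \<cdot> h = w"
        using acyc_cof_lift[OF *(1,2) q(1) q' S *(6) w(1)] by blast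
      then show ?thesis
        using w q' pb' by (intro exI[of _ h]) (simp add: hom_def)
    qed
    show "p \<cdot> p1 \<cdot> q = p \<cdot> p2 \<cdot> q"
      using comp_square_extend[of p p1 p p2 q] pb' p q' by (auto simp: hom_def)
  qed (use pb' q' j p in \<open>auto simp: hom_def\<close>)
qed

text \<open>The section is a deformation retract in the fibres. For a problem (a, b) the map s b
  lies over b but restricts to s p a instead of a; the fibrewise homotopy from s p to the identity
  repairs this, since it extends from A to B along the acyclic fibration d1.\<close>

lemma fib_section_acyc_fib:
  assumes p: "p \<in> fib M" "\<guillemotleft>p : E \<rightarrow> Y\<guillemotright>" "cofibrant M E" "fibrant M Y"
    and s: "acyc_cof M s" "\<guillemotleft>s : Y \<rightarrow> E\<guillemotright>" "p \<cdot> s = idm M Y"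
  shows "acyc_fib M p"
proof (rule acyc_fibI[OF p(1,2)])
  obtain Q d1 d2 j where d: "\<guillemotleft>d1 : Q \<rightarrow> E\<guillemotright>" "\<guillemotleft>d2 : Q \<rightarrow> E\<guillemotright>" and j: "\<guillemotleft>j : E \<rightarrow> Q\<guillemotright>"
    "d1 \<cdot> j = idm M E" "d2 \<cdot> j = idm M E" and pd: "p \<cdot> d1 = p \<cdot> d2" and ac: "acyc_fib M d1"
    and lift: "\<And>l K L a u v. \<lbrakk>acyc_cof M l; \<guillemotleft>l : K \<rightarrow> L\<guillemotright>; \<guillemotleft>u : L \<rightarrow> E\<guillemotright>; \<guillemotleft>v : L \<rightarrow> E\<guillemotright>; p \<cdot> u = p \<cdot> v;
      \<guillemotleft>a : K \<rightarrow> Q\<guillemotright>; d1 \<cdot> a = u \<cdot> l; d2 \<cdot> a = v \<cdot> l\<rbrakk>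
      \<Longrightarrow> \<exists>h. \<guillemotleft>h : L \<rightarrow> Q\<guillemotright> \<and> h \<cdot> l = a \<and> d1 \<cdot> h = u \<and> d2 \<cdot> h = v"
    using rel_path_ex[OF p] by blast
  have idE: "\<guillemotleft>idm M E : E \<rightarrow> E\<guillemotright>" using id_arr arr_Ob p by blast
  \<comment> \<open>Both s p and the identity restrict to s along s, so the constant path j s
    extends over E and yields the homotopy.\<close>
  have "\<exists>h. \<guillemotleft>h : E \<rightarrow> Q\<guillemotright> \<and> h \<cdot> s = j \<cdot> s \<and> d1 \<cdot> h = s \<cdot> p \<and> d2 \<cdot> h = idm M E"
    by (rule lift[OF s(1,2) _ idE])
      (use s p j d idE comp_eq_extend[of p s _ p] comp_eq_extend[of d1 j _ s]
        comp_eq_extend[of d2 j _ s] in \<open>auto simp: hom_def\<close>)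
  then obtain H where H: "\<guillemotleft>H : E \<rightarrow> Q\<guillemotright>" "d1 \<cdot> H = s \<cdot> p" "d2 \<cdot> H = idm M E" by blast
  fix i A B a b
  assume *: "i \<in> cof M" "\<guillemotleft>i : A \<rightarrow> B\<guillemotright>" "cofibrant M A" "\<guillemotleft>a : A \<rightarrow> E\<guillemotright>" "\<guillemotleft>b : B \<rightarrow> Y\<guillemotright>" "p \<cdot> a = b \<cdot> i"
  have "d1 \<cdot> H \<cdot> a = (s \<cdot> b) \<cdot> i"
    using comp_eq_extend[OF H(2), of a] H d s p * by (auto simp: hom_def)
  then obtain G where G: "\<guillemotleft>G : B \<rightarrow> Q\<guillemotright>" "G \<cdot> i = H \<cdot> a" "d1 \<cdot> G = s \<cdot> b"
    using acyc_fib_lift[OF ac d(1) *(1-3), of "H \<cdot> a" "s \<cdot> b"] H * s by blast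
  have "(d2 \<cdot> G) \<cdot> i = a"
    using comp_eq_extend[OF H(3), of a] H G d * by (auto simp: hom_def)
  moreover have "p \<cdot> d2 \<cdot> G = b"
    using comp_square_extend[OF pd, of G] comp_eq_extend[OF s(3), of b] G d s p * by (auto simp: hom_def)
  ultimately show "\<exists>h. \<guillemotleft>h : B \<rightarrow> E\<guillemotright> \<and> h \<cdot> i = a \<and> p \<cdot> h = b"
    using G d by blast
qed

text \<open>Dual to the previous lemma: a r extends a only up to the homotopy from k r to the
  identity, which is relative to A. Lifting it along p, starting at a r, gives at its other end a
  solution.\<close>

lemma cof_retraction_acyc_cof:
  assumes k: "k \<in> cof M" "\<guillemotleft>k : A \<rightarrow> B\<guillemotright>" "cofibrant M A" "fibrant M B"
    and r: "acyc_fib M r" "\<guillemotleft>r : B \<rightarrow> A\<guillemotright>" "r \<cdot> k = idm M A"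
  shows "acyc_cof M k"
proof (rule acyc_cofI[OF k(1,2)])
  obtain C c1 c2 s where c: "\<guillemotleft>c1 : B \<rightarrow> C\<guillemotright>" "\<guillemotleft>c2 : B \<rightarrow> C\<guillemotright>" and s: "\<guillemotleft>s : C \<rightarrow> B\<guillemotright>"
    "s \<cdot> c1 = idm M B" "s \<cdot> c2 = idm M B" and ck: "c1 \<cdot> k = c2 \<cdot> k" and ac: "acyc_cof M c1"
    and lift: "\<And>p E Y u v b. \<lbrakk>acyc_fib M p; \<guillemotleft>p : E \<rightarrow> Y\<guillemotright>; \<guillemotleft>u : B \<rightarrow> E\<guillemotright>; \<guillemotleft>v : B \<rightarrow> E\<guillemotright>; u \<cdot> k = v \<cdot> k;
      \<guillemotleft>b : C \<rightarrow> Y\<guillemotright>; p \<cdot> u = b \<cdot> c1; p \<cdot> v = b \<cdot> c2\<rbrakk>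
      \<Longrightarrow> \<exists>h. \<guillemotleft>h : C \<rightarrow> E\<guillemotright> \<and> h \<cdot> c1 = u \<and> h \<cdot> c2 = v \<and> p \<cdot> h = b"
    using rel_cylinder_ex[OF k] by blast
  have idB: "\<guillemotleft>idm M B : B \<rightarrow> B\<guillemotright>" using id_arr arr_Ob r by blast
  \<comment> \<open>The maps k r and the identity both become r after composing with r, so the
    constant homotopy r s lifts along r with these two ends.\<close>
  have "\<exists>h. \<guillemotleft>h : C \<rightarrow> B\<guillemotright> \<and> h \<cdot> c1 = k \<cdot> r \<and> h \<cdot> c2 = idm M B \<and> r \<cdot> h = r \<cdot> s"
    by (rule lift[OF r(1,2) _ idB])
      (use s r k c idB comp_eq_extend[of r k _ r] in \<open>auto simp: hom_def\<close>)
  then obtain H where H: "\<guillemotleft>H : C \<rightarrow> B\<guillemotright>" "H \<cdot> c1 = k \<cdot> r" "H \<cdot> c2 = idm M B" by blast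
  fix p E Y a b
  assume *: "p \<in> fib M" "\<guillemotleft>p : E \<rightarrow> Y\<guillemotright>" "fibrant M Y" "\<guillemotleft>a : A \<rightarrow> E\<guillemotright>" "\<guillemotleft>b : B \<rightarrow> Y\<guillemotright>" "p \<cdot> a = b \<cdot> k"
  have "p \<cdot> a \<cdot> r = (b \<cdot> H) \<cdot> c1"
    using comp_square_extend[OF *(6), of r] H c r k * by (auto simp: hom_def)
  then obtain G where G: "\<guillemotleft>G : C \<rightarrow> E\<guillemotright>" "G \<cdot> c1 = a \<cdot> r" "p \<cdot> G = b \<cdot> H"
    using acyc_cof_lift[OF ac c(1) *(1-3), of "a \<cdot> r" "b \<cdot> H"] H * r by blast
  have "p \<cdot> G \<cdot> c2 = b"
    using comp_square_extend[OF G(3), of c2] H G c * by (auto simp: hom_def)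
  moreover have "(G \<cdot> c2) \<cdot> k = a"
    using comp_square_extend[OF G(2), of k] ck G c r k * by (auto simp: hom_def)
  ultimately show "\<exists>h. \<guillemotleft>h : B \<rightarrow> E\<guillemotright> \<and> h \<cdot> k = a \<and> p \<cdot> h = b"
    using G c by blast
qed

text \<open>The map r is exhibited as a retract of g2 n. Here n is acyclic and g2 is the base change
  of t r along t. That is how lifting against t r can be used over F instead of over E.\<close>

lemma acyc_fib_cancel:
  assumes r: "r \<in> fib M" "\<guillemotleft>r : P \<rightarrow> F\<guillemotright>" and t: "acyc_fib M t" "\<guillemotleft>t : F \<rightarrow> E\<guillemotright>"
    and tr: "acyc_fib M (t \<cdot> r)" and P: "cofibrant M P" and E: "fibrant M E"
  shows "acyc_fib M r"
proof (rule acyc_fibI[OF r])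
  have F: "fibrant M F" using fibrant_src acyc_fib_fib t E by blast
  then have P': "fibrant M P" using fibrant_src r by blast
  have tr': "\<guillemotleft>t \<cdot> r : P \<rightarrow> E\<guillemotright>" using r t by blast
  obtain g1 g2 where pb: "is_pullback M t (t \<cdot> r) g1 g2"
    using pullback_ex[OF acyc_fib_fib[OF t(1)] t(2) tr' P' E] by blast
  note pb' = pullback_arrs[OF pb t(2) tr']
  have g1: "acyc_fib M g1" using pullback_acyc_fib[OF pb t tr' P' E] .
  then have S: "fibrant M (src M g1)" using fibrant_src acyc_fib_fib pb'(1) P' by blast
  have idP: "\<guillemotleft>idm M P : P \<rightarrow> P\<guillemotright>" using id_arr arr_Ob r by blast
  \<comment> \<open>The graph of r, as a map from P to the pullback of F and P over E.\<close>
  obtain w where w: "\<guillemotleft>w : P \<rightarrow> src M g1\<guillemotright>" "g2 \<cdot> w = r" "g1 \<cdot> w = idm M P"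
    using pullback_pair[OF pb t(2) tr' r(2) idP] tr' by (auto simp: hom_def)
  obtain T k n where k: "\<guillemotleft>k : P \<rightarrow> T\<guillemotright>" "k \<in> cof M" and n: "\<guillemotleft>n : T \<rightarrow> src M g1\<guillemotright>" "acyc_fib M n"
    and nk: "n \<cdot> k = w" and T: "bifibrant T"
    using factor_cof_acyc_fib[OF w(1) P S] by blast
  \<comment> \<open>g1 n is an acyclic fibration and a retraction of k. Acyclicity of k is what
    allows m, the retraction over r, to be built by lifting against r.\<close>
  have "acyc_cof M k"
    by (rule cof_retraction_acyc_cof[OF k(2,1) P _ acyc_fib_comp[OF n(2) g1 n(1) pb'(1)]])
      (use T n pb' k w nk in \<open>auto simp: hom_def\<close>)
  moreover have "r \<cdot> idm M P = (g2 \<cdot> n) \<cdot> k"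
    using r n pb' k w nk by (auto simp: hom_def)
  ultimately obtain m where m: "\<guillemotleft>m : T \<rightarrow> P\<guillemotright>" "m \<cdot> k = idm M P" "r \<cdot> m = g2 \<cdot> n"
    using acyc_cof_lift[OF _ k(1) r F idP, of "g2 \<cdot> n"] n pb' by blast
  fix i A B a b
  assume *: "i \<in> cof M" "\<guillemotleft>i : A \<rightarrow> B\<guillemotright>" "cofibrant M A" "\<guillemotleft>a : A \<rightarrow> P\<guillemotright>" "\<guillemotleft>b : B \<rightarrow> F\<guillemotright>" "r \<cdot> a = b \<cdot> i"
  \<comment> \<open>l solves the problem only after composing with t, so r l may differ from b. The
    pair of b and l still is a map x to the pullback; lifting x through n and applying m gives a
    solution over b.\<close>
  have "(t \<cdot> r) \<cdot> a = (t \<cdot> b) \<cdot> i" using * r t by (auto simp: hom_def)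
  then obtain l where l: "\<guillemotleft>l : B \<rightarrow> P\<guillemotright>" "l \<cdot> i = a" "(t \<cdot> r) \<cdot> l = t \<cdot> b"
    using acyc_fib_lift[OF tr tr' *(1-4), of "t \<cdot> b"] * t by blast
  obtain x where x: "\<guillemotleft>x : B \<rightarrow> src M g1\<guillemotright>" "g2 \<cdot> x = b" "g1 \<cdot> x = l"
    using pullback_pair[OF pb t(2) tr' *(5) l(1)] l by metis
  have "n \<cdot> k \<cdot> a = x \<cdot> i"
    by (rule pullback_cancel[OF pb, where T = A])
      (use n k pb' w x * l comp_eq_extend[OF nk, of a] comp_eq_extend[OF w(2), of a]
        comp_eq_extend[OF w(3), of a] comp_eq_extend[OF x(2), of i] comp_eq_extend[OF x(3), of i]
        in \<open>auto simp: hom_def\<close>)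
  then obtain y where y: "\<guillemotleft>y : B \<rightarrow> T\<guillemotright>" "y \<cdot> i = k \<cdot> a" "n \<cdot> y = x"
    using acyc_fib_lift[OF n(2,1) *(1-3), of "k \<cdot> a" x] k * x by blast
  have "(m \<cdot> y) \<cdot> i = a"
    using comp_eq_extend[OF m(2), of a] y m k * by (auto simp: hom_def)
  moreover have "r \<cdot> m \<cdot> y = b"
    using comp_square_extend[OF m(3), of y] y m n r pb' x by (auto simp: hom_def)
  ultimately show "\<exists>h. \<guillemotleft>h : B \<rightarrow> P\<guillemotright> \<and> h \<cdot> i = a \<and> r \<cdot> h = b"
    using y m by blast
qed


section \<open>Path objects\<close>

text \<open>The last clause says that $(p_1, p_2) : P \to Z \times Z$ has the right lifting property against
  acyclic cofibrations, phrased without choosing a product. Both projections are required to be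
  acyclic, which makes the notion symmetric.\<close>

definition path_object :: "'o \<Rightarrow> 'o \<Rightarrow> 'm \<Rightarrow> 'm \<Rightarrow> 'm \<Rightarrow> bool" where
  "path_object Z P p1 p2 j \<longleftrightarrow>
     \<guillemotleft>p1 : P \<rightarrow> Z\<guillemotright> \<and> \<guillemotleft>p2 : P \<rightarrow> Z\<guillemotright> \<and> \<guillemotleft>j : Z \<rightarrow> P\<guillemotright> \<and> p1 \<cdot> j = idm M Z \<and> p2 \<cdot> j = idm M Z \<and>
     acyc_fib M p1 \<and> acyc_fib M p2 \<and> fibrant M P \<and>
     (\<forall>l K L a u v. acyc_cof M l \<and> \<guillemotleft>l : K \<rightarrow> L\<guillemotright> \<and> \<guillemotleft>u : L \<rightarrow> Z\<guillemotright> \<and> \<guillemotleft>v : L \<rightarrow> Z\<guillemotright> \<and> \<guillemotleft>a : K \<rightarrow> P\<guillemotright> \<and>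
        p1 \<cdot> a = u \<cdot> l \<and> p2 \<cdot> a = v \<cdot> l \<longrightarrow>
        (\<exists>h. \<guillemotleft>h : L \<rightarrow> P\<guillemotright> \<and> h \<cdot> l = a \<and> p1 \<cdot> h = u \<and> p2 \<cdot> h = v))"

lemma path_objectD:
  assumes "path_object Z P p1 p2 j"
  shows "\<guillemotleft>p1 : P \<rightarrow> Z\<guillemotright>" "\<guillemotleft>p2 : P \<rightarrow> Z\<guillemotright>" "\<guillemotleft>j : Z \<rightarrow> P\<guillemotright>" "p1 \<cdot> j = idm M Z" "p2 \<cdot> j = idm M Z"
    "acyc_fib M p1" "acyc_fib M p2" "fibrant M P"
  using assms unfolding path_object_def by blast+

lemma path_object_lift:
  assumes "path_object Z P p1 p2 j" "acyc_cof M l" "\<guillemotleft>l : K \<rightarrow> L\<guillemotright>" "\<guillemotleft>u : L \<rightarrow> Z\<guillemotright>" "\<guillemotleft>v : L \<rightarrow> Z\<guillemotright>"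
    "\<guillemotleft>a : K \<rightarrow> P\<guillemotright>" "p1 \<cdot> a = u \<cdot> l" "p2 \<cdot> a = v \<cdot> l"
  obtains h where "\<guillemotleft>h : L \<rightarrow> P\<guillemotright>" "h \<cdot> l = a" "p1 \<cdot> h = u" "p2 \<cdot> h = v"
  using assms unfolding path_object_def by blast

text \<open>Factors the diagonal. \<open>rel_path_ex\<close> provides acyclicity of d1 only; here j
  is an acyclic cofibration and a section of both projections, which makes both acyclic.\<close>

lemma path_object_ex:
  assumes Z: "bifibrant Z"
  obtains P p1 p2 j where "path_object Z P p1 p2 j"
proof -
  obtain Q q1 q2 where q: "\<guillemotleft>q1 : Q \<rightarrow> Z\<guillemotright>" "\<guillemotleft>q2 : Q \<rightarrow> Z\<guillemotright>" "q1 \<in> fib M" "q2 \<in> fib M" and Q: "fibrant M Q"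
    and pair: "\<And>T u v. \<lbrakk>\<guillemotleft>u : T \<rightarrow> Z\<guillemotright>; \<guillemotleft>v : T \<rightarrow> Z\<guillemotright>\<rbrakk> \<Longrightarrow> \<exists>h. \<guillemotleft>h : T \<rightarrow> Q\<guillemotright> \<and> q1 \<cdot> h = u \<and> q2 \<cdot> h = v"
    and cancel: "\<And>T h h'. \<lbrakk>\<guillemotleft>h : T \<rightarrow> Q\<guillemotright>; \<guillemotleft>h' : T \<rightarrow> Q\<guillemotright>; q1 \<cdot> h = q1 \<cdot> h'; q2 \<cdot> h = q2 \<cdot> h'\<rbrakk> \<Longrightarrow> h = h'"
    using product_ex[of Z Z] Z by blast
  have idZ: "\<guillemotleft>idm M Z : Z \<rightarrow> Z\<guillemotright>" using Z id_arr fibrant_Ob by blast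
  obtain d where d: "\<guillemotleft>d : Z \<rightarrow> Q\<guillemotright>" "q1 \<cdot> d = idm M Z" "q2 \<cdot> d = idm M Z"
    using pair[OF idZ idZ] by blast
  obtain P j e where j: "\<guillemotleft>j : Z \<rightarrow> P\<guillemotright>" "acyc_cof M j" and e: "\<guillemotleft>e : P \<rightarrow> Q\<guillemotright>" "e \<in> fib M" "e \<cdot> j = d"
    and P: "bifibrant P"
    using factor_acyc_cof_fib[OF d(1) _ Q] Z by blast
  have p: "\<guillemotleft>q1 \<cdot> e : P \<rightarrow> Z\<guillemotright>" "\<guillemotleft>q2 \<cdot> e : P \<rightarrow> Z\<guillemotright>" using e q by auto
  have pj: "(q1 \<cdot> e) \<cdot> j = idm M Z" "(q2 \<cdot> e) \<cdot> j = idm M Z"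
    using e q d j by (auto simp: hom_def)
  have fp: "q1 \<cdot> e \<in> fib M" "q2 \<cdot> e \<in> fib M" using fib_comp e q by (auto simp: hom_def)
  have ac: "acyc_fib M (q1 \<cdot> e)" "acyc_fib M (q2 \<cdot> e)"
    using fib_section_acyc_fib[OF fp(1) p(1) _ _ j(2,1) pj(1)]
      fib_section_acyc_fib[OF fp(2) p(2) _ _ j(2,1) pj(2)] P Z by auto
  have pathZ: "\<exists>h. \<guillemotleft>h : L \<rightarrow> P\<guillemotright> \<and> h \<cdot> l = a \<and> (q1 \<cdot> e) \<cdot> h = u \<and> (q2 \<cdot> e) \<cdot> h = v"
    if *: "acyc_cof M l" "\<guillemotleft>l : K \<rightarrow> L\<guillemotright>" "\<guillemotleft>u : L \<rightarrow> Z\<guillemotright>" "\<guillemotleft>v : L \<rightarrow> Z\<guillemotright>" "\<guillemotleft>a : K \<rightarrow> P\<guillemotright>"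
      "(q1 \<cdot> e) \<cdot> a = u \<cdot> l" "(q2 \<cdot> e) \<cdot> a = v \<cdot> l" for l K L a u v
  proof -
    obtain w where w: "\<guillemotleft>w : L \<rightarrow> Q\<guillemotright>" "q1 \<cdot> w = u" "q2 \<cdot> w = v" using pair[OF *(3,4)] by blast
    have "e \<cdot> a = w \<cdot> l"
      by (rule cancel[where T = K])
        (use * w e q comp_eq_extend[OF w(2), of l] comp_eq_extend[OF w(3), of l] in
          \<open>auto simp: hom_def\<close>)
    then obtain h where "\<guillemotleft>h : L \<rightarrow> P\<guillemotright>" "h \<cdot> l = a" "e \<cdot> h = w"
      using acyc_cof_lift[OF *(1,2) e(2,1) Q *(5) w(1)] by blast
    then show ?thesis using w e q by (intro exI[of _ h]) (simp add: hom_def)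
  qed
  have "path_object Z P (q1 \<cdot> e) (q2 \<cdot> e) j"
    unfolding path_object_def
    by (intro conjI allI impI; (elim conjE)?; (rule pathZ)?) (use p j pj P ac in blast)+
  then show thesis by (rule that)
qed

text \<open>Here the last clause says that $PE \to E \times_Y PY$, formed with the first endpoints, is an
  acyclic fibration.\<close>

definition fib_path_object ::
  "'m \<Rightarrow> 'o \<Rightarrow> 'o \<Rightarrow> 'o \<Rightarrow> 'm \<Rightarrow> 'm \<Rightarrow> 'm \<Rightarrow> 'o \<Rightarrow> 'm \<Rightarrow> 'm \<Rightarrow> 'm \<Rightarrow> 'm \<Rightarrow> bool" where
  "fib_path_object q E Y PY y1 y2 jY PE e1 e2 jE Pq \<longleftrightarrow>
     path_object Y PY y1 y2 jY \<and> path_object E PE e1 e2 jE \<and> \<guillemotleft>Pq : PE \<rightarrow> PY\<guillemotright> \<and>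
     y1 \<cdot> Pq = q \<cdot> e1 \<and> y2 \<cdot> Pq = q \<cdot> e2 \<and> Pq \<cdot> jE = jY \<cdot> q \<and>
     (\<forall>i A B a b d. i \<in> cof M \<and> \<guillemotleft>i : A \<rightarrow> B\<guillemotright> \<and> cofibrant M A \<and> \<guillemotleft>a : A \<rightarrow> PE\<guillemotright> \<and> \<guillemotleft>b : B \<rightarrow> E\<guillemotright> \<and> \<guillemotleft>d : B \<rightarrow> PY\<guillemotright> \<and>
        e1 \<cdot> a = b \<cdot> i \<and> Pq \<cdot> a = d \<cdot> i \<and> y1 \<cdot> d = q \<cdot> b \<longrightarrow>
        (\<exists>h. \<guillemotleft>h : B \<rightarrow> PE\<guillemotright> \<and> h \<cdot> i = a \<and> e1 \<cdot> h = b \<and> Pq \<cdot> h = d))"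

lemma fib_path_objectD:
  assumes "fib_path_object q E Y PY y1 y2 jY PE e1 e2 jE Pq"
  shows "path_object Y PY y1 y2 jY" "path_object E PE e1 e2 jE" "\<guillemotleft>Pq : PE \<rightarrow> PY\<guillemotright>"
     "y1 \<cdot> Pq = q \<cdot> e1" "y2 \<cdot> Pq = q \<cdot> e2" "Pq \<cdot> jE = jY \<cdot> q"
  using assms unfolding fib_path_object_def by blast+

lemma fib_path_object_lift:
  assumes "fib_path_object q E Y PY y1 y2 jY PE e1 e2 jE Pq"
    "i \<in> cof M" "\<guillemotleft>i : A \<rightarrow> B\<guillemotright>" "cofibrant M A" "\<guillemotleft>a : A \<rightarrow> PE\<guillemotright>" "\<guillemotleft>b : B \<rightarrow> E\<guillemotright>" "\<guillemotleft>d : B \<rightarrow> PY\<guillemotright>"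
    "e1 \<cdot> a = b \<cdot> i" "Pq \<cdot> a = d \<cdot> i" "y1 \<cdot> d = q \<cdot> b"
  obtains h where "\<guillemotleft>h : B \<rightarrow> PE\<guillemotright>" "h \<cdot> i = a" "e1 \<cdot> h = b" "Pq \<cdot> h = d"
  using assms unfolding fib_path_object_def by blast

text \<open>PE replaces the object of triples (u, path from q u to q v, v), so a path in E remembers
  its image in PY. Two independently chosen path objects would in general have no comparison map
  with the lifting property of the last clause.\<close>

lemma fib_path_object_ex:
  assumes q: "q \<in> fib M" "\<guillemotleft>q : E \<rightarrow> Y\<guillemotright>" and E: "bifibrant E" and Y: "bifibrant Y"
  obtains PY y1 y2 jY PE e1 e2 jE Pq where "fib_path_object q E Y PY y1 y2 jY PE e1 e2 jE Pq"
proof -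
  obtain PY y1 y2 jY where PY: "path_object Y PY y1 y2 jY"
    using path_object_ex Y by blast
  note y = path_objectD[OF PY]
  have Yf: "fibrant M Y" and Ef: "fibrant M E" and Ec: "cofibrant M E" using E Y by auto
  \<comment> \<open>The source of t is E x_Y PY: a point u of E and a path starting at q u.\<close>
  obtain t f where pb1: "is_pullback M y1 q t f"
    using pullback_ex[OF acyc_fib_fib[OF y(6)] y(1) q(2) Ef Yf] by blast
  note F = pullback_arrs[OF pb1 y(1) q(2)]
  have t: "acyc_fib M t" using pullback_acyc_fib[OF pb1 y(6,1) q(2) Ef Yf] .
  have f: "f \<in> fib M" using pullback_fib[OF pullback_sym[OF pb1] q(1,2) y(1) y(8) Yf] .
  have Ff: "fibrant M (src M t)" using fibrant_src[OF acyc_fib_fib[OF t] F(1) Ef] .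
  have yf: "\<guillemotleft>y2 \<cdot> f : src M t \<rightarrow> Y\<guillemotright>" "y2 \<cdot> f \<in> fib M"
    using y F fib_comp[OF f acyc_fib_fib[OF y(7)]] by (auto simp: hom_def)
  \<comment> \<open>The source of n1 adds a second point v of E above the end of the path.\<close>
  obtain n1 n2 where pb2: "is_pullback M q (y2 \<cdot> f) n1 n2"
    using pullback_ex[OF q yf(1) Ff Yf] by blast
  note N = pullback_arrs[OF pb2 q(2) yf(1)]
  have n1: "n1 \<in> fib M" using pullback_fib[OF pb2 q yf(1) Ff Yf] .
  have n2: "n2 \<in> fib M" using pullback_fib[OF pullback_sym[OF pb2] yf(2,1) q(2) Ef Yf] .
  have Nf: "fibrant M (src M n1)" using fibrant_src[OF n1 N(1) Ff] .
  have idE: "\<guillemotleft>idm M E : E \<rightarrow> E\<guillemotright>" using id_arr fibrant_Ob Ef by blast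
  have "y1 \<cdot> jY \<cdot> q = q \<cdot> idm M E"
    using comp_eq_extend[OF y(4), of q] y q by (auto simp: hom_def)
  then obtain w1 where w1: "\<guillemotleft>w1 : E \<rightarrow> src M t\<guillemotright>" "f \<cdot> w1 = jY \<cdot> q" "t \<cdot> w1 = idm M E"
    using pullback_pair[OF pb1 y(1) q(2) comp_arr[OF q(2) y(3)] idE] by blast
  have "q \<cdot> idm M E = (y2 \<cdot> f) \<cdot> w1"
    using comp_eq_extend[OF y(5), of q] y q w1 F by (auto simp: hom_def)
  then obtain w where w: "\<guillemotleft>w : E \<rightarrow> src M n1\<guillemotright>" "n2 \<cdot> w = idm M E" "n1 \<cdot> w = w1"
    using pullback_pair[OF pb2 q(2) yf(1) idE w1(1)] by blast
  \<comment> \<open>w is the constant triple, so its factorization plays the role of that of the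
    diagonal in \<open>path_object_ex\<close>.\<close>
  obtain PE jE e where jE: "\<guillemotleft>jE : E \<rightarrow> PE\<guillemotright>" "acyc_cof M jE" and e: "\<guillemotleft>e : PE \<rightarrow> src M n1\<guillemotright>" "e \<in> fib M" "e \<cdot> jE = w"
    and PE: "bifibrant PE"
    using factor_acyc_cof_fib[OF w(1) Ec Nf] by blast
  define r where "r = n1 \<cdot> e"
  have r: "\<guillemotleft>r : PE \<rightarrow> src M t\<guillemotright>" "r \<in> fib M"
    using e n1 N fib_comp[of e n1] by (auto simp: r_def hom_def)
  have rj: "r \<cdot> jE = w1" using w jE e N by (auto simp: r_def hom_def)
  define e1 where "e1 = t \<cdot> r"
  define e2 where "e2 = n2 \<cdot> e"
  define Pq where "Pq = f \<cdot> r"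
  have e1: "\<guillemotleft>e1 : PE \<rightarrow> E\<guillemotright>" "e1 \<in> fib M" "e1 \<cdot> jE = idm M E"
    using r F fib_comp[of r t] acyc_fib_fib[OF t] rj jE w1 by (auto simp: e1_def hom_def)
  have e2: "\<guillemotleft>e2 : PE \<rightarrow> E\<guillemotright>" "e2 \<in> fib M" "e2 \<cdot> jE = idm M E"
    using e N fib_comp[of e n2] n2 jE w by (auto simp: e2_def hom_def)
  have a1: "acyc_fib M e1" using fib_section_acyc_fib[OF e1(2,1) _ Ef jE(2,1) e1(3)] PE by blast
  have a2: "acyc_fib M e2" using fib_section_acyc_fib[OF e2(2,1) _ Ef jE(2,1) e2(3)] PE by blast
  \<comment> \<open>r is the map PE -> E x_Y PY. Its composite with the acyclic t is e1, which is
    acyclic as well, so r can be cancelled.\<close>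
  have ar: "acyc_fib M r"
    using acyc_fib_cancel[OF r(2,1) t F(1)] a1 PE Ef unfolding e1_def by blast
  have Pq: "\<guillemotleft>Pq : PE \<rightarrow> PY\<guillemotright>" using r F by (auto simp: Pq_def)
  have y1Pq: "y1 \<cdot> Pq = q \<cdot> e1"
    using comp_square_extend[OF F(3), of r] y q F r by (auto simp: Pq_def e1_def hom_def)
  have y2Pq: "y2 \<cdot> Pq = q \<cdot> e2"
    using comp_square_extend[OF N(3), of e] y q F r N e by (auto simp: Pq_def e2_def r_def hom_def)
  have Pqj: "Pq \<cdot> jE = jY \<cdot> q"
    using rj w1 F r jE by (auto simp: Pq_def hom_def)
  have pathE: "\<exists>h. \<guillemotleft>h : L \<rightarrow> PE\<guillemotright> \<and> h \<cdot> l = a \<and> e1 \<cdot> h = u \<and> e2 \<cdot> h = v"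
    if *: "acyc_cof M l" "\<guillemotleft>l : K \<rightarrow> L\<guillemotright>" "\<guillemotleft>u : L \<rightarrow> E\<guillemotright>" "\<guillemotleft>v : L \<rightarrow> E\<guillemotright>" "\<guillemotleft>a : K \<rightarrow> PE\<guillemotright>"
      "e1 \<cdot> a = u \<cdot> l" "e2 \<cdot> a = v \<cdot> l" for l K L a u v
  proof -
    \<comment> \<open>To join u to v in PE, a path between q u and q v is found in PY, combined with
      u and v to a map into the object of triples, and lifted along e.\<close>
    have "y1 \<cdot> Pq \<cdot> a = (q \<cdot> u) \<cdot> l" "y2 \<cdot> Pq \<cdot> a = (q \<cdot> v) \<cdot> l"
      using comp_square_extend[OF y1Pq, of a] comp_square_extend[OF y2Pq, of a] * y Pq q e1 e2
      by (auto simp: hom_def)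
    then obtain d where d: "\<guillemotleft>d : L \<rightarrow> PY\<guillemotright>" "d \<cdot> l = Pq \<cdot> a" "y1 \<cdot> d = q \<cdot> u" "y2 \<cdot> d = q \<cdot> v"
      using path_object_lift[OF PY *(1,2) comp_arr[OF *(3) q(2)] comp_arr[OF *(4) q(2)]
          comp_arr[OF *(5) Pq]] by blast
    obtain x1 where x1: "\<guillemotleft>x1 : L \<rightarrow> src M t\<guillemotright>" "f \<cdot> x1 = d" "t \<cdot> x1 = u"
      using pullback_pair[OF pb1 y(1) q(2) d(1) *(3) d(3)] by blast
    have "q \<cdot> v = (y2 \<cdot> f) \<cdot> x1" using d x1 y F by (auto simp: hom_def)
    then obtain x where x: "\<guillemotleft>x : L \<rightarrow> src M n1\<guillemotright>" "n2 \<cdot> x = v" "n1 \<cdot> x = x1"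
      using pullback_pair[OF pb2 q(2) yf(1) *(4) x1(1)] by blast
    have "r \<cdot> a = x1 \<cdot> l"
      by (rule pullback_cancel[OF pb1, where T = K])
        (use * d x1 F r e1 Pq comp_eq_extend[OF x1(2), of l] comp_eq_extend[OF x1(3), of l]
          comp_eq_extend[OF e1_def[symmetric], of a] comp_eq_extend[OF Pq_def[symmetric], of a]
          in \<open>auto simp: hom_def\<close>)
    then have "n1 \<cdot> e \<cdot> a = n1 \<cdot> x \<cdot> l"
      using comp_eq_extend[OF x(3), of l] comp_eq_extend[OF r_def[symmetric], of a] x N e *
      by (auto simp: hom_def)
    moreover have "n2 \<cdot> e \<cdot> a = n2 \<cdot> x \<cdot> l"
      using comp_eq_extend[OF x(2), of l] comp_eq_extend[OF e2_def[symmetric], of a] x N e *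
      by (auto simp: hom_def)
    ultimately have "e \<cdot> a = x \<cdot> l"
      using pullback_cancel[OF pb2 comp_arr[OF *(5) e(1)] comp_arr[OF *(2) x(1)]] by blast
    then obtain h where h: "\<guillemotleft>h : L \<rightarrow> PE\<guillemotright>" "h \<cdot> l = a" "e \<cdot> h = x"
      using acyc_cof_lift[OF *(1,2) e(2,1) Nf *(5) x(1)] by blast
    then show ?thesis
      using x x1 e N F by (intro exI[of _ h]) (simp add: e1_def e2_def r_def hom_def)
  qed
  have pE: "path_object E PE e1 e2 jE"
    unfolding path_object_def
    by (intro conjI allI impI; (elim conjE)?; (rule pathE)?) (use e1 e2 jE a1 a2 PE in blast)+
  have liftE: "\<exists>h. \<guillemotleft>h : B \<rightarrow> PE\<guillemotright> \<and> h \<cdot> i = a \<and> e1 \<cdot> h = b \<and> Pq \<cdot> h = d"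
    if *: "i \<in> cof M" "\<guillemotleft>i : A \<rightarrow> B\<guillemotright>" "cofibrant M A" "\<guillemotleft>a : A \<rightarrow> PE\<guillemotright>" "\<guillemotleft>b : B \<rightarrow> E\<guillemotright>" "\<guillemotleft>d : B \<rightarrow> PY\<guillemotright>"
      "e1 \<cdot> a = b \<cdot> i" "Pq \<cdot> a = d \<cdot> i" "y1 \<cdot> d = q \<cdot> b" for i A B a b d
  proof -
    obtain x where x: "\<guillemotleft>x : B \<rightarrow> src M t\<guillemotright>" "f \<cdot> x = d" "t \<cdot> x = b"
      using pullback_pair[OF pb1 y(1) q(2) *(6,5,9)] by blast
    have "r \<cdot> a = x \<cdot> i"
      by (rule pullback_cancel[OF pb1, where T = A])
        (use * x F r e1 Pq comp_eq_extend[OF x(2), of i] comp_eq_extend[OF x(3), of i]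
          comp_eq_extend[OF e1_def[symmetric], of a] comp_eq_extend[OF Pq_def[symmetric], of a]
          in \<open>auto simp: hom_def\<close>)
    then obtain h where "\<guillemotleft>h : B \<rightarrow> PE\<guillemotright>" "h \<cdot> i = a" "r \<cdot> h = x"
      using acyc_fib_lift[OF ar r(1) *(1-4) x(1)] by blast
    then show ?thesis
      using x r F by (intro exI[of _ h]) (simp add: e1_def Pq_def hom_def)
  qed
  have "fib_path_object q E Y PY y1 y2 jY PE e1 e2 jE Pq"
    unfolding fib_path_object_def
    by (intro conjI allI impI; (elim conjE)?; (rule liftE)?) (use PY pE Pq y1Pq y2Pq Pqj in blast)+
  then show thesis by (rule that)
qed

text \<open>Solvability of lifting problems against q is invariant under homotopies of the upper map that
  need not be fibrewise.\<close>

lemma lift_transport: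
  assumes P: "fib_path_object q E Y PY y1 y2 jY PE e1 e2 jE Pq" and q: "\<guillemotleft>q : E \<rightarrow> Y\<guillemotright>"
    and i: "i \<in> cof M" "\<guillemotleft>i : A \<rightarrow> B\<guillemotright>" "cofibrant M A"
    and g: "\<guillemotleft>g : A \<rightarrow> PE\<guillemotright>" and b: "\<guillemotleft>b : B \<rightarrow> Y\<guillemotright>" "q \<cdot> e2 \<cdot> g = b \<cdot> i"
    and lift: "\<And>b'. \<lbrakk>\<guillemotleft>b' : B \<rightarrow> Y\<guillemotright>; q \<cdot> e1 \<cdot> g = b' \<cdot> i\<rbrakk>
      \<Longrightarrow> \<exists>h. \<guillemotleft>h : B \<rightarrow> E\<guillemotright> \<and> h \<cdot> i = e1 \<cdot> g \<and> q \<cdot> h = b'"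
  shows "\<exists>h. \<guillemotleft>h : B \<rightarrow> E\<guillemotright> \<and> h \<cdot> i = e2 \<cdot> g \<and> q \<cdot> h = b"
proof -
  note P' = fib_path_objectD[OF P]
  note y = path_objectD[OF P'(1)] and e = path_objectD[OF P'(2)]
  have "y2 \<cdot> Pq \<cdot> g = b \<cdot> i"
    using comp_square_extend[OF P'(5), of g] P'(3) y(1-3) e(1-3) q g b by (auto simp: hom_def)
  \<comment> \<open>The image of the path g ends at b on A. As y2 is acyclic, it extends to a path d
    on B ending at b; the start of d is the lower map of the new problem.\<close>
  then obtain d where d: "\<guillemotleft>d : B \<rightarrow> PY\<guillemotright>" "d \<cdot> i = Pq \<cdot> g" "y2 \<cdot> d = b"
    using acyc_fib_lift[OF y(7,2) i comp_arr[OF g P'(3)] b(1)] by blast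
  have "q \<cdot> e1 \<cdot> g = (y1 \<cdot> d) \<cdot> i"
    using comp_square_extend[OF P'(4), of g] P'(3) y(1-3) e(1-3) q g d i by (auto simp: hom_def)
  then obtain w where w: "\<guillemotleft>w : B \<rightarrow> E\<guillemotright>" "w \<cdot> i = e1 \<cdot> g" "q \<cdot> w = y1 \<cdot> d"
    using lift[of "y1 \<cdot> d"] d y by blast
  \<comment> \<open>Lifts d to E, starting at the solution w and extending g; the end of h solves
    the original problem.\<close>
  obtain h where h: "\<guillemotleft>h : B \<rightarrow> PE\<guillemotright>" "h \<cdot> i = g" "e1 \<cdot> h = w" "Pq \<cdot> h = d"
    using fib_path_object_lift[OF P i g w(1) d(1)] w d by metis
  have "q \<cdot> e2 \<cdot> h = b"
    using comp_square_extend[OF P'(5), of h] P'(3) y(1-3) e(1-3) q h d by (auto simp: hom_def)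
  moreover have "(e2 \<cdot> h) \<cdot> i = e2 \<cdot> g"
    using h e i by (auto simp: hom_def)
  ultimately show ?thesis using h e by blast
qed

text \<open>The condition on d i says that the path d is constant on A. Its lift to E starts at w
  and can be kept constant on A, so moving to its end changes the lower map without changing the
  upper one.\<close>

lemma lift_along_path:
  assumes P: "fib_path_object q E Y PY y1 y2 jY PE e1 e2 jE Pq" and q: "\<guillemotleft>q : E \<rightarrow> Y\<guillemotright>"
    and i: "i \<in> cof M" "\<guillemotleft>i : A \<rightarrow> B\<guillemotright>" "cofibrant M A"
    and w: "\<guillemotleft>w : B \<rightarrow> E\<guillemotright>" and d: "\<guillemotleft>d : B \<rightarrow> PY\<guillemotright>" "y1 \<cdot> d = q \<cdot> w" "d \<cdot> i = jY \<cdot> q \<cdot> w \<cdot> i"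
  shows "\<exists>h. \<guillemotleft>h : B \<rightarrow> E\<guillemotright> \<and> h \<cdot> i = w \<cdot> i \<and> q \<cdot> h = y2 \<cdot> d"
proof -
  note P' = fib_path_objectD[OF P]
  note y = path_objectD[OF P'(1)] and e = path_objectD[OF P'(2)]
  have "e1 \<cdot> jE \<cdot> w \<cdot> i = w \<cdot> i" "Pq \<cdot> jE \<cdot> w \<cdot> i = d \<cdot> i"
    using comp_eq_extend[OF e(4), of "w \<cdot> i"] comp_square_extend[OF P'(6), of "w \<cdot> i"] P'(3) y(1-3) e(1-3) q w i d
    by (auto simp: hom_def)
  then obtain h where h: "\<guillemotleft>h : B \<rightarrow> PE\<guillemotright>" "h \<cdot> i = jE \<cdot> w \<cdot> i" "e1 \<cdot> h = w" "Pq \<cdot> h = d"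
    using fib_path_object_lift[OF P i _ w d(1) _ _ d(2), of "jE \<cdot> w \<cdot> i"] w i e by blast
  have "q \<cdot> e2 \<cdot> h = y2 \<cdot> d"
    using comp_square_extend[OF P'(5), of h] P'(3) y(1-3) e(1-3) q h d by (auto simp: hom_def)
  moreover have "(e2 \<cdot> h) \<cdot> i = w \<cdot> i"
    using comp_eq_extend[OF e(5), of "w \<cdot> i"] h e i w by (auto simp: hom_def)
  ultimately show ?thesis using h e by blast
qed


section \<open>Left homotopy\<close>

text \<open>The last clause is what the arguments use of K + K -> C being a cofibration; stated this
  way it needs no choice of a coproduct.\<close>

definition cylinder :: "'o \<Rightarrow> 'o \<Rightarrow> 'm \<Rightarrow> 'm \<Rightarrow> 'm \<Rightarrow> bool" where
  "cylinder K C c1 c2 s \<longleftrightarrow>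
     \<guillemotleft>c1 : K \<rightarrow> C\<guillemotright> \<and> \<guillemotleft>c2 : K \<rightarrow> C\<guillemotright> \<and> \<guillemotleft>s : C \<rightarrow> K\<guillemotright> \<and> s \<cdot> c1 = idm M K \<and> s \<cdot> c2 = idm M K \<and>
     acyc_cof M c1 \<and>
     (\<forall>p E Y u v b. acyc_fib M p \<and> \<guillemotleft>p : E \<rightarrow> Y\<guillemotright> \<and> \<guillemotleft>u : K \<rightarrow> E\<guillemotright> \<and> \<guillemotleft>v : K \<rightarrow> E\<guillemotright> \<and> \<guillemotleft>b : C \<rightarrow> Y\<guillemotright> \<and>
        p \<cdot> u = b \<cdot> c1 \<and> p \<cdot> v = b \<cdot> c2 \<longrightarrow>
        (\<exists>h. \<guillemotleft>h : C \<rightarrow> E\<guillemotright> \<and> h \<cdot> c1 = u \<and> h \<cdot> c2 = v \<and> p \<cdot> h = b))"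

lemma cylinderD:
  assumes "cylinder K C c1 c2 s"
  shows "\<guillemotleft>c1 : K \<rightarrow> C\<guillemotright>" "\<guillemotleft>c2 : K \<rightarrow> C\<guillemotright>" "\<guillemotleft>s : C \<rightarrow> K\<guillemotright>" "s \<cdot> c1 = idm M K" "s \<cdot> c2 = idm M K"
    "acyc_cof M c1"
  using assms unfolding cylinder_def by blast+

lemma cylinder_lift:
  assumes "cylinder K C c1 c2 s" "acyc_fib M p" "\<guillemotleft>p : E \<rightarrow> Y\<guillemotright>" "\<guillemotleft>u : K \<rightarrow> E\<guillemotright>" "\<guillemotleft>v : K \<rightarrow> E\<guillemotright>"
    "\<guillemotleft>b : C \<rightarrow> Y\<guillemotright>" "p \<cdot> u = b \<cdot> c1" "p \<cdot> v = b \<cdot> c2"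
  obtains h where "\<guillemotleft>h : C \<rightarrow> E\<guillemotright>" "h \<cdot> c1 = u" "h \<cdot> c2 = v" "p \<cdot> h = b"
  using assms unfolding cylinder_def by blast

text \<open>The relative cylinder of 0 -> K, for which agreement of the two ends on 0 is automatic.
  The axiom applies because K is fibrant.\<close>

lemma cylinder_ex:
  assumes "bifibrant K"
  obtains C c1 c2 s where "cylinder K C c1 c2 s"
proof -
  obtain i where i: "\<guillemotleft>i : zero M \<rightarrow> K\<guillemotright>" "i \<in> cof M"
    using assms by (auto simp: cofibrant_def)
  have K: "fibrant M K" using assms by blast
  show thesis
  proof (rule rel_cylinder_ex[OF i(2,1) cofibrant_zero K])
    fix C c1 c2 s
    assume c: "\<guillemotleft>c1 : K \<rightarrow> C\<guillemotright>" "\<guillemotleft>c2 : K \<rightarrow> C\<guillemotright>" "\<guillemotleft>s : C \<rightarrow> K\<guillemotright>" "s \<cdot> c1 = idm M K" "s \<cdot> c2 = idm M K"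
      "acyc_cof M c1"
    assume lift: "\<And>p E Y u v b. \<lbrakk>acyc_fib M p; \<guillemotleft>p : E \<rightarrow> Y\<guillemotright>; \<guillemotleft>u : K \<rightarrow> E\<guillemotright>; \<guillemotleft>v : K \<rightarrow> E\<guillemotright>; u \<cdot> i = v \<cdot> i;
      \<guillemotleft>b : C \<rightarrow> Y\<guillemotright>; p \<cdot> u = b \<cdot> c1; p \<cdot> v = b \<cdot> c2\<rbrakk>
      \<Longrightarrow> \<exists>h. \<guillemotleft>h : C \<rightarrow> E\<guillemotright> \<and> h \<cdot> c1 = u \<and> h \<cdot> c2 = v \<and> p \<cdot> h = b"
    have lift': "\<exists>h. \<guillemotleft>h : C \<rightarrow> E\<guillemotright> \<and> h \<cdot> c1 = u \<and> h \<cdot> c2 = v \<and> p \<cdot> h = b"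
      if "acyc_fib M p" "\<guillemotleft>p : E \<rightarrow> Y\<guillemotright>" "\<guillemotleft>u : K \<rightarrow> E\<guillemotright>" "\<guillemotleft>v : K \<rightarrow> E\<guillemotright>" "\<guillemotleft>b : C \<rightarrow> Y\<guillemotright>"
        "p \<cdot> u = b \<cdot> c1" "p \<cdot> v = b \<cdot> c2" for p E Y u v b
    proof -
      have "u \<cdot> i = v \<cdot> i" by (rule from_zero_unique) (use that i in auto)
      then show ?thesis using lift[OF that(1-4)] that(5-) by blast
    qed
    have "cylinder K C c1 c2 s"
      unfolding cylinder_def
      by (intro conjI allI impI; (elim conjE)?; (rule lift')?) (use c in blast)+
    then show thesis by (rule that)
  qed
qed

text \<open>The cylinder is not fixed. Comparison of homotopies on different cylinders goes through
  path objects.\<close>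

definition lhtpy :: "'o \<Rightarrow> 'o \<Rightarrow> 'm \<Rightarrow> 'm \<Rightarrow> bool" where
  "lhtpy K Z k k' \<longleftrightarrow>
     (\<exists>C c1 c2 s h. cylinder K C c1 c2 s \<and> \<guillemotleft>h : C \<rightarrow> Z\<guillemotright> \<and> h \<cdot> c1 = k \<and> h \<cdot> c2 = k')"

lemma lhtpy_arr: "lhtpy K Z k k' \<Longrightarrow> \<guillemotleft>k : K \<rightarrow> Z\<guillemotright> \<and> \<guillemotleft>k' : K \<rightarrow> Z\<guillemotright>"
  unfolding lhtpy_def using cylinderD(1,2) by blast

lemma lhtpy_refl:
  assumes "bifibrant K" "\<guillemotleft>k : K \<rightarrow> Z\<guillemotright>"
  shows "lhtpy K Z k k"
proof -
  obtain C c1 c2 s where C: "cylinder K C c1 c2 s" using cylinder_ex assms(1) by blast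
  note c = cylinderD[OF C]
  have "\<guillemotleft>k \<cdot> s : C \<rightarrow> Z\<guillemotright>" "(k \<cdot> s) \<cdot> c1 = k" "(k \<cdot> s) \<cdot> c2 = k"
    using c assms(2) by (auto simp: hom_def)
  then show ?thesis unfolding lhtpy_def using C by blast
qed

lemma lhtpy_comp:
  assumes "lhtpy K Z k k'" "\<guillemotleft>m : Z \<rightarrow> W\<guillemotright>"
  shows "lhtpy K W (m \<cdot> k) (m \<cdot> k')"
proof -
  obtain C c1 c2 s h where C: "cylinder K C c1 c2 s" and h: "\<guillemotleft>h : C \<rightarrow> Z\<guillemotright>" "h \<cdot> c1 = k" "h \<cdot> c2 = k'"
    using assms(1) unfolding lhtpy_def by blast
  note c = cylinderD[OF C]
  have "\<guillemotleft>m \<cdot> h : C \<rightarrow> W\<guillemotright>" "(m \<cdot> h) \<cdot> c1 = m \<cdot> k" "(m \<cdot> h) \<cdot> c2 = m \<cdot> k'"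
    using c h assms(2) by (auto simp: hom_def)
  then show ?thesis unfolding lhtpy_def using C by blast
qed

lemma lhtpy_lift:
  assumes "acyc_fib M p" "\<guillemotleft>p : E \<rightarrow> Y\<guillemotright>" "\<guillemotleft>k : K \<rightarrow> E\<guillemotright>" "\<guillemotleft>k' : K \<rightarrow> E\<guillemotright>" "lhtpy K Y (p \<cdot> k) (p \<cdot> k')"
  shows "lhtpy K E k k'"
proof -
  obtain C c1 c2 s h where C: "cylinder K C c1 c2 s"
    and h: "\<guillemotleft>h : C \<rightarrow> Y\<guillemotright>" "h \<cdot> c1 = p \<cdot> k" "h \<cdot> c2 = p \<cdot> k'"
    using assms(5) unfolding lhtpy_def by blast
  obtain h' where "\<guillemotleft>h' : C \<rightarrow> E\<guillemotright>" "h' \<cdot> c1 = k" "h' \<cdot> c2 = k'"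
    using cylinder_lift[OF C assms(1-4) h(1)] h(2,3) by metis
  then show ?thesis unfolding lhtpy_def using C by blast
qed

lemma path_object_sym: "path_object Z P p1 p2 j \<Longrightarrow> path_object Z P p2 p1 j"
  unfolding path_object_def by metis

text \<open>The constant path at k sits over c1. It extends over C with first endpoint constant and
  second endpoint running along h, because c1 is acyclic; restricting to c2 gives the path.\<close>

lemma lhtpy_path:
  assumes P: "path_object Z P p1 p2 j" and "lhtpy K Z k k'"
  obtains r where "\<guillemotleft>r : K \<rightarrow> P\<guillemotright>" "p1 \<cdot> r = k" "p2 \<cdot> r = k'"
proof -
  obtain C c1 c2 s h where C: "cylinder K C c1 c2 s" and h: "\<guillemotleft>h : C \<rightarrow> Z\<guillemotright>" "h \<cdot> c1 = k" "h \<cdot> c2 = k'"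
    using assms(2) unfolding lhtpy_def by blast
  note c = cylinderD[OF C] and p = path_objectD[OF P]
  have k: "\<guillemotleft>k : K \<rightarrow> Z\<guillemotright>" using c h by auto
  have "p1 \<cdot> j \<cdot> k = (k \<cdot> s) \<cdot> c1" "p2 \<cdot> j \<cdot> k = h \<cdot> c1"
    using comp_eq_extend[OF p(4), of k] comp_eq_extend[OF p(5), of k] p(1-3) k c(1-5) h
    by (auto simp: hom_def)
  then obtain l where l: "\<guillemotleft>l : C \<rightarrow> P\<guillemotright>" "p1 \<cdot> l = k \<cdot> s" "p2 \<cdot> l = h"
    using path_object_lift[OF P c(6,1) comp_arr[OF c(3) k] h(1) comp_arr[OF k p(3)]] by blast
  have "p1 \<cdot> l \<cdot> c2 = k" "p2 \<cdot> l \<cdot> c2 = k'"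
    using comp_square_extend[OF l(2), of c2] comp_eq_extend[OF l(3), of c2] l(1) p(1-3) k c(1-5) h
    by (auto simp: hom_def)
  then show thesis using that[of "l \<cdot> c2"] l(1) c(2) by blast
qed

text \<open>The cylinder is mapped to P with r at c2 and the constant path at c1, all paths having
  first endpoint p1 r; this lifts along the acyclic p1. The second endpoints then form the
  homotopy.\<close>

lemma path_lhtpy:
  assumes P: "path_object Z P p1 p2 j" and K: "bifibrant K" and r: "\<guillemotleft>r : K \<rightarrow> P\<guillemotright>"
  shows "lhtpy K Z (p1 \<cdot> r) (p2 \<cdot> r)"
proof -
  obtain C c1 c2 s where C: "cylinder K C c1 c2 s" using cylinder_ex K by blast
  note c = cylinderD[OF C] and p = path_objectD[OF P]
  have k: "\<guillemotleft>p1 \<cdot> r : K \<rightarrow> Z\<guillemotright>" using p r by blast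
  have "p1 \<cdot> j \<cdot> p1 \<cdot> r = ((p1 \<cdot> r) \<cdot> s) \<cdot> c1" "p1 \<cdot> r = ((p1 \<cdot> r) \<cdot> s) \<cdot> c2"
    using comp_eq_extend[OF p(4), of "p1 \<cdot> r"] k p(1-3) r c(1-5) by (auto simp: hom_def)
  then obtain l where l: "\<guillemotleft>l : C \<rightarrow> P\<guillemotright>" "l \<cdot> c1 = j \<cdot> p1 \<cdot> r" "l \<cdot> c2 = r"
    using cylinder_lift[OF C p(6,1) comp_arr[OF k p(3)] r comp_arr[OF c(3) k]] by blast
  have "\<guillemotleft>p2 \<cdot> l : C \<rightarrow> Z\<guillemotright>" "(p2 \<cdot> l) \<cdot> c1 = p1 \<cdot> r" "(p2 \<cdot> l) \<cdot> c2 = p2 \<cdot> r"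
    using comp_eq_extend[OF p(5), of "p1 \<cdot> r"] k p(1-3) l c(1-5) r by (auto simp: hom_def)
  then show ?thesis unfolding lhtpy_def using C by blast
qed

text \<open>Symmetry comes from exchanging the two projections of a path object; only c1 is known to
  be acyclic in a cylinder, so cylinders are not visibly symmetric.\<close>

lemma lhtpy_sym_bifibrant:
  assumes "bifibrant K" "bifibrant Z" "lhtpy K Z k k'"
  shows "lhtpy K Z k' k"
proof -
  obtain P p1 p2 j where P: "path_object Z P p1 p2 j" using path_object_ex assms(2) by blast
  obtain r where r: "\<guillemotleft>r : K \<rightarrow> P\<guillemotright>" "p1 \<cdot> r = k" "p2 \<cdot> r = k'" using lhtpy_path[OF P assms(3)] by blast
  then show ?thesis using path_lhtpy[OF path_object_sym[OF P] assms(1) r(1)] by simp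
qed

text \<open>The path r from k' to k'' is transported along a homotopy from k' to k while its second
  endpoint stays at k''. The given homotopy is reversed so that it starts at k', where r
  starts.\<close>

lemma lhtpy_trans_bifibrant:
  assumes "bifibrant K" "bifibrant Z" "lhtpy K Z k k'" "lhtpy K Z k' k''"
  shows "lhtpy K Z k k''"
proof -
  obtain P p1 p2 j where P: "path_object Z P p1 p2 j" using path_object_ex assms(2) by blast
  note p = path_objectD[OF P]
  obtain r where r: "\<guillemotleft>r : K \<rightarrow> P\<guillemotright>" "p1 \<cdot> r = k'" "p2 \<cdot> r = k''" using lhtpy_path[OF P assms(4)] by blast
  obtain C c1 c2 s h where C: "cylinder K C c1 c2 s" and h: "\<guillemotleft>h : C \<rightarrow> Z\<guillemotright>" "h \<cdot> c1 = k'" "h \<cdot> c2 = k"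
    using lhtpy_sym_bifibrant[OF assms(1-3)] unfolding lhtpy_def by blast
  note c = cylinderD[OF C]
  have k'': "\<guillemotleft>k'' : K \<rightarrow> Z\<guillemotright>" using lhtpy_arr assms(4) by blast
  have "p1 \<cdot> r = h \<cdot> c1" "p2 \<cdot> r = (k'' \<cdot> s) \<cdot> c1"
    using r h c k'' by (auto simp: hom_def)
  then obtain l where l: "\<guillemotleft>l : C \<rightarrow> P\<guillemotright>" "p1 \<cdot> l = h" "p2 \<cdot> l = k'' \<cdot> s"
    using path_object_lift[OF P c(6,1) h(1) comp_arr[OF c(3) k''] r(1)] by blast
  have "p1 \<cdot> l \<cdot> c2 = k" "p2 \<cdot> l \<cdot> c2 = k''"
    using comp_square_extend[OF l(3), of c2] comp_eq_extend[OF l(2), of c2] l(1) p(1-3) k'' c(1-5) h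
    by (auto simp: hom_def)
  then show ?thesis using path_lhtpy[OF P assms(1), of "l \<cdot> c2"] l(1) c(2) by auto
qed

text \<open>Path objects are available on bifibrant objects only. Since K is cofibrant, maps to Z
  lift to a cofibrant replacement, and homotopies lift along it too.\<close>

lemma lhtpy_sym:
  assumes "bifibrant K" "fibrant M Z" "lhtpy K Z k k'"
  shows "lhtpy K Z k' k"
proof -
  obtain Z' p where p: "\<guillemotleft>p : Z' \<rightarrow> Z\<guillemotright>" "acyc_fib M p" and Z': "bifibrant Z'"
    using cofibrant_replacement assms(2) by blast
  have k: "\<guillemotleft>k : K \<rightarrow> Z\<guillemotright>" "\<guillemotleft>k' : K \<rightarrow> Z\<guillemotright>" using lhtpy_arr assms(3) by auto
  have K: "cofibrant M K" using assms by blast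
  obtain l l' where l: "\<guillemotleft>l : K \<rightarrow> Z'\<guillemotright>" "p \<cdot> l = k" "\<guillemotleft>l' : K \<rightarrow> Z'\<guillemotright>" "p \<cdot> l' = k'"
    using acyc_fib_lift_point[OF p(2,1) K] k by metis
  have "lhtpy K Z' l' l"
    using lhtpy_sym_bifibrant[OF assms(1) Z'] lhtpy_lift[OF p(2,1) l(1,3)] l assms(3) by blast
  then show ?thesis using lhtpy_comp p l by blast
qed

lemma lhtpy_trans:
  assumes "bifibrant K" "fibrant M Z" "lhtpy K Z k k'" "lhtpy K Z k' k''"
  shows "lhtpy K Z k k''"
proof -
  obtain Z' p where p: "\<guillemotleft>p : Z' \<rightarrow> Z\<guillemotright>" "acyc_fib M p" and Z': "bifibrant Z'"
    using cofibrant_replacement assms(2) by blast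
  have k: "\<guillemotleft>k : K \<rightarrow> Z\<guillemotright>" "\<guillemotleft>k' : K \<rightarrow> Z\<guillemotright>" "\<guillemotleft>k'' : K \<rightarrow> Z\<guillemotright>" using lhtpy_arr assms(3,4) by auto
  have K: "cofibrant M K" using assms by blast
  obtain l l' l'' where l: "\<guillemotleft>l : K \<rightarrow> Z'\<guillemotright>" "p \<cdot> l = k" "\<guillemotleft>l' : K \<rightarrow> Z'\<guillemotright>" "p \<cdot> l' = k'"
    "\<guillemotleft>l'' : K \<rightarrow> Z'\<guillemotright>" "p \<cdot> l'' = k''"
    using acyc_fib_lift_point[OF p(2,1) K] k by metis
  have "lhtpy K Z' l l''"
    using lhtpy_trans_bifibrant[OF assms(1) Z'] lhtpy_lift[OF p(2,1) l(1,3)]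
      lhtpy_lift[OF p(2,1) l(3,5)] l assms(3,4) by blast
  then show ?thesis using lhtpy_comp p l by blast
qed

lemma fib_homotopy_equivalence_acyc_fib:
  assumes q: "q \<in> fib M" "\<guillemotleft>q : E \<rightarrow> Y\<guillemotright>" and E: "bifibrant E" and Y: "bifibrant Y"
    and g: "\<guillemotleft>g : Y \<rightarrow> E\<guillemotright>" "lhtpy Y Y (q \<cdot> g) (idm M Y)" "lhtpy E E (g \<cdot> q) (idm M E)"
  shows "acyc_fib M q"
proof (rule acyc_fibI[OF q])
  obtain C c1 c2 s h where C: "cylinder Y C c1 c2 s"
    and h: "\<guillemotleft>h : C \<rightarrow> Y\<guillemotright>" "h \<cdot> c1 = q \<cdot> g" "h \<cdot> c2 = idm M Y"
    using g(2) unfolding lhtpy_def by blast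
  note c = cylinderD[OF C]
  have Yf: "fibrant M Y" using Y by blast
  \<comment> \<open>Lifting the homotopy from q g to the identity, starting at g, ends at a map g'
    with q g' equal to the identity.\<close>
  obtain H where H: "\<guillemotleft>H : C \<rightarrow> E\<guillemotright>" "H \<cdot> c1 = g" "q \<cdot> H = h"
    using acyc_cof_lift[OF c(6,1) q Yf g(1) h(1)] h(2) by metis
  define g' where "g' = H \<cdot> c2"
  have g': "\<guillemotleft>g' : Y \<rightarrow> E\<guillemotright>" using H c by (auto simp: g'_def)
  have qg': "q \<cdot> g' = idm M Y"
    using comp_eq_extend[OF H(3), of c2] H(1) q c(1-3) h by (auto simp: g'_def hom_def)
  have gg': "lhtpy Y E g g'" unfolding lhtpy_def using C H g'_def by blast
  obtain PY y1 y2 jY PE e1 e2 jE Pq where P: "fib_path_object q E Y PY y1 y2 jY PE e1 e2 jE Pq"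
    using fib_path_object_ex[OF q E Y] by blast
  note PE = fib_path_objectD(2)[OF P]
  note e = path_objectD[OF PE]
  obtain r where r: "\<guillemotleft>r : Y \<rightarrow> PE\<guillemotright>" "e1 \<cdot> r = g" "e2 \<cdot> r = g'" using lhtpy_path[OF PE gg'] by blast
  \<comment> \<open>Precomposition with q is immediate for a path, whereas a homotopy on a cylinder
    of Y would have to be moved to a cylinder of E.\<close>
  have "lhtpy E E (e1 \<cdot> r \<cdot> q) (e2 \<cdot> r \<cdot> q)" using path_lhtpy[OF PE E, of "r \<cdot> q"] r q by blast
  moreover have "e1 \<cdot> r \<cdot> q = g \<cdot> q" "e2 \<cdot> r \<cdot> q = g' \<cdot> q"
    using comp_eq_extend[OF r(2), of q] comp_eq_extend[OF r(3), of q] e(1-3) r q by (auto simp: hom_def)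
  ultimately have "lhtpy E E (g' \<cdot> q) (idm M E)"
    using lhtpy_trans_bifibrant[OF E E lhtpy_sym_bifibrant[OF E E] g(3)] by simp
  then obtain z where z: "\<guillemotleft>z : E \<rightarrow> PE\<guillemotright>" "e1 \<cdot> z = g' \<cdot> q" "e2 \<cdot> z = idm M E"
    using lhtpy_path[OF PE] by blast
  fix i A B a b
  assume *: "i \<in> cof M" "\<guillemotleft>i : A \<rightarrow> B\<guillemotright>" "cofibrant M A" "\<guillemotleft>a : A \<rightarrow> E\<guillemotright>" "\<guillemotleft>b : B \<rightarrow> Y\<guillemotright>" "q \<cdot> a = b \<cdot> i"
  have za: "e1 \<cdot> z \<cdot> a = g' \<cdot> q \<cdot> a" "e2 \<cdot> z \<cdot> a = a"
    using comp_square_extend[OF z(2), of a] comp_eq_extend[OF z(3), of a] e(1-3) z * q g'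
    by (auto simp: hom_def)
  have "\<exists>h. \<guillemotleft>h : B \<rightarrow> E\<guillemotright> \<and> h \<cdot> i = e2 \<cdot> z \<cdot> a \<and> q \<cdot> h = b"
  proof (rule lift_transport[OF P q(2) *(1-3)])
    show "\<guillemotleft>z \<cdot> a : A \<rightarrow> PE\<guillemotright>" "\<guillemotleft>b : B \<rightarrow> Y\<guillemotright>" using z * by auto
    show "q \<cdot> e2 \<cdot> z \<cdot> a = b \<cdot> i" using za * by simp
    fix b'
    assume b': "\<guillemotleft>b' : B \<rightarrow> Y\<guillemotright>" "q \<cdot> e1 \<cdot> z \<cdot> a = b' \<cdot> i"
    \<comment> \<open>Here strictness of the section matters: q g' = id turns the hypothesis on b'
      into b' i = q a and places g' b' exactly over b'.\<close>
    have "q \<cdot> g' \<cdot> q \<cdot> a = q \<cdot> a" "q \<cdot> g' \<cdot> b' = b'"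
      using comp_eq_extend[OF qg', of "q \<cdot> a"] comp_eq_extend[OF qg', of b'] q g' * b'(1)
      by (auto simp: hom_def)
    then have "(g' \<cdot> b') \<cdot> i = g' \<cdot> q \<cdot> a" "q \<cdot> g' \<cdot> b' = b'" using za b' g' * by (auto simp: hom_def)
    then show "\<exists>h. \<guillemotleft>h : B \<rightarrow> E\<guillemotright> \<and> h \<cdot> i = e1 \<cdot> z \<cdot> a \<and> q \<cdot> h = b'"
      using za(1) b'(1) g' by (intro exI[of _ "g' \<cdot> b'"]) auto
  qed
  then show "\<exists>h. \<guillemotleft>h : B \<rightarrow> E\<guillemotright> \<and> h \<cdot> i = a \<and> q \<cdot> h = b" using za by simp
qed


section \<open>Zigzags and homotopy classes\<close>

lemma sub_hom_arr: "sub_hom M f \<Longrightarrow> \<guillemotleft>f : src M f \<rightarrow> tgt M f\<guillemotright>"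
  by (simp add: sub_hom_def hom_def)

lemma zz_path_append: "\<lbrakk>zz_path M X ss Y; zz_path M Y ts Z\<rbrakk> \<Longrightarrow> zz_path M X (ss @ ts) Z"
  by (induction rule: zz_path.induct) (auto intro: zz_path.intros)

lemma zz_pathD: "zz_path M X ss Y \<Longrightarrow> X \<in> fc_obj M \<and> Y \<in> fc_obj M"
  by (induction rule: zz_path.induct) (auto simp: sub_hom_def)

lemma zz_path_fwd: "sub_hom M f \<Longrightarrow> zz_path M (src M f) [(True, f)] (tgt M f)"
  by (rule zz_fwd[OF _ zz_nil]) (simp_all add: sub_hom_def)

lemma zz_path_bwd: "w \<in> weq_gen M \<Longrightarrow> sub_hom M w \<Longrightarrow> zz_path M (tgt M w) [(False, w)] (src M w)"
  by (rule zz_bwd[OF _ _ zz_nil]) (simp_all add: sub_hom_def)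

lemma sub_hom_comp: "\<lbrakk>sub_hom M f; sub_hom M g; tgt M f = src M g\<rbrakk> \<Longrightarrow> sub_hom M (g \<cdot> f)"
  by (simp add: sub_hom_def)

lemma zz_eq_path: "zz_eq M X Y ss ts \<Longrightarrow> zz_path M X ss Y \<and> zz_path M X ts Y"
proof (induction rule: zz_eq.induct)
  case (zz_id x)
  then have "x \<in> Ob M" by (simp add: fc_obj_def)
  then have "\<guillemotleft>idm M x : x \<rightarrow> x\<guillemotright>" by (rule id_arr)
  then show ?case
    using zz_id zz_path_fwd[of "idm M x"] zz_nil[of x M] by (simp add: sub_hom_def hom_def)
next
  case (zz_comp f g)
  have "zz_path M (src M g) [(True, g)] (tgt M g)" using zz_path_fwd zz_comp by blast
  moreover have "zz_path M (src M f) [(True, g \<cdot> f)] (tgt M g)"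
    using zz_path_fwd[OF sub_hom_comp[OF zz_comp]] zz_comp by (simp add: sub_hom_def)
  ultimately show ?case using zz_fwd[OF zz_comp(1)] zz_comp(3) by simp
next
  case (zz_inv1 w)
  then show ?case
    using zz_fwd[OF zz_inv1(2) zz_path_bwd] zz_nil[of "src M w" M] by (simp add: sub_hom_def)
next
  case (zz_inv2 w)
  then show ?case
    using zz_bwd[OF zz_inv2 zz_path_fwd] zz_nil[of "tgt M w" M] by (simp add: sub_hom_def)
next
  case zz_ctx
  then show ?case using zz_path_append by blast
qed auto

end

text \<open>K is the test object. Its bifibrancy makes homotopy of maps from K to any fibrant object
  an equivalence relation.\<close>

locale weak_model_test = weak_model +
  fixes K
  assumes K: "cofibrant M K \<and> fibrant M K"
begin

text \<open>Families on X are the elements of the limit of the homotopy classes $[K, Z]$ over all maps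
  $X \to Z$ with Z fibrant, given by representatives. Precomposition makes this strictly functorial
  in X, also when X is only cofibrant and $[K, X]$ itself is not meaningful.\<close>

definition family :: "'a \<Rightarrow> ('b \<Rightarrow> 'b) \<Rightarrow> bool" where
  "family X \<theta> \<longleftrightarrow>
     (\<forall>t Z. \<guillemotleft>t : X \<rightarrow> Z\<guillemotright> \<and> fibrant M Z \<longrightarrow> \<guillemotleft>\<theta> t : K \<rightarrow> Z\<guillemotright>) \<and>
     (\<forall>t Z m W. \<guillemotleft>t : X \<rightarrow> Z\<guillemotright> \<and> fibrant M Z \<and> \<guillemotleft>m : Z \<rightarrow> W\<guillemotright> \<and> fibrant M W \<longrightarrow>
        lhtpy K W (\<theta> (m \<cdot> t)) (m \<cdot> \<theta> t))"

definition fam_eq :: "'a \<Rightarrow> ('b \<Rightarrow> 'b) \<Rightarrow> ('b \<Rightarrow> 'b) \<Rightarrow> bool" where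
  "fam_eq X \<theta> \<eta> \<longleftrightarrow> (\<forall>t Z. \<guillemotleft>t : X \<rightarrow> Z\<guillemotright> \<and> fibrant M Z \<longrightarrow> lhtpy K Z (\<theta> t) (\<eta> t))"

definition push :: "'b \<Rightarrow> ('b \<Rightarrow> 'b) \<Rightarrow> 'b \<Rightarrow> 'b" where
  "push f \<theta> = (\<lambda>t. \<theta> (t \<cdot> f))"

section \<open>Functoriality of families and inversion of the generating weak equivalences\<close>

lemma family_arr: "\<lbrakk>family X \<theta>; \<guillemotleft>t : X \<rightarrow> Z\<guillemotright>; fibrant M Z\<rbrakk> \<Longrightarrow> \<guillemotleft>\<theta> t : K \<rightarrow> Z\<guillemotright>"
  by (simp add: family_def)

lemma family_nat:
  "\<lbrakk>family X \<theta>; \<guillemotleft>t : X \<rightarrow> Z\<guillemotright>; fibrant M Z; \<guillemotleft>m : Z \<rightarrow> W\<guillemotright>; fibrant M W\<rbrakk>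
    \<Longrightarrow> lhtpy K W (\<theta> (m \<cdot> t)) (m \<cdot> \<theta> t)"
  unfolding family_def by blast

lemma fam_eqD: "\<lbrakk>fam_eq X \<theta> \<eta>; \<guillemotleft>t : X \<rightarrow> Z\<guillemotright>; fibrant M Z\<rbrakk> \<Longrightarrow> lhtpy K Z (\<theta> t) (\<eta> t)"
  by (simp add: fam_eq_def)

lemmas htpy_refl = lhtpy_refl[OF K] and htpy_sym = lhtpy_sym[OF K] and htpy_trans = lhtpy_trans[OF K]

lemma fam_eq_refl: "family X \<theta> \<Longrightarrow> fam_eq X \<theta> \<theta>"
  unfolding fam_eq_def using family_arr htpy_refl by blast

lemma fam_eq_sym: "fam_eq X \<theta> \<eta> \<Longrightarrow> fam_eq X \<eta> \<theta>"
  unfolding fam_eq_def using htpy_sym by blast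

lemma fam_eq_trans: "\<lbrakk>fam_eq X \<theta> \<eta>; fam_eq X \<eta> \<zeta>\<rbrakk> \<Longrightarrow> fam_eq X \<theta> \<zeta>"
  unfolding fam_eq_def using htpy_trans by blast

lemma fam_eq_cong_left: "fam_eq X \<theta> \<theta>' \<Longrightarrow> fam_eq X \<theta> \<eta> \<longleftrightarrow> fam_eq X \<theta>' \<eta>"
  using fam_eq_sym[of X \<theta> \<theta>'] fam_eq_trans[of X \<theta> \<theta>' \<eta>] fam_eq_trans[of X \<theta>' \<theta> \<eta>] by blast

lemma push_family:
  assumes f: "\<guillemotleft>f : X \<rightarrow> Y\<guillemotright>" and "family X \<theta>"
  shows "family Y (push f \<theta>)"
  unfolding family_def push_def
proof (intro conjI allI impI; elim conjE)
  fix t Z assume t: "\<guillemotleft>t : Y \<rightarrow> Z\<guillemotright>" "fibrant M Z"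
  then show "\<guillemotleft>\<theta> (t \<cdot> f) : K \<rightarrow> Z\<guillemotright>" using family_arr assms by blast
  fix m W assume "\<guillemotleft>m : Z \<rightarrow> W\<guillemotright>" "fibrant M W"
  then have "lhtpy K W (\<theta> (m \<cdot> t \<cdot> f)) (m \<cdot> \<theta> (t \<cdot> f))"
    using family_nat[OF assms(2) comp_arr[OF f t(1)] t(2)] by blast
  moreover have "(m \<cdot> t) \<cdot> f = m \<cdot> t \<cdot> f" using t f \<open>\<guillemotleft>m : Z \<rightarrow> W\<guillemotright>\<close> by (simp add: hom_def)
  ultimately show "lhtpy K W (\<theta> ((m \<cdot> t) \<cdot> f)) (m \<cdot> \<theta> (t \<cdot> f))" by simp
qed

lemma push_eq: "\<lbrakk>\<guillemotleft>f : X \<rightarrow> Y\<guillemotright>; fam_eq X \<theta> \<eta>\<rbrakk> \<Longrightarrow> fam_eq Y (push f \<theta>) (push f \<eta>)"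
  unfolding fam_eq_def push_def by blast

lemma push_comp:
  assumes "\<guillemotleft>f : X \<rightarrow> Y\<guillemotright>" "\<guillemotleft>g : Y \<rightarrow> Z\<guillemotright>" "family X \<theta>"
  shows "fam_eq Z (push g (push f \<theta>)) (push (g \<cdot> f) \<theta>)"
  unfolding fam_eq_def push_def
proof (intro allI impI; elim conjE)
  fix t W assume t: "\<guillemotleft>t : Z \<rightarrow> W\<guillemotright>" "fibrant M W"
  then have "(t \<cdot> g) \<cdot> f = t \<cdot> g \<cdot> f" using assms by (simp add: hom_def)
  moreover have "\<guillemotleft>\<theta> (t \<cdot> g \<cdot> f) : K \<rightarrow> W\<guillemotright>" using family_arr[OF assms(3)] t assms(1,2) by blast
  ultimately show "lhtpy K W (\<theta> ((t \<cdot> g) \<cdot> f)) (\<theta> (t \<cdot> g \<cdot> f))" using htpy_refl by simp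
qed

lemma push_id:
  assumes "X \<in> Ob M" "family X \<theta>"
  shows "fam_eq X (push (idm M X) \<theta>) \<theta>"
  unfolding fam_eq_def push_def
proof (intro allI impI; elim conjE)
  fix t W assume t: "\<guillemotleft>t : X \<rightarrow> W\<guillemotright>" "fibrant M W"
  then show "lhtpy K W (\<theta> (t \<cdot> idm M X)) (\<theta> t)"
    using htpy_refl[OF family_arr[OF assms(2) t]] by (simp add: hom_def)
qed

text \<open>For fibrant X, families on X amount to homotopy classes of maps from K to X.\<close>

lemma yoneda_family:
  assumes "\<guillemotleft>k : K \<rightarrow> X\<guillemotright>"
  shows "family X (\<lambda>t. t \<cdot> k)"
  unfolding family_def
proof (intro conjI allI impI; elim conjE)
  fix t Z assume t: "\<guillemotleft>t : X \<rightarrow> Z\<guillemotright>" "fibrant M Z"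
  then show "\<guillemotleft>t \<cdot> k : K \<rightarrow> Z\<guillemotright>" using assms by blast
  fix m W assume m: "\<guillemotleft>m : Z \<rightarrow> W\<guillemotright>" "fibrant M W"
  then have "(m \<cdot> t) \<cdot> k = m \<cdot> t \<cdot> k" "\<guillemotleft>m \<cdot> t \<cdot> k : K \<rightarrow> W\<guillemotright>"
    using t assms by (auto simp: hom_def)
  then show "lhtpy K W ((m \<cdot> t) \<cdot> k) (m \<cdot> t \<cdot> k)" using htpy_refl by simp
qed

text \<open>Fibrancy of X allows the family to be evaluated at the identity; naturality along t does
  the rest.\<close>

lemma family_yoneda:
  assumes X: "fibrant M X" and "family X \<theta>" "\<guillemotleft>t : X \<rightarrow> Z\<guillemotright>" "fibrant M Z"
  shows "lhtpy K Z (\<theta> t) (t \<cdot> \<theta> (idm M X))"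
proof -
  have "\<guillemotleft>idm M X : X \<rightarrow> X\<guillemotright>" using id_arr fibrant_Ob X by blast
  then have "lhtpy K Z (\<theta> (t \<cdot> idm M X)) (t \<cdot> \<theta> (idm M X))" using family_nat assms by blast
  then show ?thesis using assms(3) by (simp add: hom_def)
qed

text \<open>At the identity of Y both pushed families take the value at w, which is w after the
  value at the identity of X. Acyclic fibrations reflect homotopies, and the value at the identity
  determines a family.\<close>

lemma push_acyc_fib_inj:
  assumes w: "acyc_fib M w" "\<guillemotleft>w : X \<rightarrow> Y\<guillemotright>" and Y: "fibrant M Y"
    and F: "family X \<theta>" "family X \<eta>" and eq: "fam_eq Y (push w \<theta>) (push w \<eta>)"
  shows "fam_eq X \<theta> \<eta>"
  unfolding fam_eq_def
proof (intro allI impI; elim conjE)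
  fix t Z assume t: "\<guillemotleft>t : X \<rightarrow> Z\<guillemotright>" "fibrant M Z"
  have X: "fibrant M X" using fibrant_src acyc_fib_fib w Y by blast
  have id: "\<guillemotleft>idm M X : X \<rightarrow> X\<guillemotright>" "\<guillemotleft>idm M Y : Y \<rightarrow> Y\<guillemotright>" using id_arr fibrant_Ob X Y by blast+
  have "lhtpy K Y (\<theta> w) (\<eta> w)"
    using fam_eqD[OF eq id(2) Y] w by (simp add: push_def hom_def)
  then have "lhtpy K Y (w \<cdot> \<theta> (idm M X)) (w \<cdot> \<eta> (idm M X))"
    using family_yoneda[OF X F(1) w(2) Y] family_yoneda[OF X F(2) w(2) Y] htpy_sym[OF Y] htpy_trans[OF Y]
    by blast
  then have "lhtpy K X (\<theta> (idm M X)) (\<eta> (idm M X))"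
    using lhtpy_lift[OF w family_arr[OF F(1) id(1) X] family_arr[OF F(2) id(1) X]] by blast
  then have "lhtpy K Z (t \<cdot> \<theta> (idm M X)) (t \<cdot> \<eta> (idm M X))" using lhtpy_comp t by blast
  then show "lhtpy K Z (\<theta> t) (\<eta> t)"
    using family_yoneda[OF X F(1) t] family_yoneda[OF X F(2) t] htpy_sym[OF t(2)] htpy_trans[OF t(2)]
    by blast
qed

text \<open>The map K -> Y that represents the family lifts along w, because K is cofibrant.\<close>

lemma push_acyc_fib_surj:
  assumes w: "acyc_fib M w" "\<guillemotleft>w : X \<rightarrow> Y\<guillemotright>" and Y: "fibrant M Y" and F: "family Y \<eta>"
  shows "\<exists>\<theta>. family X \<theta> \<and> fam_eq Y (push w \<theta>) \<eta>"
proof -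
  have id: "\<guillemotleft>idm M Y : Y \<rightarrow> Y\<guillemotright>" using id_arr fibrant_Ob Y by blast
  obtain k where k: "\<guillemotleft>k : K \<rightarrow> X\<guillemotright>" "w \<cdot> k = \<eta> (idm M Y)"
    using acyc_fib_lift_point[OF w _ family_arr[OF F id Y]] K by blast
  have "fam_eq Y (push w (\<lambda>t. t \<cdot> k)) \<eta>"
    unfolding fam_eq_def push_def
  proof (intro allI impI; elim conjE)
    fix t Z assume t: "\<guillemotleft>t : Y \<rightarrow> Z\<guillemotright>" "fibrant M Z"
    then have "(t \<cdot> w) \<cdot> k = t \<cdot> \<eta> (idm M Y)" using w k by (simp add: hom_def)
    then show "lhtpy K Z ((t \<cdot> w) \<cdot> k) (\<eta> t)"
      using family_yoneda[OF Y F t] htpy_sym[OF t(2)] by simp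
  qed
  then show ?thesis using yoneda_family[OF k(1)] by blast
qed

text \<open>Two extensions along an acyclic cofibration are joined by a path in a cofibrant replacement of
  Z; naturality along its two endpoint maps compares their values.\<close>

lemma family_acyc_cof_indep:
  assumes w: "acyc_cof M w" "\<guillemotleft>w : X \<rightarrow> Y\<guillemotright>" and X: "cofibrant M X" and F: "family Y \<eta>"
    and t: "\<guillemotleft>t : Y \<rightarrow> Z\<guillemotright>" "\<guillemotleft>t' : Y \<rightarrow> Z\<guillemotright>" "t \<cdot> w = t' \<cdot> w" and Z: "fibrant M Z"
  shows "lhtpy K Z (\<eta> t) (\<eta> t')"
proof -
  obtain Z' z where z: "\<guillemotleft>z : Z' \<rightarrow> Z\<guillemotright>" "acyc_fib M z" and Z': "bifibrant Z'"
    using cofibrant_replacement Z by blast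
  obtain P p1 p2 j where P: "path_object Z' P p1 p2 j" using path_object_ex[OF Z'] by blast
  note p = path_objectD[OF P]
  have Zf: "fibrant M Z'" using Z' by blast
  have tw: "\<guillemotleft>t \<cdot> w : X \<rightarrow> Z\<guillemotright>" using t w by blast
  \<comment> \<open>Cofibrancy of X and acyclicity of z make both t and t' lift to Z' with the same
    restriction x to X; the constant path at x then extends to a path between the lifts.\<close>
  obtain x where x: "\<guillemotleft>x : X \<rightarrow> Z'\<guillemotright>" "z \<cdot> x = t \<cdot> w"
    using acyc_fib_lift_point[OF z(2,1) X tw] by blast
  obtain u where u: "\<guillemotleft>u : Y \<rightarrow> Z'\<guillemotright>" "u \<cdot> w = x" "z \<cdot> u = t"
    using acyc_fib_lift[OF z(2,1) acyc_cof_cof[OF w(1)] w(2) X x(1) t(1) x(2)] by blast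
  obtain u' where u': "\<guillemotleft>u' : Y \<rightarrow> Z'\<guillemotright>" "u' \<cdot> w = x" "z \<cdot> u' = t'"
    using acyc_fib_lift[OF z(2,1) acyc_cof_cof[OF w(1)] w(2) X x(1) t(2)] x(2) t(3) by metis
  have "p1 \<cdot> j \<cdot> x = u \<cdot> w" "p2 \<cdot> j \<cdot> x = u' \<cdot> w"
    using comp_eq_extend[OF p(4), of x] comp_eq_extend[OF p(5), of x] p(1-3) x(1) u u'
    by (auto simp: hom_def)
  then obtain r where r: "\<guillemotleft>r : Y \<rightarrow> P\<guillemotright>" "p1 \<cdot> r = u" "p2 \<cdot> r = u'"
    using path_object_lift[OF P w u(1) u'(1) comp_arr[OF x(1) p(3)]] by blast
  have "lhtpy K Z' (\<eta> u) (p1 \<cdot> \<eta> r)" "lhtpy K Z' (\<eta> u') (p2 \<cdot> \<eta> r)"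
    using family_nat[OF F r(1) p(8) p(1) Zf] family_nat[OF F r(1) p(8) p(2) Zf] r by auto
  moreover have "lhtpy K Z' (p1 \<cdot> \<eta> r) (p2 \<cdot> \<eta> r)"
    using path_lhtpy[OF P K family_arr[OF F r(1) p(8)]] .
  ultimately have "lhtpy K Z' (\<eta> u) (\<eta> u')"
    using htpy_sym[OF Zf] htpy_trans[OF Zf] by blast
  then have "lhtpy K Z (z \<cdot> \<eta> u) (z \<cdot> \<eta> u')" using lhtpy_comp z by blast
  moreover have "lhtpy K Z (\<eta> t) (z \<cdot> \<eta> u)" "lhtpy K Z (\<eta> t') (z \<cdot> \<eta> u')"
    using family_nat[OF F u(1) Zf z(1) Z] family_nat[OF F u'(1) Zf z(1) Z] u u' by auto
  ultimately show ?thesis using htpy_sym[OF Z] htpy_trans[OF Z] by blast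
qed

text \<open>Every map from X to a fibrant object extends along w, so the values of the pushed family
  already include all values of the family.\<close>

lemma push_acyc_cof_inj:
  assumes w: "acyc_cof M w" "\<guillemotleft>w : X \<rightarrow> Y\<guillemotright>" and eq: "fam_eq Y (push w \<theta>) (push w \<eta>)"
  shows "fam_eq X \<theta> \<eta>"
  unfolding fam_eq_def
proof (intro allI impI; elim conjE)
  fix t Z assume t: "\<guillemotleft>t : X \<rightarrow> Z\<guillemotright>" "fibrant M Z"
  obtain u where "\<guillemotleft>u : Y \<rightarrow> Z\<guillemotright>" "u \<cdot> w = t" using acyc_cof_extend[OF w t(2,1)] by blast
  then show "lhtpy K Z (\<theta> t) (\<eta> t)" using fam_eqD[OF eq _ t(2)] by (auto simp: push_def)
qed

text \<open>The value at t is that of the given family at a chosen extension of t.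
  \<open>family_acyc_cof_indep\<close> shows that the choice does not matter up to homotopy, which
  gives both naturality and the comparison on Y.\<close>

lemma push_acyc_cof_surj:
  assumes w: "acyc_cof M w" "\<guillemotleft>w : X \<rightarrow> Y\<guillemotright>" and X: "cofibrant M X" and F: "family Y \<eta>"
  shows "\<exists>\<theta>. family X \<theta> \<and> fam_eq Y (push w \<theta>) \<eta>"
proof -
  define ext where "ext t = (SOME u. \<guillemotleft>u : Y \<rightarrow> tgt M t\<guillemotright> \<and> u \<cdot> w = t)" for t
  have ext: "\<guillemotleft>ext t : Y \<rightarrow> Z\<guillemotright> \<and> ext t \<cdot> w = t" if t: "\<guillemotleft>t : X \<rightarrow> Z\<guillemotright>" "fibrant M Z" for t Z
  proof -
    have "\<exists>u. \<guillemotleft>u : Y \<rightarrow> Z\<guillemotright> \<and> u \<cdot> w = t" using acyc_cof_extend[OF w t(2,1)] by blast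
    moreover have "tgt M t = Z" using t by (simp add: hom_def)
    ultimately show ?thesis unfolding ext_def by (metis (mono_tags, lifting) someI_ex)
  qed
  have "family X (\<lambda>t. \<eta> (ext t))"
    unfolding family_def
  proof (intro conjI allI impI; elim conjE)
    fix t Z assume t: "\<guillemotleft>t : X \<rightarrow> Z\<guillemotright>" "fibrant M Z"
    then show "\<guillemotleft>\<eta> (ext t) : K \<rightarrow> Z\<guillemotright>" using family_arr[OF F] ext by blast
    fix m W assume m: "\<guillemotleft>m : Z \<rightarrow> W\<guillemotright>" "fibrant M W"
    have mt: "\<guillemotleft>m \<cdot> t : X \<rightarrow> W\<guillemotright>" using m t by blast
    note e = ext[OF t] and e' = ext[OF mt m(2)]
    have "lhtpy K W (\<eta> (ext (m \<cdot> t))) (\<eta> (m \<cdot> ext t))"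
      by (rule family_acyc_cof_indep[OF w X F])
        (use e e' m t w in \<open>auto simp: hom_def\<close>)
    moreover have "lhtpy K W (\<eta> (m \<cdot> ext t)) (m \<cdot> \<eta> (ext t))"
      using family_nat[OF F] e t m by blast
    ultimately show "lhtpy K W (\<eta> (ext (m \<cdot> t))) (m \<cdot> \<eta> (ext t))"
      using htpy_trans[OF m(2)] by blast
  qed
  moreover have "fam_eq Y (push w (\<lambda>t. \<eta> (ext t))) \<eta>"
    unfolding fam_eq_def push_def
  proof (intro allI impI; elim conjE)
    fix t Z assume t: "\<guillemotleft>t : Y \<rightarrow> Z\<guillemotright>" "fibrant M Z"
    have tw: "\<guillemotleft>t \<cdot> w : X \<rightarrow> Z\<guillemotright>" using w t by blast
    note e = ext[OF tw t(2)]
    show "lhtpy K Z (\<eta> (ext (t \<cdot> w))) (\<eta> t)"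
      by (rule family_acyc_cof_indep[OF w X F]) (use e t in auto)
  qed
  ultimately show ?thesis by blast
qed

section \<open>Zigzags acting on families\<close>

lemma push_weq_inj:
  assumes "w \<in> weq_gen M" "\<guillemotleft>w : X \<rightarrow> Y\<guillemotright>" "family X \<theta>" "family X \<eta>" "fam_eq Y (push w \<theta>) (push w \<eta>)"
  shows "fam_eq X \<theta> \<eta>"
proof -
  have "acyc_cof M w \<or> acyc_fib M w \<and> fibrant M Y"
    using assms(1,2) by (auto simp: weq_gen_def hom_def)
  then show ?thesis
    using push_acyc_cof_inj[OF _ assms(2,5)] push_acyc_fib_inj[OF _ assms(2) _ assms(3-5)] by blast
qed

lemma push_weq_surj:
  assumes "w \<in> weq_gen M" "\<guillemotleft>w : X \<rightarrow> Y\<guillemotright>" "family Y \<eta>"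
  shows "\<exists>\<theta>. family X \<theta> \<and> fam_eq Y (push w \<theta>) \<eta>"
proof -
  have "acyc_cof M w \<and> cofibrant M X \<or> acyc_fib M w \<and> fibrant M Y"
    using assms(1,2) by (auto simp: weq_gen_def hom_def)
  then show ?thesis
    using push_acyc_cof_surj[OF _ assms(2) _ assms(3)] push_acyc_fib_surj[OF _ assms(2) _ assms(3)] by blast
qed

text \<open>A relation and not a function, since a backward step asks for a preimage under
  \<open>push\<close> and this is determined only up to \<open>fam_eq\<close>.\<close>

primrec zz_act :: "(bool \<times> 'b) list \<Rightarrow> 'a \<Rightarrow> ('b \<Rightarrow> 'b) \<Rightarrow> ('b \<Rightarrow> 'b) \<Rightarrow> bool" where
  "zz_act [] X \<theta> \<eta> \<longleftrightarrow> fam_eq X \<theta> \<eta>"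
| "zz_act (s # ss) X \<theta> \<eta> \<longleftrightarrow>
     (if fst s then zz_act ss (tgt M (snd s)) (push (snd s) \<theta>) \<eta>
      else \<exists>\<zeta>. family (src M (snd s)) \<zeta> \<and> fam_eq (tgt M (snd s)) (push (snd s) \<zeta>) \<theta> \<and>
             zz_act ss (src M (snd s)) \<zeta> \<eta>)"

lemma zz_act_cong:
  assumes "zz_path M X ss Y" "family X \<theta>" "family X \<theta>'" "fam_eq X \<theta> \<theta>'" "fam_eq Y \<eta> \<eta>'"
    "zz_act ss X \<theta> \<eta>"
  shows "zz_act ss X \<theta>' \<eta>'"
  using assms
proof (induction arbitrary: \<theta> \<theta>' rule: zz_path.induct)
  case (zz_nil X)
  then show ?case using fam_eq_cong_left[OF zz_nil.prems(3)] fam_eq_trans[OF _ zz_nil.prems(4)] by simp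
next
  case (zz_fwd f ss Y)
  note f = sub_hom_arr[OF zz_fwd(1)]
  have "zz_act ss (tgt M f) (push f \<theta>') \<eta>'"
    by (rule zz_fwd.IH[of "push f \<theta>"])
      (use zz_fwd.prems push_family[OF f] push_eq[OF f] in auto)
  then show ?case by simp
next
  case (zz_bwd w ss Y)
  obtain \<zeta> where z: "family (src M w) \<zeta>" "fam_eq (tgt M w) (push w \<zeta>) \<theta>" "zz_act ss (src M w) \<zeta> \<eta>"
    using zz_bwd.prems by auto
  have "zz_act ss (src M w) \<zeta> \<eta>'"
    using zz_bwd.IH[OF z(1) z(1) fam_eq_refl[OF z(1)]] zz_bwd.prems z by blast
  moreover have "fam_eq (tgt M w) (push w \<zeta>) \<theta>'" using z zz_bwd.prems fam_eq_trans by blast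
  ultimately show ?case using z by auto
qed

text \<open>In a backward step, two preimages of the same family agree by injectivity of
  \<open>push\<close> along generating weak equivalences.\<close>

lemma zz_act_functional:
  assumes "zz_path M X ss Y" "family X \<theta>" "family Y \<eta>" "family Y \<eta>'" "zz_act ss X \<theta> \<eta>" "zz_act ss X \<theta> \<eta>'"
  shows "fam_eq Y \<eta> \<eta>'"
  using assms
proof (induction arbitrary: \<theta> rule: zz_path.induct)
  case (zz_nil X)
  then show ?case using fam_eq_cong_left[of X \<theta> \<eta> \<eta>'] by simp
next
  case (zz_fwd f ss Y)
  note f = sub_hom_arr[OF zz_fwd(1)]
  show ?case by (rule zz_fwd.IH[of "push f \<theta>"]) (use zz_fwd.prems push_family[OF f] in auto)
next
  case (zz_bwd w ss Y)
  note w = sub_hom_arr[OF zz_bwd(2)]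
  obtain \<zeta> where z: "family (src M w) \<zeta>" "fam_eq (tgt M w) (push w \<zeta>) \<theta>" "zz_act ss (src M w) \<zeta> \<eta>"
    using zz_bwd.prems by auto
  obtain \<zeta>' where z': "family (src M w) \<zeta>'" "fam_eq (tgt M w) (push w \<zeta>') \<theta>" "zz_act ss (src M w) \<zeta>' \<eta>'"
    using zz_bwd.prems by auto
  have "fam_eq (src M w) \<zeta>' \<zeta>"
    using push_weq_inj[OF zz_bwd(1) w z'(1) z(1)] fam_eq_trans[OF z'(2) fam_eq_sym[OF z(2)]] by blast
  then have "zz_act ss (src M w) \<zeta> \<eta>'"
    using zz_act_cong[OF zz_bwd(3) z'(1) z(1)] z' fam_eq_refl zz_bwd.prems by blast
  then show ?case using zz_bwd.IH z zz_bwd.prems by blast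
qed

lemma zz_act_append:
  assumes "zz_path M X ss Y" "zz_path M Y ts Z" "family X \<theta>" "family Z \<eta>"
  shows "zz_act (ss @ ts) X \<theta> \<eta> \<longleftrightarrow> (\<exists>\<zeta>. family Y \<zeta> \<and> zz_act ss X \<theta> \<zeta> \<and> zz_act ts Y \<zeta> \<eta>)"
  using assms
proof (induction arbitrary: \<theta> rule: zz_path.induct)
  case (zz_nil X)
  then show ?case
    using zz_act_cong[OF zz_nil.prems(1) _ zz_nil.prems(2) _ fam_eq_refl[OF zz_nil.prems(3)]]
      fam_eq_refl fam_eq_sym by (simp, blast)
next
  case (zz_fwd f ss Y)
  note f = sub_hom_arr[OF zz_fwd(1)]
  show ?case using zz_fwd.IH[OF zz_fwd.prems(1) push_family[OF f zz_fwd.prems(2)] zz_fwd.prems(3)] by simp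
next
  case (zz_bwd w ss Y)
  have "zz_act (ss @ ts) (src M w) \<zeta> \<eta> \<longleftrightarrow> (\<exists>\<xi>. family Y \<xi> \<and> zz_act ss (src M w) \<zeta> \<xi> \<and> zz_act ts Y \<xi> \<eta>)"
    if "family (src M w) \<zeta>" for \<zeta>
    using zz_bwd.IH[OF zz_bwd.prems(1) that zz_bwd.prems(3)] .
  then show ?case by (simp, blast)
qed

text \<open>The action descends to the localization. The rule \<open>zz_inv1\<close> amounts to
  injectivity of \<open>push\<close> along w, \<open>zz_inv2\<close> to surjectivity, and the
  context rule follows by decomposing the action of a concatenation.\<close>

lemma zz_act_eq:
  assumes "zz_eq M X Y ss ts" "family X \<theta>" "family Y \<eta>"
  shows "zz_act ss X \<theta> \<eta> \<longleftrightarrow> zz_act ts X \<theta> \<eta>"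
  using assms
proof (induction arbitrary: \<theta> \<eta> rule: zz_eq.induct)
  case (zz_id x)
  then have x: "x \<in> Ob M" by (simp add: fc_obj_def)
  then have "tgt M (idm M x) = x" using id_arr[OF x] by (simp add: hom_def)
  then show ?case using fam_eq_cong_left[OF push_id[OF x zz_id(2)]] by simp
next
  case (zz_comp f g)
  note f = sub_hom_arr[OF zz_comp(1)] and g = sub_hom_arr[OF zz_comp(2), folded zz_comp(3)]
  have "tgt M (g \<cdot> f) = tgt M g" using f g by (simp add: hom_def)
  then show ?case using fam_eq_cong_left[OF push_comp[OF f g zz_comp(4)]] by simp
next
  case (zz_inv1 w)
  note w = sub_hom_arr[OF zz_inv1(2)]
  have "fam_eq (src M w) \<theta> \<eta>" if "family (src M w) \<zeta>" "fam_eq (tgt M w) (push w \<zeta>) (push w \<theta>)"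
    "fam_eq (src M w) \<zeta> \<eta>" for \<zeta>
    using fam_eq_cong_left[OF push_weq_inj[OF zz_inv1(1) w that(1) zz_inv1(3) that(2)]] that(3) by blast
  moreover have "fam_eq (tgt M w) (push w \<theta>) (push w \<theta>)"
    using fam_eq_refl push_family[OF w] zz_inv1 by blast
  ultimately show ?case using zz_inv1(3) by (simp, blast)
next
  case (zz_inv2 w)
  note w = sub_hom_arr[OF zz_inv2(2)]
  show ?case
    using push_weq_surj[OF zz_inv2(1) w zz_inv2(3)] fam_eq_cong_left[of "tgt M w" _ \<theta> \<eta>]
    by (simp, blast)
next
  case (zz_ctx a as x y ss ts bs b)
  have p: "zz_path M x ss y" "zz_path M x ts y" using zz_eq_path zz_ctx(2) by auto
  have "zz_act (us @ bs) x \<zeta> \<eta> \<longleftrightarrow> (\<exists>\<xi>. family y \<xi> \<and> zz_act us x \<zeta> \<xi> \<and> zz_act bs y \<xi> \<eta>)"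
    if "zz_path M x us y" "family x \<zeta>" for us \<zeta>
    using zz_act_append[OF that(1) zz_ctx(3) that(2) zz_ctx(6)] .
  then have "zz_act (ss @ bs) x \<zeta> \<eta> \<longleftrightarrow> zz_act (ts @ bs) x \<zeta> \<eta>" if "family x \<zeta>" for \<zeta>
    using zz_ctx.IH p that by blast
  then show ?case
    using zz_act_append[OF zz_ctx(1) zz_path_append[OF p(1) zz_ctx(3)] zz_ctx(5,6)]
      zz_act_append[OF zz_ctx(1) zz_path_append[OF p(2) zz_ctx(3)] zz_ctx(5,6)] by blast
qed auto

text \<open>The inverse zigzag relates \<open>push f \<theta>\<close> back to \<theta>, and its
  action is functional.\<close>

lemma equivalence_push_inj:
  assumes e: "equivalence M f" and f: "\<guillemotleft>f : X \<rightarrow> Y\<guillemotright>"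
    and F: "family X \<theta>" "family X \<eta>" "fam_eq Y (push f \<theta>) (push f \<eta>)"
  shows "fam_eq X \<theta> \<eta>"
proof -
  obtain g where g: "zz_path M Y g X" "zz_eq M X X ((True, f) # g) []"
    using e f by (auto simp: equivalence_def hom_def)
  have tf: "tgt M f = Y" using f by (simp add: hom_def)
  have "zz_act g Y (push f \<theta>) \<theta>" "zz_act g Y (push f \<eta>) \<eta>"
    using zz_act_eq[OF g(2) F(1,1)] zz_act_eq[OF g(2) F(2,2)] fam_eq_refl F tf by auto
  moreover note pf = push_family[OF f F(1)] push_family[OF f F(2)]
  ultimately show ?thesis
    using zz_act_functional[OF g(1) pf(2) F(1,2)] zz_act_cong[OF g(1) pf F(3) fam_eq_refl[OF F(1)]]
    by blast
qed

text \<open>The inverse zigzag followed by f relates the family to itself; the intermediate family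
  on X is the preimage.\<close>

lemma equivalence_push_surj:
  assumes e: "equivalence M f" and f: "\<guillemotleft>f : X \<rightarrow> Y\<guillemotright>" and F: "family Y \<eta>"
  shows "\<exists>\<theta>. family X \<theta> \<and> fam_eq Y (push f \<theta>) \<eta>"
proof -
  obtain g where g: "zz_path M Y g X" "zz_eq M Y Y (g @ [(True, f)]) []" and s: "sub_hom M f"
    using e f by (auto simp: equivalence_def hom_def)
  have sf: "src M f = X" "tgt M f = Y" using f by (simp_all add: hom_def)
  have "zz_act (g @ [(True, f)]) Y \<eta> \<eta>" using zz_act_eq[OF g(2) F F] fam_eq_refl F by simp
  then show ?thesis
    using zz_act_append[OF g(1) zz_path_fwd[OF s, unfolded sf] F F] sf by auto
qed


end

context weak_model
begin

text \<open>Two test objects are needed. Surjectivity for K = Y, applied to the identity of Y,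
  produces g with q g homotopic to the identity; injectivity for K = E, applied to g q and the
  identity of E, gives the other homotopy.\<close>

lemma fib_equivalence_acyc_fib:
  assumes q: "q \<in> fib M" "\<guillemotleft>q : E \<rightarrow> Y\<guillemotright>" and E: "bifibrant E" and Y: "bifibrant Y"
    and e: "equivalence M q"
  shows "acyc_fib M q"
proof -
  interpret Yt: weak_model_test M Y by standard (rule Y)
  interpret Et: weak_model_test M E by standard (rule E)
  have fY: "fibrant M Y" and fE: "fibrant M E" using E Y by auto
  have id: "\<guillemotleft>idm M E : E \<rightarrow> E\<guillemotright>" "\<guillemotleft>idm M Y : Y \<rightarrow> Y\<guillemotright>" using id_arr fibrant_Ob fY fE by blast+
  obtain \<theta> where t: "Yt.family E \<theta>" "Yt.fam_eq Y (Yt.push q \<theta>) (\<lambda>t. t \<cdot> idm M Y)"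
    using Yt.equivalence_push_surj[OF e q(2) Yt.yoneda_family[OF id(2)]] by blast
  define g where "g = \<theta> (idm M E)"
  have g: "\<guillemotleft>g : Y \<rightarrow> E\<guillemotright>" using Yt.family_arr[OF t(1) id(1) fE] by (simp add: g_def)
  have "lhtpy Y Y (\<theta> q) (idm M Y)"
    using Yt.fam_eqD[OF t(2) id(2) fY] q id by (simp add: Yt.push_def hom_def)
  moreover have "lhtpy Y Y (\<theta> q) (q \<cdot> g)"
    using Yt.family_yoneda[OF fE t(1) q(2) fY] by (simp add: g_def)
  ultimately have qg: "lhtpy Y Y (q \<cdot> g) (idm M Y)"
    using lhtpy_sym[OF Y fY] lhtpy_trans[OF Y fY] by blast
  have gq: "\<guillemotleft>g \<cdot> q : E \<rightarrow> E\<guillemotright>" using g q by blast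
  obtain P p1 p2 j where P: "path_object Y P p1 p2 j" using path_object_ex[OF Y] by blast
  note p = path_objectD[OF P]
  \<comment> \<open>The homotopy from q g to the identity is turned into a path so that it can be
    precomposed with q.\<close>
  obtain r where r: "\<guillemotleft>r : Y \<rightarrow> P\<guillemotright>" "p1 \<cdot> r = q \<cdot> g" "p2 \<cdot> r = idm M Y" using lhtpy_path[OF P qg] by blast
  have "p1 \<cdot> r \<cdot> q = q \<cdot> g \<cdot> q" "p2 \<cdot> r \<cdot> q = q"
    using comp_square_extend[OF r(2), of q] comp_eq_extend[OF r(3), of q] p(1-3) r q g
    by (auto simp: hom_def)
  then have qgq: "lhtpy E Y (q \<cdot> g \<cdot> q) q"
    using path_lhtpy[OF P E comp_arr[OF q(2) r(1)]] by simp
  have "Et.fam_eq Y (Et.push q (\<lambda>t. t \<cdot> g \<cdot> q)) (Et.push q (\<lambda>t. t \<cdot> idm M E))"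
    unfolding Et.fam_eq_def Et.push_def
  proof (intro allI impI; elim conjE)
    fix t Z assume tt: "\<guillemotleft>t : Y \<rightarrow> Z\<guillemotright>" "fibrant M Z"
    have "(t \<cdot> q) \<cdot> g \<cdot> q = t \<cdot> q \<cdot> g \<cdot> q" "(t \<cdot> q) \<cdot> idm M E = t \<cdot> q"
      using tt q g by (auto simp: hom_def)
    then show "lhtpy E Z ((t \<cdot> q) \<cdot> g \<cdot> q) ((t \<cdot> q) \<cdot> idm M E)"
      using lhtpy_comp[OF qgq tt(1)] by simp
  qed
  from Et.equivalence_push_inj[OF e q(2) Et.yoneda_family[OF gq] Et.yoneda_family[OF id(1)] this]
  have "lhtpy E E (idm M E \<cdot> g \<cdot> q) (idm M E \<cdot> idm M E)"
    using Et.fam_eqD id(1) fE by blast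
  then have "lhtpy E E (g \<cdot> q) (idm M E)" using gq id by (simp add: hom_def)
  with qg g show ?thesis using fib_homotopy_equivalence_acyc_fib[OF q E Y] by blast
qed


section \<open>Two out of three\<close>

lemma zz_path_ends: "zz_path M X ss Y \<Longrightarrow> zz_path M X [] X \<and> zz_path M Y [] Y"
  using zz_pathD[of X ss Y] zz_nil[of X M] zz_nil[of Y M] by simp

lemma zz_eq_append:
  assumes "zz_eq M X Y p p'" "zz_eq M Y Z q q'"
  shows "zz_eq M X Z (p @ q) (p' @ q')"
proof -
  have p: "zz_path M X p Y" "zz_path M X p' Y" and q: "zz_path M Y q Z" "zz_path M Y q' Z"
    using zz_eq_path assms by auto
  have X: "zz_path M X [] X" and Z: "zz_path M Z [] Z" using zz_path_ends[OF p(1)] zz_path_ends[OF q(1)] by auto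
  have "zz_eq M X Z (p @ q) (p' @ q)" using zz_ctx[OF X assms(1) q(1)] by simp
  moreover have "zz_eq M X Z (p' @ q) (p' @ q')" using zz_ctx[OF p(2) assms(2) Z] by simp
  ultimately show ?thesis by (rule zz_trans)
qed

text \<open>Both sides are zigzags, because the inverse of an arrow is in general only a zigzag. Two
  out of three thus becomes cancellation of isomorphisms in the localization.\<close>

definition zz_inverse :: "'o \<Rightarrow> 'o \<Rightarrow> (bool \<times> 'm) list \<Rightarrow> (bool \<times> 'm) list \<Rightarrow> bool" where
  "zz_inverse X Y p p' \<longleftrightarrow> zz_path M X p Y \<and> zz_path M Y p' X \<and>
     zz_eq M X X (p @ p') [] \<and> zz_eq M Y Y (p' @ p) []"

lemma zz_inverse_sym: "zz_inverse X Y p p' \<Longrightarrow> zz_inverse Y X p' p"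
  by (simp add: zz_inverse_def)

lemma zz_inverse_cong:
  assumes "zz_inverse X Y p p'" "zz_eq M X Y p q"
  shows "zz_inverse X Y q p'"
proof -
  have p': "zz_eq M Y X p' p'" using assms(1) zz_refl[of M Y p' X] by (simp add: zz_inverse_def)
  have e: "zz_eq M X X (q @ p') (p @ p')" "zz_eq M Y Y (p' @ q) (p' @ p)"
    using zz_eq_append[OF zz_sym[OF assms(2)] p'] zz_eq_append[OF p' zz_sym[OF assms(2)]] .
  have "zz_eq M X X (q @ p') []" "zz_eq M Y Y (p' @ q) []"
    using assms(1) zz_trans[OF e(1)] zz_trans[OF e(2)] unfolding zz_inverse_def by auto
  then show ?thesis using assms zz_eq_path by (simp add: zz_inverse_def)
qed

lemma zz_eq_cancel_mid:
  assumes "zz_path M X p Y" "zz_eq M Y Y q []" "zz_path M Y r Z"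
  shows "zz_eq M X Z (p @ q @ r) (p @ r)"
  using zz_ctx[OF assms] by simp

lemma zz_inverse_append:
  assumes "zz_inverse X Y p p'" "zz_inverse Y Z q q'"
  shows "zz_inverse X Z (p @ q) (q' @ p')"
proof -
  have p: "zz_path M X p Y" "zz_path M Y p' X" "zz_eq M X X (p @ p') []" "zz_eq M Y Y (p' @ p) []"
    and q: "zz_path M Y q Z" "zz_path M Z q' Y" "zz_eq M Y Y (q @ q') []" "zz_eq M Z Z (q' @ q) []"
    using assms by (auto simp: zz_inverse_def)
  have "zz_eq M X X (p @ (q @ q') @ p') []"
    by (rule zz_trans[OF zz_eq_cancel_mid[OF p(1) q(3) p(2)] p(3)])
  moreover have "zz_eq M Z Z (q' @ (p' @ p) @ q) []"
    by (rule zz_trans[OF zz_eq_cancel_mid[OF q(2) p(4) q(1)] q(4)])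
  ultimately show ?thesis
    using zz_path_append p q by (auto simp: zz_inverse_def)
qed

text \<open>q equals p' followed by p @ q in the localization, a composite of two invertible
  zigzags.\<close>

lemma zz_inverse_cancel_left:
  assumes "zz_inverse X Y p p'" "zz_inverse X Z (p @ q) r" "zz_path M Y q Z"
  shows "\<exists>q'. zz_inverse Y Z q q'"
proof -
  have Y: "zz_path M Y [] Y" using zz_path_ends[OF assms(3)] by simp
  have e: "zz_eq M Y Y (p' @ p) []" using assms(1) by (simp add: zz_inverse_def)
  have "zz_eq M Y Z (p' @ p @ q) q" using zz_eq_cancel_mid[OF Y e assms(3)] by simp
  then show ?thesis
    using zz_inverse_cong[OF zz_inverse_append[OF zz_inverse_sym[OF assms(1)] assms(2)]] by auto
qed

lemma zz_inverse_cancel_right: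
  assumes "zz_inverse Y Z q q'" "zz_inverse X Z (p @ q) r" "zz_path M X p Y"
  shows "\<exists>p'. zz_inverse X Y p p'"
proof -
  have Y: "zz_path M Y [] Y" using zz_path_ends[OF assms(3)] by simp
  have e: "zz_eq M Y Y (q @ q') []" using assms(1) by (simp add: zz_inverse_def)
  have "zz_eq M X Y ((p @ q) @ q') p" using zz_eq_cancel_mid[OF assms(3) e Y] by simp
  then show ?thesis
    using zz_inverse_cong[OF zz_inverse_append[OF assms(2) zz_inverse_sym[OF assms(1)]]] by blast
qed

lemma equivalence_zz_inverse:
  assumes "\<guillemotleft>f : X \<rightarrow> Y\<guillemotright>"
  shows "equivalence M f \<longleftrightarrow> sub_hom M f \<and> (\<exists>g. zz_inverse X Y [(True, f)] g)"
  using assms zz_path_fwd[of f] by (auto simp: equivalence_def zz_inverse_def hom_def)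

lemma weq_gen_equivalence:
  assumes "w \<in> weq_gen M" "sub_hom M w"
  shows "equivalence M w"
  unfolding equivalence_def
  using assms zz_path_bwd[OF assms] zz_inv1[OF assms] zz_inv2[OF assms]
  by (intro conjI exI[of _ "[(False, w)]"]) simp_all

text \<open>Cancellation acts on concatenations, so the single step g f is split into two
  steps.\<close>

lemma zz_inverse_comp:
  assumes "\<guillemotleft>f : X \<rightarrow> Y\<guillemotright>" "\<guillemotleft>g : Y \<rightarrow> Z\<guillemotright>" "sub_hom M f" "sub_hom M g"
  shows "zz_inverse X Z [(True, g \<cdot> f)] h \<longleftrightarrow> zz_inverse X Z ([(True, f)] @ [(True, g)]) h"
proof -
  have e: "zz_eq M X Z ([(True, f)] @ [(True, g)]) [(True, g \<cdot> f)]"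
    using zz_comp[OF assms(3,4)] assms(1,2) by (simp add: hom_def)
  show ?thesis using zz_inverse_cong[OF _ e] zz_inverse_cong[OF _ zz_sym[OF e]] by blast
qed

lemma equivalence_comp:
  assumes f: "\<guillemotleft>f : X \<rightarrow> Y\<guillemotright>" "equivalence M f" and g: "\<guillemotleft>g : Y \<rightarrow> Z\<guillemotright>" "equivalence M g"
  shows "equivalence M (g \<cdot> f)"
proof -
  have s: "sub_hom M f" "sub_hom M g" using f g by (auto simp: equivalence_def)
  have "sub_hom M (g \<cdot> f)" using sub_hom_comp[OF s] f g by (simp add: hom_def)
  moreover obtain f' g' where "zz_inverse X Y [(True, f)] f'" "zz_inverse Y Z [(True, g)] g'"
    using equivalence_zz_inverse f g by blast
  then have "zz_inverse X Z [(True, g \<cdot> f)] (g' @ f')"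
    using zz_inverse_append zz_inverse_comp[OF f(1) g(1) s] by blast
  ultimately show ?thesis using equivalence_zz_inverse[OF comp_arr[OF f(1) g(1)]] by blast
qed

lemma equivalence_cancel_left:
  assumes f: "\<guillemotleft>f : X \<rightarrow> Y\<guillemotright>" "equivalence M f" and g: "\<guillemotleft>g : Y \<rightarrow> Z\<guillemotright>" "sub_hom M g"
    and gf: "equivalence M (g \<cdot> f)"
  shows "equivalence M g"
proof -
  have s: "sub_hom M f" using f by (simp add: equivalence_def)
  obtain f' where f': "zz_inverse X Y [(True, f)] f'" using equivalence_zz_inverse f by blast
  obtain h where "zz_inverse X Z [(True, g \<cdot> f)] h" using equivalence_zz_inverse gf f g by blast
  then have h: "zz_inverse X Z ([(True, f)] @ [(True, g)]) h"
    using zz_inverse_comp[OF f(1) g(1) s g(2)] by blast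
  have "zz_path M Y [(True, g)] Z" using zz_path_fwd[OF g(2)] g(1) by (simp add: hom_def)
  then show ?thesis
    using zz_inverse_cancel_left[OF f' h] equivalence_zz_inverse[OF g(1)] g(2) by blast
qed

lemma equivalence_cancel_right:
  assumes f: "\<guillemotleft>f : X \<rightarrow> Y\<guillemotright>" "sub_hom M f" and g: "\<guillemotleft>g : Y \<rightarrow> Z\<guillemotright>" "equivalence M g"
    and gf: "equivalence M (g \<cdot> f)"
  shows "equivalence M f"
proof -
  have s: "sub_hom M g" using g by (simp add: equivalence_def)
  obtain g' where g': "zz_inverse Y Z [(True, g)] g'" using equivalence_zz_inverse g by blast
  obtain h where "zz_inverse X Z [(True, g \<cdot> f)] h" using equivalence_zz_inverse gf f g by blast
  then have h: "zz_inverse X Z ([(True, f)] @ [(True, g)]) h"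
    using zz_inverse_comp[OF f(1) g(1) f(2) s] by blast
  have "zz_path M X [(True, f)] Y" using zz_path_fwd[OF f(2)] f(1) by (simp add: hom_def)
  then show ?thesis
    using zz_inverse_cancel_right[OF g' h] equivalence_zz_inverse[OF f(1)] f(2) by blast
qed

lemma sub_homI: "\<lbrakk>\<guillemotleft>f : X \<rightarrow> Y\<guillemotright>; fibrant M X \<or> cofibrant M X; fibrant M Y \<or> cofibrant M Y\<rbrakk> \<Longrightarrow> sub_hom M f"
  by (auto simp: sub_hom_def fc_obj_def hom_def fibrant_def cofibrant_def)

lemma acyc_fib_equivalence:
  assumes "acyc_fib M w" "\<guillemotleft>w : X \<rightarrow> Y\<guillemotright>" "fibrant M Y"
  shows "equivalence M w"
proof (rule weq_gen_equivalence)
  show "w \<in> weq_gen M" using assms by (simp add: weq_gen_def hom_def)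
  show "sub_hom M w" using sub_homI assms fibrant_src acyc_fib_fib by metis
qed

lemma acyc_cof_equivalence:
  assumes "acyc_cof M w" "\<guillemotleft>w : X \<rightarrow> Y\<guillemotright>" "cofibrant M X"
  shows "equivalence M w"
proof (rule weq_gen_equivalence)
  show "w \<in> weq_gen M" using assms by (simp add: weq_gen_def hom_def)
  show "sub_hom M w" using sub_homI assms cofibrant_tgt acyc_cof_cof by metis
qed

section \<open>Replacing a map by a fibration\<close>

text \<open>The map $(r, q) : E \to X' \times Y'$ comes from factoring the graph of a lift
  $X' \to Y'$ of f as the acyclic cofibration s followed by a fibration.\<close>

definition fib_model :: "'m \<Rightarrow> 'o \<Rightarrow> 'o \<Rightarrow> 'o \<Rightarrow> 'm \<Rightarrow> 'o \<Rightarrow> 'm \<Rightarrow> 'o \<Rightarrow> 'm \<Rightarrow> 'm \<Rightarrow> 'm \<Rightarrow> bool" where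
  "fib_model f X Y X' x Y' y E s q r \<longleftrightarrow>
     \<guillemotleft>f : X \<rightarrow> Y\<guillemotright> \<and> \<guillemotleft>x : X' \<rightarrow> X\<guillemotright> \<and> \<guillemotleft>y : Y' \<rightarrow> Y\<guillemotright> \<and> \<guillemotleft>s : X' \<rightarrow> E\<guillemotright> \<and> \<guillemotleft>q : E \<rightarrow> Y'\<guillemotright> \<and> \<guillemotleft>r : E \<rightarrow> X'\<guillemotright> \<and>
     fibrant M X \<and> fibrant M Y \<and> bifibrant X' \<and> bifibrant Y' \<and> bifibrant E \<and>
     acyc_fib M x \<and> acyc_fib M y \<and> acyc_cof M s \<and> q \<in> fib M \<and> acyc_fib M r \<and>
     r \<cdot> s = idm M X' \<and> y \<cdot> q \<cdot> s = f \<cdot> x"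

lemma fib_model_ex:
  assumes f: "\<guillemotleft>f : X \<rightarrow> Y\<guillemotright>" and X: "fibrant M X" and Y: "fibrant M Y"
  obtains X' x Y' y E s q r where "fib_model f X Y X' x Y' y E s q r"
proof -
  obtain X' x where x: "\<guillemotleft>x : X' \<rightarrow> X\<guillemotright>" "acyc_fib M x" and X': "bifibrant X'"
    using cofibrant_replacement X by blast
  obtain Y' y where y: "\<guillemotleft>y : Y' \<rightarrow> Y\<guillemotright>" "acyc_fib M y" and Y': "bifibrant Y'"
    using cofibrant_replacement Y by blast
  have X'c: "cofibrant M X'" and X'f: "fibrant M X'" and Y'f: "fibrant M Y'" using X' Y' by auto
  obtain g where g: "\<guillemotleft>g : X' \<rightarrow> Y'\<guillemotright>" "y \<cdot> g = f \<cdot> x"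
    using acyc_fib_lift_point[OF y(2,1) X'c comp_arr[OF x(1) f]] by blast
  obtain Q p1 p2 where p: "\<guillemotleft>p1 : Q \<rightarrow> X'\<guillemotright>" "\<guillemotleft>p2 : Q \<rightarrow> Y'\<guillemotright>" "p1 \<in> fib M" "p2 \<in> fib M" and Q: "fibrant M Q"
    and pair: "\<And>T u v. \<lbrakk>\<guillemotleft>u : T \<rightarrow> X'\<guillemotright>; \<guillemotleft>v : T \<rightarrow> Y'\<guillemotright>\<rbrakk> \<Longrightarrow> \<exists>h. \<guillemotleft>h : T \<rightarrow> Q\<guillemotright> \<and> p1 \<cdot> h = u \<and> p2 \<cdot> h = v"
    by (rule product_ex[OF X'f Y'f]) (rule that; assumption)
  have id: "\<guillemotleft>idm M X' : X' \<rightarrow> X'\<guillemotright>" using id_arr fibrant_Ob X'f by blast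
  obtain w where w: "\<guillemotleft>w : X' \<rightarrow> Q\<guillemotright>" "p1 \<cdot> w = idm M X'" "p2 \<cdot> w = g" using pair[OF id g(1)] by blast
  obtain E s m where s: "\<guillemotleft>s : X' \<rightarrow> E\<guillemotright>" "acyc_cof M s" and m: "\<guillemotleft>m : E \<rightarrow> Q\<guillemotright>" "m \<in> fib M" "m \<cdot> s = w"
    and E: "bifibrant E"
    using factor_acyc_cof_fib[OF w(1) X'c Q] by blast
  have r: "\<guillemotleft>p1 \<cdot> m : E \<rightarrow> X'\<guillemotright>" "p1 \<cdot> m \<in> fib M" "(p1 \<cdot> m) \<cdot> s = idm M X'"
    using p m s w fib_comp[of m p1] by (auto simp: hom_def)
  have q: "\<guillemotleft>p2 \<cdot> m : E \<rightarrow> Y'\<guillemotright>" "p2 \<cdot> m \<in> fib M" "y \<cdot> (p2 \<cdot> m) \<cdot> s = f \<cdot> x"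
    using p m s w fib_comp[of m p2] g y by (auto simp: hom_def)
  \<comment> \<open>The acyclic cofibration s is a section of p1 m, because the first component of
    the graph is the identity.\<close>
  have "acyc_fib M (p1 \<cdot> m)" using fib_section_acyc_fib[OF r(2,1) _ X'f s(2,1) r(3)] E by blast
  then have "fib_model f X Y X' x Y' y E s (p2 \<cdot> m) (p1 \<cdot> m)"
    unfolding fib_model_def using f x y s q r X Y X' Y' E by blast
  then show thesis by (rule that)
qed

lemma fib_modelD:
  assumes "fib_model f X Y X' x Y' y E s q r"
  shows "\<guillemotleft>f : X \<rightarrow> Y\<guillemotright>" "\<guillemotleft>x : X' \<rightarrow> X\<guillemotright>" "\<guillemotleft>y : Y' \<rightarrow> Y\<guillemotright>" "\<guillemotleft>s : X' \<rightarrow> E\<guillemotright>" "\<guillemotleft>q : E \<rightarrow> Y'\<guillemotright>" "\<guillemotleft>r : E \<rightarrow> X'\<guillemotright>"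
    "r \<cdot> s = idm M X'" "y \<cdot> q \<cdot> s = f \<cdot> x"
    "acyc_fib M x" "acyc_fib M y" "acyc_cof M s" "q \<in> fib M" "acyc_fib M r"
    "fibrant M X" "fibrant M Y" "bifibrant X'" "bifibrant Y'" "bifibrant E"
  using assms unfolding fib_model_def by blast+

text \<open>The square y q s = f x has equivalences x, y and s, so f and q can each be cancelled out
  of it.\<close>

lemma fib_model_equivalence_iff:
  assumes "fib_model f X Y X' x Y' y E s q r"
  shows "equivalence M f \<longleftrightarrow> equivalence M q"
proof -
  note m = fib_modelD[OF assms]
  have ex: "equivalence M x" and ey: "equivalence M y" and es: "equivalence M s"
    using acyc_fib_equivalence[OF m(9,2,14)] acyc_fib_equivalence[OF m(10,3,15)]
      acyc_cof_equivalence[OF m(11,4)] m(16) by auto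
  have sub: "sub_hom M f" "sub_hom M q" "sub_hom M (q \<cdot> s)"
    using sub_homI[OF m(1)] sub_homI[OF m(5)] sub_homI[OF comp_arr[OF m(4,5)]] m(14-18) by auto
  have "equivalence M f \<longleftrightarrow> equivalence M (f \<cdot> x)"
    using equivalence_comp[OF m(2) ex m(1)] equivalence_cancel_left[OF m(2) ex m(1) sub(1)] by blast
  also have "\<dots> \<longleftrightarrow> equivalence M (y \<cdot> q \<cdot> s)" using m(8) by simp
  also have "\<dots> \<longleftrightarrow> equivalence M (q \<cdot> s)"
    using equivalence_comp[OF comp_arr[OF m(4,5)] _ m(3) ey]
      equivalence_cancel_right[OF comp_arr[OF m(4,5)] sub(3) m(3) ey] by blast
  also have "\<dots> \<longleftrightarrow> equivalence M q"
    using equivalence_comp[OF m(4) es m(5)] equivalence_cancel_left[OF m(4) es m(5) sub(2)] by blast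
  finally show ?thesis .
qed

section \<open>Lifting against the fibration and surjectivity on setoids\<close>

lemma weak_cylinderD:
  assumes "rel_weak_cyl M i i1 i2 c d e" and i: "\<guillemotleft>i : A \<rightarrow> B\<guillemotright>"
  shows "\<guillemotleft>c \<cdot> i1 : B \<rightarrow> tgt M c\<guillemotright>" "\<guillemotleft>c \<cdot> i2 : B \<rightarrow> tgt M c\<guillemotright>" "(c \<cdot> i1) \<cdot> i = (c \<cdot> i2) \<cdot> i"
    "acyc_cof M (c \<cdot> i1)" "\<guillemotleft>c : tgt M i2 \<rightarrow> tgt M c\<guillemotright>" "c \<in> cof M" "is_pushout M i i i2 i1"
proof -
  show po: "is_pushout M i i i2 i1" and "c \<in> cof M" "acyc_cof M (c \<cdot> i1)"
    using assms by (auto simp: rel_weak_cyl_def)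
  note po' = pushout_arrs[OF po i i]
  show c: "\<guillemotleft>c : tgt M i2 \<rightarrow> tgt M c\<guillemotright>"
    using assms po' cof_Ar by (auto simp: rel_weak_cyl_def hom_def)
  show "\<guillemotleft>c \<cdot> i1 : B \<rightarrow> tgt M c\<guillemotright>" "\<guillemotleft>c \<cdot> i2 : B \<rightarrow> tgt M c\<guillemotright>" using po' c by auto
  show "(c \<cdot> i1) \<cdot> i = (c \<cdot> i2) \<cdot> i" using po' c i by (auto simp: hom_def)
qed

text \<open>A weak cylinder need not project to B, so the constant homotopy is obtained by extending
  b along the acyclic cofibration e and composing with d. This is where fibrancy of Z
  enters.\<close>

lemma weak_cylinder_const:
  assumes "rel_weak_cyl M i i1 i2 c d e" and i: "\<guillemotleft>i : A \<rightarrow> B\<guillemotright>" and b: "\<guillemotleft>b : B \<rightarrow> Z\<guillemotright>" and Z: "fibrant M Z"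
  obtains h where "\<guillemotleft>h : tgt M c \<rightarrow> Z\<guillemotright>" "h \<cdot> c \<cdot> i1 = b" "h \<cdot> c \<cdot> i2 = b"
proof -
  note c = weak_cylinderD[OF assms(1,2)]
  have d: "\<guillemotleft>d : tgt M c \<rightarrow> tgt M e\<guillemotright>" "\<guillemotleft>e : B \<rightarrow> tgt M e\<guillemotright>" "acyc_cof M e" "d \<cdot> c \<cdot> i1 = e" "d \<cdot> c \<cdot> i2 = e"
    using assms(1) i cof_Ar acyc_cof_cof by (auto simp: rel_weak_cyl_def hom_def)
  obtain k where k: "\<guillemotleft>k : tgt M e \<rightarrow> Z\<guillemotright>" "k \<cdot> e = b" using acyc_cof_extend[OF d(3,2) Z b] by blast
  have "\<guillemotleft>k \<cdot> d : tgt M c \<rightarrow> Z\<guillemotright>" "(k \<cdot> d) \<cdot> c \<cdot> i1 = b" "(k \<cdot> d) \<cdot> c \<cdot> i2 = b"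
    using k d c(1,2) by (auto simp: hom_def)
  then show thesis by (rule that)
qed

text \<open>Surjectivity yields a homotopy in Y, whereas a lifting problem against q lives over Y'.
  The homotopy is lifted along y, turned into a path in Y' that is constant on A, and followed by a
  lift to E.\<close>

lemma pi_surj_lifts:
  assumes m: "fib_model f X Y X' x Y' y E s q r"
    and i: "i \<in> cof M" "\<guillemotleft>i : A \<rightarrow> B\<guillemotright>" "cofibrant M A"
    and cyl: "rel_weak_cyl M i i1 i2 c d e"
    and surj: "\<And>z. \<guillemotleft>z : A \<rightarrow> X\<guillemotright> \<Longrightarrow> pi_surj M i i1 i2 c f z"
  shows "lifts M i q"
proof -
  note m' = fib_modelD[OF m] and c = weak_cylinderD[OF cyl i(2)]
  have ty: "src M f = X" "tgt M f = Y" "src M i = A" "tgt M i = B" "src M q = E" "tgt M q = Y'"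
    using m' i by (auto simp: hom_def)
  obtain PY y1 y2 jY PE e1 e2 jE Pq where P: "fib_path_object q E Y' PY y1 y2 jY PE e1 e2 jE Pq"
    using fib_path_object_ex[OF m'(12,5,18,17)] by blast
  note PY = fib_path_objectD(1)[OF P] and PE = fib_path_objectD(2)[OF P]
  note yp = path_objectD[OF PY] and ep = path_objectD[OF PE]
  have idE: "\<guillemotleft>idm M E : E \<rightarrow> E\<guillemotright>" using id_arr fibrant_Ob m'(18) by blast
  \<comment> \<open>s r and the identity agree along the acyclic cofibration s, hence are joined by
    a path z. It replaces the upper map a by s r a, the form that surjectivity can treat.\<close>
  have "e1 \<cdot> jE \<cdot> s = (s \<cdot> r) \<cdot> s" "e2 \<cdot> jE \<cdot> s = idm M E \<cdot> s"
    using comp_eq_extend[OF ep(4), of s] comp_eq_extend[OF ep(5), of s] ep(1-3) m'(1-8)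
    by (auto simp: hom_def)
  then obtain z where z: "\<guillemotleft>z : E \<rightarrow> PE\<guillemotright>" "e1 \<cdot> z = s \<cdot> r" "e2 \<cdot> z = idm M E"
    using path_object_lift[OF PE m'(11,4) comp_arr[OF m'(6,4)] idE comp_arr[OF m'(4) ep(3)]] by blast
  have "\<exists>h. \<guillemotleft>h : B \<rightarrow> E\<guillemotright> \<and> h \<cdot> i = a \<and> q \<cdot> h = b"
    if a: "\<guillemotleft>a : A \<rightarrow> E\<guillemotright>" and b: "\<guillemotleft>b : B \<rightarrow> Y'\<guillemotright>" "q \<cdot> a = b \<cdot> i" for a b
  proof -
    define x' where "x' = r \<cdot> a"
    have x': "\<guillemotleft>x' : A \<rightarrow> X'\<guillemotright>" using a m'(6) by (auto simp: x'_def)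
    have za: "e1 \<cdot> z \<cdot> a = s \<cdot> x'" "e2 \<cdot> z \<cdot> a = a"
      using comp_square_extend[OF z(2), of a] comp_eq_extend[OF z(3), of a] ep(1-3) m'(4,6) z a
      by (auto simp: hom_def x'_def)
    have "\<exists>h. \<guillemotleft>h : B \<rightarrow> E\<guillemotright> \<and> h \<cdot> i = e2 \<cdot> z \<cdot> a \<and> q \<cdot> h = b"
    proof (rule lift_transport[OF P m'(5) i])
      show "\<guillemotleft>z \<cdot> a : A \<rightarrow> PE\<guillemotright>" "\<guillemotleft>b : B \<rightarrow> Y'\<guillemotright>" "q \<cdot> e2 \<cdot> z \<cdot> a = b \<cdot> i" using z a b za by auto
      fix b' assume b': "\<guillemotleft>b' : B \<rightarrow> Y'\<guillemotright>" "q \<cdot> e1 \<cdot> z \<cdot> a = b' \<cdot> i"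
      then have bi: "b' \<cdot> i = q \<cdot> s \<cdot> x'" using za by simp
      have "\<guillemotleft>x \<cdot> x' : A \<rightarrow> X\<guillemotright>" using x' m'(2) by blast
      then have "pi_surj M i i1 i2 c f (x \<cdot> x')" by (rule surj)
      moreover have "y \<cdot> q \<cdot> s \<cdot> x' = f \<cdot> x \<cdot> x'"
        using comp_square_extend[of y "q \<cdot> s" f x x'] m'(1-8) x' by (auto simp: hom_def)
      then have "pi_el M i Y (f \<cdot> x \<cdot> x') (y \<cdot> b')"
        using bi b' m'(3) i by (auto simp: pi_el_def hom_def)
      ultimately obtain u h where u: "\<guillemotleft>u : B \<rightarrow> X\<guillemotright>" "u \<cdot> i = x \<cdot> x'"
        and h: "\<guillemotleft>h : tgt M c \<rightarrow> Y\<guillemotright>" "h \<cdot> c \<cdot> i1 = y \<cdot> b'" "h \<cdot> c \<cdot> i2 = f \<cdot> u"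
        unfolding pi_surj_def pi_el_def rel_htpy_def ty by blast
      obtain u' where u': "\<guillemotleft>u' : B \<rightarrow> X'\<guillemotright>" "u' \<cdot> i = x'" "x \<cdot> u' = u"
        using acyc_fib_lift[OF m'(9,2) i x' u(1)] u(2) by metis
      have w: "\<guillemotleft>s \<cdot> u' : B \<rightarrow> E\<guillemotright>" "\<guillemotleft>q \<cdot> s \<cdot> u' : B \<rightarrow> Y'\<guillemotright>" using u' m'(4,5) by auto
      have wi: "b' \<cdot> i = (q \<cdot> s \<cdot> u') \<cdot> i" using u' bi m'(4,5) i by (auto simp: hom_def)
      have "y \<cdot> q \<cdot> s \<cdot> u' = f \<cdot> u"
        using comp_square_extend[of y "q \<cdot> s" f x u'] m'(1-8) u' by (auto simp: hom_def)
      \<comment> \<open>b' and q s u' agree on A, so the homotopy h lifts along y to one with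
        exactly these ends.\<close>
      then obtain h' where h': "\<guillemotleft>h' : tgt M c \<rightarrow> Y'\<guillemotright>" "h' \<cdot> c \<cdot> i1 = b'" "h' \<cdot> c \<cdot> i2 = q \<cdot> s \<cdot> u'"
        using rel_cylinder_lift[OF c(7) i c(6,5) m'(10,3) b'(1) w(2) wi h(1)] h(2,3) by metis
      have Y'f: "fibrant M Y'" using m'(17) by blast
      obtain k where k: "\<guillemotleft>k : tgt M c \<rightarrow> Y'\<guillemotright>" "k \<cdot> c \<cdot> i1 = b'" "k \<cdot> c \<cdot> i2 = b'"
        using weak_cylinder_const[OF cyl i(2) b'(1) Y'f] by blast
      \<comment> \<open>Conversion of h' into a path: l starts as the constant path at b', its first
        endpoint follows h' and its second stays at b'. At the other end of the cylinder, d is a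
        path from q s u' to b', the direction that \<open>lift_along_path\<close> requires.\<close>
      have "y1 \<cdot> jY \<cdot> b' = h' \<cdot> c \<cdot> i1" "y2 \<cdot> jY \<cdot> b' = k \<cdot> c \<cdot> i1"
        using comp_eq_extend[OF yp(4), of b'] comp_eq_extend[OF yp(5), of b'] yp(1-3) b'(1) h' k
        by (auto simp: hom_def)
      then obtain l where l: "\<guillemotleft>l : tgt M c \<rightarrow> PY\<guillemotright>" "l \<cdot> c \<cdot> i1 = jY \<cdot> b'" "y1 \<cdot> l = h'" "y2 \<cdot> l = k"
        using path_object_lift[OF PY c(4,1) h'(1) k(1) comp_arr[OF b'(1) yp(3)]] by blast
      define d where "d = l \<cdot> c \<cdot> i2"
      have d: "\<guillemotleft>d : B \<rightarrow> PY\<guillemotright>" using l c(2) by (auto simp: d_def)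
      have yd: "y1 \<cdot> d = q \<cdot> s \<cdot> u'" "y2 \<cdot> d = b'"
        using comp_eq_extend[OF l(3), of "c \<cdot> i2"] comp_eq_extend[OF l(4), of "c \<cdot> i2"] yp(1-3) l(1)
          c(2) h' k by (auto simp: d_def hom_def)
      \<comment> \<open>The two inclusions of B into the cylinder agree on A, so d restricts there
        to the same constant path as l at its start.\<close>
      have "d \<cdot> i = l \<cdot> (c \<cdot> i2) \<cdot> i" using l(1) c(2) i unfolding d_def hom_def by (metis comp_assoc)
      also have "\<dots> = (l \<cdot> c \<cdot> i1) \<cdot> i" using l(1) c(1,3) i unfolding hom_def by (metis comp_assoc)
      also have "\<dots> = jY \<cdot> b' \<cdot> i" using l(2) yp(3) b'(1) i by (simp add: hom_def)
      also have "\<dots> = jY \<cdot> q \<cdot> (s \<cdot> u') \<cdot> i" using wi m'(4,5) u' i by (simp add: hom_def)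
      finally have di: "d \<cdot> i = jY \<cdot> q \<cdot> (s \<cdot> u') \<cdot> i" .
      have "(s \<cdot> u') \<cdot> i = e1 \<cdot> z \<cdot> a" using za u' m'(4) i by (auto simp: hom_def)
      then show "\<exists>h. \<guillemotleft>h : B \<rightarrow> E\<guillemotright> \<and> h \<cdot> i = e1 \<cdot> z \<cdot> a \<and> q \<cdot> h = b'"
        using lift_along_path[OF P m'(5) i w(1) d yd(1) di] yd(2) by simp
    qed
    then show ?thesis using za by simp
  qed
  then show ?thesis unfolding lifts_def ty by blast
qed

text \<open>The preimage of v is x r w, where w solves a lifting problem for v in E. Both w and s r
  w have image r w under r and agree on A, so they are joined by a homotopy relative to A, and y q
  carries it to one from v to f x r w.\<close>

lemma acyc_fib_pi_surj:
  assumes m: "fib_model f X Y X' x Y' y E s q r" and q: "acyc_fib M q"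
    and i: "i \<in> cof M" "\<guillemotleft>i : A \<rightarrow> B\<guillemotright>" "cofibrant M A"
    and cyl: "rel_weak_cyl M i i1 i2 c d e" and z: "\<guillemotleft>z : A \<rightarrow> X\<guillemotright>"
  shows "pi_surj M i i1 i2 c f z"
proof -
  note m' = fib_modelD[OF m] and c = weak_cylinderD[OF cyl i(2)]
  have ty: "src M f = X" "tgt M f = Y" "tgt M i = B" using m' i by (auto simp: hom_def)
  have "\<exists>u. (\<guillemotleft>u : B \<rightarrow> X\<guillemotright> \<and> u \<cdot> i = z) \<and>
      (\<exists>h. \<guillemotleft>h : tgt M c \<rightarrow> Y\<guillemotright> \<and> h \<cdot> c \<cdot> i1 = v \<and> h \<cdot> c \<cdot> i2 = f \<cdot> u)"
    if v: "\<guillemotleft>v : B \<rightarrow> Y\<guillemotright>" "v \<cdot> i = f \<cdot> z" for v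
  proof -
    obtain x' where x': "\<guillemotleft>x' : A \<rightarrow> X'\<guillemotright>" "x \<cdot> x' = z"
      using acyc_fib_lift_point[OF m'(9,2) i(3) z] by blast
    have sx: "\<guillemotleft>s \<cdot> x' : A \<rightarrow> E\<guillemotright>" using x' m'(4) by blast
    have "y \<cdot> q \<cdot> s \<cdot> x' = v \<cdot> i"
      using comp_square_extend[of y "q \<cdot> s" f x x'] m'(1-8) x' v by (auto simp: hom_def)
    then obtain v' where v': "\<guillemotleft>v' : B \<rightarrow> Y'\<guillemotright>" "v' \<cdot> i = q \<cdot> s \<cdot> x'" "y \<cdot> v' = v"
      using acyc_fib_lift[OF m'(10,3) i comp_arr[OF sx m'(5)] v(1)] by blast
    obtain w where w: "\<guillemotleft>w : B \<rightarrow> E\<guillemotright>" "w \<cdot> i = s \<cdot> x'" "q \<cdot> w = v'"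
      using acyc_fib_lift[OF q m'(5) i sx v'(1)] v'(2) by metis
    have rw: "\<guillemotleft>r \<cdot> w : B \<rightarrow> X'\<guillemotright>" using w m'(6) by blast
    have rwi: "(r \<cdot> w) \<cdot> i = x'"
      using comp_eq_extend[OF m'(7), of x'] w m'(4,6) x' i by (auto simp: hom_def)
    have X'f: "fibrant M X'" using m'(16) by blast
    obtain k where k: "\<guillemotleft>k : tgt M c \<rightarrow> X'\<guillemotright>" "k \<cdot> c \<cdot> i1 = r \<cdot> w" "k \<cdot> c \<cdot> i2 = r \<cdot> w"
      using weak_cylinder_const[OF cyl i(2) rw X'f] by blast
    have sr: "\<guillemotleft>s \<cdot> r \<cdot> w : B \<rightarrow> E\<guillemotright>" using rw m'(4) by blast
    have wi: "w \<cdot> i = (s \<cdot> r \<cdot> w) \<cdot> i" using rwi w sr rw m'(4,6) i by (auto simp: hom_def)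
    \<comment> \<open>With r s the identity, the constant homotopy k has the images of w and s r w
      as its ends, which permits lifting it along r.\<close>
    have "r \<cdot> s \<cdot> r \<cdot> w = k \<cdot> c \<cdot> i2"
      using comp_eq_extend[OF m'(7), of "r \<cdot> w"] rw k m'(4,6) by (auto simp: hom_def)
    then obtain h where h: "\<guillemotleft>h : tgt M c \<rightarrow> E\<guillemotright>" "h \<cdot> c \<cdot> i1 = w" "h \<cdot> c \<cdot> i2 = s \<cdot> r \<cdot> w"
      using rel_cylinder_lift[OF c(7) i c(6,5) m'(13,6) w(1) sr wi k(1)] k(2) by metis
    have "y \<cdot> q \<cdot> s \<cdot> r \<cdot> w = f \<cdot> x \<cdot> r \<cdot> w"
      using comp_square_extend[of y "q \<cdot> s" f x "r \<cdot> w"] m'(1-8) rw by (auto simp: hom_def)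
    then have "\<guillemotleft>y \<cdot> q \<cdot> h : tgt M c \<rightarrow> Y\<guillemotright>" "(y \<cdot> q \<cdot> h) \<cdot> c \<cdot> i1 = v" "(y \<cdot> q \<cdot> h) \<cdot> c \<cdot> i2 = f \<cdot> x \<cdot> r \<cdot> w"
      using h w v' c(1,2) m'(3,5) by (auto simp: hom_def)
    moreover have "\<guillemotleft>x \<cdot> r \<cdot> w : B \<rightarrow> X\<guillemotright>" "(x \<cdot> r \<cdot> w) \<cdot> i = z"
      using rw rwi m'(2) x' i by (auto simp: hom_def)
    ultimately show ?thesis by blast
  qed
  then show ?thesis unfolding pi_surj_def pi_el_def rel_htpy_def ty by blast
qed

end

theorem theoremA2p6:
  fixes M :: "('o, 'm) wcat" and I :: "'m set" and f :: 'm
    and i1 i2 c d e :: "'m \<Rightarrow> 'm"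
  assumes "weak_model_category M"
    and "pseudo_generating M I"
    and "\<forall>i\<in>I. cofibrant M (src M i)"
    and "\<forall>i\<in>I. rel_weak_cyl M i (i1 i) (i2 i) (c i) (d i) (e i)"
    and "f \<in> Ar M" and "fibrant M (src M f)" and "fibrant M (tgt M f)"
  shows "equivalence M f \<longleftrightarrow>
    (\<forall>i\<in>I. \<forall>x. hom M (src M i) (src M f) x \<longrightarrow> pi_surj M i (i1 i) (i2 i) (c i) f x)"
proof -
  interpret weak_model M by standard (rule assms(1))
  have f: "\<guillemotleft>f : src M f \<rightarrow> tgt M f\<guillemotright>" using assms(5) by (simp add: hom_def)
  obtain X' x Y' y E s q r where m: "fib_model f (src M f) (tgt M f) X' x Y' y E s q r"
    using fib_model_ex[OF f assms(6,7)] by blast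
  note m' = fib_modelD[OF m]
  have i: "i \<in> cof M" "\<guillemotleft>i : src M i \<rightarrow> tgt M i\<guillemotright>" "cofibrant M (src M i)"
    "rel_weak_cyl M i (i1 i) (i2 i) (c i) (d i) (e i)" if "i \<in> I" for i
    using that assms(2-4) cof_Ar by (auto simp: pseudo_generating_def hom_def)
  have q: "src M q = E" "tgt M q = Y'" using m'(5) by (auto simp: hom_def)
  have "equivalence M f \<longleftrightarrow> equivalence M q" by (rule fib_model_equivalence_iff[OF m])
  also have "\<dots> \<longleftrightarrow> acyc_fib M q"
    using fib_equivalence_acyc_fib[OF m'(12,5,18,17)] acyc_fib_equivalence[OF _ m'(5)] m'(17) by blast
  also have "\<dots> \<longleftrightarrow> (\<forall>i\<in>I. \<forall>x. hom M (src M i) (src M f) x \<longrightarrow> pi_surj M i (i1 i) (i2 i) (c i) f x)"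
  proof
    assume "acyc_fib M q"
    then show "\<forall>i\<in>I. \<forall>x. hom M (src M i) (src M f) x \<longrightarrow> pi_surj M i (i1 i) (i2 i) (c i) f x"
      using acyc_fib_pi_surj[OF m _ i] by blast
  next
    assume "\<forall>i\<in>I. \<forall>x. hom M (src M i) (src M f) x \<longrightarrow> pi_surj M i (i1 i) (i2 i) (c i) f x"
    then have "\<forall>i\<in>I. lifts M i q" using pi_surj_lifts[OF m i] by blast
    moreover have "fibrant M (src M q)" "fibrant M (tgt M q)" using m'(17,18) q by auto
    ultimately show "acyc_fib M q"
      using assms(2) m'(12) by (auto simp: pseudo_generating_def)
  qed
  finally show ?thesis .
qed

end
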